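(* One has $$\mathcal M(\Gamma(16))_{\frac14\mathbb M}=\mathcal M(16)_{\langle\frac14^*,\chi_{16}\rangle}=\mathcal M(4)_{\langle\frac14^*,\chi_{16},c_{16},b_{16}\rangle},$$ $$\mathcal S(\Gamma(16))_{\frac14\mathbb M}=\mathcal M(\Gamma(16))_{\frac14\mathbb M}\,\eta^{3/2}.$$ Here the first line means that for every integer $k\ge0$, as (internal direct sums of) spaces of functions, $$\mathcal M(\Gamma(16))_{k/4}=\bigoplus_{j=0}^3\mathcal M(16)_{(\frac k4^*,\chi_{16}^j)}=\bigoplus_{j,l,m=0}^3\mathcal M(4)_{(\frac k4^*,\chi_{16}^jc_{16}^lb_{16}^m)}.$$
   Context: $\mathbb M=\{0,1,2,\dots\}$; $\mathcal H$ is the upper half plane, $q^r=e^{2\pi i r\tau}$. $\Gamma(N)$ is the principal congruence subgroup; $\Gamma_0(N)$ (resp. $\Gamma^0(N)$) is the group of $\begin{pmatrix}a&b\\c&d\end{pmatrix}\in\mathrm{SL}_2(\mathbb Z)$ with $N\mid c$ (resp. $N\mid b$). $\eta=q^{1/24}\prod_{n\ge1}(1-q^n)$, $\eta^{3/2}=q^{1/16}\prod_{n\ge1}(1-q^n)^{3/2}$ (principal branches). For $\gamma=\begin{pmatrix}a&b\\c&d\end{pmatrix}\in\Gamma_0(2)\cap\Gamma^0(2)$ let $b_{16}(\gamma)=e^{2\pi i bd/16}$, $c_{16}(\gamma)=e^{-2\pi i cd/16}$ and $\chi_4(d)=(-1)^{(d-1)/2}$. The automorphy factor of (formal) weight $\frac34^*$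 is $J_{\frac34^*}(\gamma,\tau)=\big(c_{16}(\gamma)b_{16}(\gamma)\big)^{-1}\eta^{3/2}(\gamma\tau)/\eta^{3/2}(\tau)$, that of weight $1^*$ is $\chi_4(d)(c\tau+d)$, and factors multiply when weights add; so $$J_{\frac14^*}(\gamma,\tau)=\chi_4(d)(c\tau+d)/J_{\frac34^*}(\gamma,\tau),\qquad J_{\frac k4^*}=J_{\frac14^*}^k .$$ For $\gamma\in\Gamma(16)$ the weight $\frac k4$ factor is $J_{k/4}=J_{\frac k4^*}$, so that $J_{3/4}(\gamma,\tau)=\eta^{3/2}(\gamma\tau)/\eta^{3/2}(\tau)$ and $J_1(\gamma,\tau)=c\tau+d$. For a congruence subgroup $\varGamma\subset\Gamma_0(2)\cap\Gamma^0(2)$ and a map $\chi:\varGamma\to\mathbb C^\times$, $\mathcal M(\varGamma)_{(\frac k4^*,\chi)}$ is the space of holomorphic $f$ on $\mathcal H$ with $f(\gamma\tau)=\chi(\gamma)J_{\frac k4^*}(\gamma,\tau)f(\tau)$ for all $\gamma\in\varGamma$ and holomorphic at the cusps, i.e. $|c\tau+d|^{-k/4}\big|f\big(\frac{a\tau+b}{c\tau+d}\big)\big|$ is bounded as $\operatorname{Im}\tau\to\infty$ for every $\begin{pmatrix}a&b\\c&d\end{pmatrix}\in\mathrm{SL}_2(\mathbb Z)$; $\mathcal S$ denotes the subspaces where these all tend to $0$. $\mathcal M(\Gamma(16))_{k/4}$, $\mathcal S(\Gamma(16))_{k/4}$ are defined with $\chi=1$; $\mathcal M(\Gamma(16))_{\frac14\mathbb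 M}=\bigoplus_{k\in\mathbb M}\mathcal M(\Gamma(16))_{k/4}$, similarly $\mathcal S$. $\chi_{16}$ is the character of $(\mathbb Z/16\mathbb Z)^\times$ with $\chi_{16}(5)=i$, $\chi_{16}(-1)=1$, regarded as a function of $\gamma$ through $d$. $\mathcal M(N)$ abbreviates $\mathcal M(\Gamma_0(N)\cap\Gamma^0(N))$; $\mathcal M(16)_{\langle\frac14^*,\chi_{16}\rangle}$ is the direct sum of the $\mathcal M(16)_{(\frac k4^*,\chi_{16}^j)}$ ($k\in\mathbb M$, $0\le j\le3$), and $\mathcal M(4)_{\langle\frac14^*,\chi_{16},c_{16},b_{16}\rangle}$ is the direct sum of the $\mathcal M(4)_{(\frac k4^*,\chi_{16}^jc_{16}^lb_{16}^m)}$ ($k\in\mathbb M$, $0\le j,l,m\le3$). *)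

theory Defs
  imports "HOL-Complex_Analysis.Complex_Analysis" "HOL-Number_Theory.Cong"
begin

definition SL2Z :: "(int^2^2) set" where
  "SL2Z = {\<gamma>. det \<gamma> = 1}"

definition Gamma_principal :: "int \<Rightarrow> (int^2^2) set" where
  "Gamma_principal N = {\<gamma> \<in> SL2Z. [\<gamma>$1$1 = 1] (mod N) \<and> [\<gamma>$1$2 = 0] (mod N) \<and>
                        [\<gamma>$2$1 = 0] (mod N) \<and> [\<gamma>$2$2 = 1] (mod N)}"

definition Gamma_lower0 :: "int \<Rightarrow> (int^2^2) set" where
  "Gamma_lower0 N = {\<gamma> \<in> SL2Z. N dvd \<gamma>$2$1}"

definition Gamma_upper0 :: "int \<Rightarrow> (int^2^2) set" where
  "Gamma_upper0 N = {\<gamma> \<in> SL2Z. N dvd \<gamma>$1$2}"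

definition upper_half_plane :: "complex set" where
  "upper_half_plane = {\<tau>. Im \<tau> > 0}"

definition denom :: "int^2^2 \<Rightarrow> complex \<Rightarrow> complex" where
  "denom \<gamma> \<tau> = of_int (\<gamma>$2$1) * \<tau> + of_int (\<gamma>$2$2)"

definition mobius :: "int^2^2 \<Rightarrow> complex \<Rightarrow> complex" where
  "mobius \<gamma> \<tau> = (of_int (\<gamma>$1$1) * \<tau> + of_int (\<gamma>$1$2)) / denom \<gamma> \<tau>"

text \<open>
  Functions on the upper half plane are represented by functions on the complex numbers that
  vanish outside it, so that equality of functions on the upper half plane is equality.
  The operator \<open>powr\<close> is the principal branch of the complex power.
\<close>

definition eta32 :: "complex \<Rightarrow> complex" where
  "eta32 \<tau> =
    (if \<tau> \<in> upper_half_plane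
     then exp (2 * pi * \<i> * \<tau> / 16) *
          (\<Prod>n. (1 - exp (2 * pi * \<i> * of_nat (Suc n) * \<tau>)) powr (3/2))
     else 0)"

definition b16 :: "int^2^2 \<Rightarrow> complex" where
  "b16 \<gamma> = exp (2 * pi * \<i> * of_int (\<gamma>$1$2 * \<gamma>$2$2) / 16)"

definition c16 :: "int^2^2 \<Rightarrow> complex" where
  "c16 \<gamma> = exp (- 2 * pi * \<i> * of_int (\<gamma>$2$1 * \<gamma>$2$2) / 16)"

text \<open>Only used for odd \<open>d\<close>.\<close>

definition chi4 :: "int \<Rightarrow> complex" where
  "chi4 d = (-1) powi ((d - 1) div 2)"

text \<open>
  Every odd integer is congruent to some \<open>\<plusminus>5\<^sup>k\<close> modulo 16, where \<open>k\<close> is determined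
  modulo 4. The lemmas below show that this is the unique character with the prescribed
  values at \<open>5\<close> and \<open>-1\<close>.
\<close>

definition chi16 :: "int \<Rightarrow> complex" where
  "chi16 d = (if even d then 0
              else \<i> ^ (LEAST k. [d = 5 ^ k] (mod 16) \<or> [d = - (5 ^ k)] (mod 16)))"

lemma chi16_cong:
  assumes "[d = e] (mod 16)"
  shows "chi16 d = chi16 e"
proof -
  have "even d \<longleftrightarrow> even e"
    using assms cong_dvd_iff[of d e 2] cong_dvd_modulus[of d e 16 2] by simp
  moreover have "[d = x] (mod 16) \<longleftrightarrow> [e = x] (mod 16)" for x
    using assms cong_sym cong_trans by blast
  ultimately show ?thesis by (simp add: chi16_def)
qed

lemma chi16_eqI:
  assumes "odd d" "[d = 5 ^ n] (mod 16) \<or> [d = - (5 ^ n)] (mod 16)"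
    and "\<And>m. m < n \<Longrightarrow> \<not> ([d = 5 ^ m] (mod 16) \<or> [d = - (5 ^ m)] (mod 16))"
  shows "chi16 d = \<i> ^ n"
proof -
  have "(LEAST k. [d = 5 ^ k] (mod 16) \<or> [d = - (5 ^ k)] (mod 16)) = n"
    using assms(2,3) by (intro Least_equality) (auto simp: not_less[symmetric])
  then show ?thesis using assms(1) by (simp add: chi16_def)
qed

lemma chi16_residues:
  "chi16 1 = 1" "chi16 3 = -\<i>" "chi16 5 = \<i>" "chi16 7 = -1"
  "chi16 9 = -1" "chi16 11 = \<i>" "chi16 13 = -\<i>" "chi16 15 = 1"
proof -
  have less: "m = 0" if "m < 1" for m :: nat using that by simp
  have less2: "m = 0 \<or> m = 1" if "m < 2" for m :: nat using that by auto
  have less3: "m = 0 \<or> m = 1 \<or> m = 2" if "m < 3" for m :: nat using that by auto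
  show "chi16 1 = 1" "chi16 15 = 1"
    using chi16_eqI[of 1 0] chi16_eqI[of 15 0] by (simp_all add: cong_def)
  have "chi16 5 = \<i> ^ 1" "chi16 11 = \<i> ^ 1"
    by (rule chi16_eqI; force simp: cong_def dest: less)+
  then show "chi16 5 = \<i>" "chi16 11 = \<i>" by simp_all
  have "chi16 7 = \<i> ^ 2" "chi16 9 = \<i> ^ 2"
    by (rule chi16_eqI; force simp: cong_def dest: less2)+
  then show "chi16 7 = -1" "chi16 9 = -1" by simp_all
  have "chi16 3 = \<i> ^ 3" "chi16 13 = \<i> ^ 3"
    by (rule chi16_eqI; force simp: cong_def dest: less3)+
  then show "chi16 3 = -\<i>" "chi16 13 = -\<i>" by (simp_all add: power3_eq_cube)
qed

lemma odd_residues_16: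
  fixes d :: int
  assumes "odd d"
  shows "d mod 16 \<in> {1, 3, 5, 7, 9, 11, 13, 15}"
proof -
  have "odd (d mod 16)" using assms by (simp add: dvd_mod_iff)
  then obtain k where k: "d mod 16 = 2 * k + 1" by (rule oddE)
  have "0 \<le> d mod 16" "d mod 16 < 16" by simp_all
  then have "k = 0 \<or> k = 1 \<or> k = 2 \<or> k = 3 \<or> k = 4 \<or> k = 5 \<or> k = 6 \<or> k = 7"
    unfolding k by linarith
  then show ?thesis using k by auto
qed

lemma chi16_mod: "chi16 (d mod 16) = chi16 d"
  by (rule chi16_cong) simp

lemma chi16_5: "chi16 5 = \<i>"
  by (fact chi16_residues)

lemma chi16_minus_1: "chi16 (- 1) = 1"
  using chi16_mod[of "-1"] chi16_residues by simp

lemma chi16_mult: "chi16 (d * e) = chi16 d * chi16 e"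
proof (cases "odd d \<and> odd e")
  case True
  have "chi16 (d * e) = chi16 (((d mod 16) * (e mod 16)) mod 16)"
    using chi16_mod[of "d * e"] by (simp add: mod_mult_eq)
  also have "\<dots> = chi16 (d mod 16) * chi16 (e mod 16)"
  proof -
    have "chi16 (x * y mod 16) = chi16 x * chi16 y"
      if x: "x \<in> {1, 3, 5, 7, 9, 11, 13, 15}" and y: "y \<in> {1, 3, 5, 7, 9, 11, 13, 15}" for x y
    proof -
      have "\<forall>x \<in> {1, 3, 5, 7, 9, 11, 13, 15}. \<forall>y \<in> {1, 3, 5, 7, 9, 11, 13, 15}.
              chi16 (x * y mod 16) = chi16 x * chi16 y"
        by (simp add: chi16_residues)
      then show ?thesis using x y by blast
    qed
    then show ?thesis using odd_residues_16[of d] odd_residues_16[of e] True by blast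
  qed
  finally show ?thesis by (simp add: chi16_mod)
next
  case False
  then show ?thesis by (auto simp: chi16_def)
qed

lemma chi16_unique:
  assumes cong: "\<And>d e. [d = e] (mod 16) \<Longrightarrow> \<psi> d = \<psi> e"
    and mult: "\<And>d e. odd d \<Longrightarrow> odd e \<Longrightarrow> \<psi> (d * e) = \<psi> d * \<psi> e"
    and 5: "\<psi> 5 = \<i>" and m1: "\<psi> (- 1) = (1 :: complex)" and "odd d"
  shows "\<psi> d = chi16 d"
proof -
  have r: "\<psi> 1 = 1" using mult[of "-1" "-1"] m1 by simp
  have 9: "\<psi> 9 = -1" using mult[of 5 5] 5 cong[of 25 9] by (simp add: cong_def)
  have 13: "\<psi> 13 = -\<i>" using mult[of 9 5] 5 9 cong[of 45 13] by (simp add: cong_def)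
  have "\<psi> 11 = \<i>" using mult[of "-1" 5] m1 5 cong[of "-5" 11] by (simp add: cong_def)
  moreover have "\<psi> 7 = -1" using mult[of "-1" 9] m1 9 cong[of "-9" 7] by (simp add: cong_def)
  moreover have "\<psi> 3 = -\<i>" using mult[of "-1" 13] m1 13 cong[of "-13" 3] by (simp add: cong_def)
  moreover have "\<psi> 15 = 1" using m1 cong[of "-1" 15] by (simp add: cong_def)
  moreover have "\<psi> d = \<psi> (d mod 16)" by (rule cong) (simp add: cong_def)
  ultimately show ?thesis
    using odd_residues_16[OF \<open>odd d\<close>] r 9 13 5 chi16_mod[of d]
    by (auto simp: chi16_residues)
qed

definition J34 :: "int^2^2 \<Rightarrow> complex \<Rightarrow> complex" where
  "J34 \<gamma> \<tau> = inverse (c16 \<gamma> * b16 \<gamma>) * (eta32 (mobius \<gamma> \<tau>) / eta32 \<tau>)"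

definition J14 :: "int^2^2 \<Rightarrow> complex \<Rightarrow> complex" where
  "J14 \<gamma> \<tau> = chi4 (\<gamma>$2$2) * denom \<gamma> \<tau> / J34 \<gamma> \<tau>"

text \<open>
  The factor of formal weight \<open>k/4\<close>. On \<open>Gamma_principal 16\<close> the functions \<open>b16\<close> and
  \<open>c16\<close> are 1, and this is the factor of weight \<open>k/4\<close>.
\<close>

definition J :: "nat \<Rightarrow> int^2^2 \<Rightarrow> complex \<Rightarrow> complex" where
  "J k \<gamma> \<tau> = J14 \<gamma> \<tau> ^ k"

definition automorphic :: "(int^2^2) set \<Rightarrow> nat \<Rightarrow> (int^2^2 \<Rightarrow> complex) \<Rightarrow> (complex \<Rightarrow> complex) set" where
  "automorphic \<Gamma> k chi =
    {f. f holomorphic_on upper_half_plane \<and> (\<forall>\<tau>. \<tau> \<notin> upper_half_plane \<longrightarrow> f \<tau> = 0) \<and>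
        (\<forall>\<gamma>\<in>\<Gamma>. \<forall>\<tau>\<in>upper_half_plane. f (mobius \<gamma> \<tau>) = chi \<gamma> * J k \<gamma> \<tau> * f \<tau>)}"

definition cusp_abs :: "nat \<Rightarrow> (complex \<Rightarrow> complex) \<Rightarrow> int^2^2 \<Rightarrow> complex \<Rightarrow> real" where
  "cusp_abs k f \<gamma> \<tau> = norm (denom \<gamma> \<tau>) powr (- (real k / 4)) * norm (f (mobius \<gamma> \<tau>))"

text \<open>
  The filter \<open>filtercomap Im at_top\<close> is the filter of \<open>Im \<tau> \<rightarrow> \<infinity>\<close>,
  uniformly in \<open>Re \<tau>\<close>.
\<close>

definition modular_forms :: "(int^2^2) set \<Rightarrow> nat \<Rightarrow> (int^2^2 \<Rightarrow> complex) \<Rightarrow> (complex \<Rightarrow> complex) set" where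
  "modular_forms \<Gamma> k chi = {f \<in> automorphic \<Gamma> k chi.
                \<forall>\<gamma>\<in>SL2Z. Bfun (cusp_abs k f \<gamma>) (filtercomap Im at_top)}"

definition cusp_forms :: "(int^2^2) set \<Rightarrow> nat \<Rightarrow> (int^2^2 \<Rightarrow> complex) \<Rightarrow> (complex \<Rightarrow> complex) set" where
  "cusp_forms \<Gamma> k chi = {f \<in> modular_forms \<Gamma> k chi.
                \<forall>\<gamma>\<in>SL2Z. (cusp_abs k f \<gamma> \<longlongrightarrow> 0) (filtercomap Im at_top)}"

definition modular_forms_level :: "int \<Rightarrow> nat \<Rightarrow> (int^2^2 \<Rightarrow> complex) \<Rightarrow> (complex \<Rightarrow> complex) set" where
  "modular_forms_level N = modular_forms (Gamma_lower0 N \<inter> Gamma_upper0 N)"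

text \<open>
  \<open>W\<close> is the internal direct sum of the spaces \<open>V i\<close>, for \<open>i\<close> in the finite set \<open>I\<close>:
  taking sums is a bijection from the families with members in the \<open>V i\<close> to \<open>W\<close>.
\<close>

definition internal_direct_sum ::
    "'i set \<Rightarrow> ('i \<Rightarrow> (complex \<Rightarrow> complex) set) \<Rightarrow> (complex \<Rightarrow> complex) set \<Rightarrow> bool" where
  "internal_direct_sum I V W \<longleftrightarrow>
     bij_betw (\<lambda>F \<tau>. \<Sum>i\<in>I. F i \<tau>) (Pi\<^sub>E I V) W"

text \<open>
  The direct sum over all weights consists of the finitely supported families; index \<open>k\<close>
  stands for weight \<open>k/4\<close>, so multiplication with \<open>eta32\<close> raises the index by 3.
\<close>

definition graded_sum ::
    "(nat \<Rightarrow> (complex \<Rightarrow> complex) set) \<Rightarrow> (nat \<Rightarrow> complex \<Rightarrow> complex) set" where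
  "graded_sum V = {F. (\<forall>k. F k \<in> V k) \<and> finite {k. F k \<noteq> (\<lambda>_. 0)}}"

definition graded_mult ::
    "(nat \<Rightarrow> complex \<Rightarrow> complex) \<Rightarrow> (nat \<Rightarrow> complex \<Rightarrow> complex) \<Rightarrow> nat \<Rightarrow> complex \<Rightarrow> complex" where
  "graded_mult F G k \<tau> = (\<Sum>i\<le>k. F i \<tau> * G (k - i) \<tau>)"

definition homogeneous :: "nat \<Rightarrow> (complex \<Rightarrow> complex) \<Rightarrow> nat \<Rightarrow> complex \<Rightarrow> complex" where
  "homogeneous n f k = (if k = n then f else (\<lambda>_. 0))"

end

theory Submission
  imports Defs "HOL-Real_Asymp.Real_Asymp"
begin

text \<open>
  The whole proof rests on the modular behaviour of \<open>\<eta>\<^sup>6\<close>, the fourth power of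
  \<open>\<eta>\<^bsup>3/2\<^esup>\<close>: for \<open>\<gamma> = (a b; c d)\<close> in \<open>SL\<^sub>2(\<int>)\<close>,
  \<open>\<eta>\<^sup>6(\<gamma>\<tau>) = i\<^bsup>e(\<gamma>)\<^esup> (c\<tau> + d)\<^sup>3 \<eta>\<^sup>6(\<tau>)\<close>, where the exponent
  \<open>e(\<gamma>)\<close> depends modulo 4 only on the entries modulo 4 (\<open>eta32_power4_mobius\<close>).
  The quotient \<open>E(\<gamma>,\<tau>) = (c\<tau> + d) \<eta>\<^bsup>3/2\<^esup>(\<tau>) / \<eta>\<^bsup>3/2\<^esup>(\<gamma>\<tau>)\<close> (\<open>eta_factor\<close>) is obviously
  a cocycle on all of \<open>SL\<^sub>2(\<int>)\<close>. By the transformation law its absolute value is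
  \<open>|c\<tau> + d|\<^bsup>1/4\<^esup>\<close>, and \<open>E\<^sup>4 = c\<tau> + d\<close> on \<open>\<Gamma>(16)\<close>. The factor of weight
  \<open>1/4\<^sup>*\<close> is \<open>E\<close> times \<open>\<chi>\<^sub>4 c\<^sub>1\<^sub>6 b\<^sub>1\<^sub>6\<close>, and on \<open>\<Gamma>\<^sub>0(4) \<inter> \<Gamma>\<^sup>0(4)\<close> each of these
  three functions is a character.

  For the direct sums, let \<open>G\<close> be \<open>\<Gamma>\<^sub>0(4) \<inter> \<Gamma>\<^sup>0(4)\<close> or \<open>\<Gamma>\<^sub>0(16) \<inter> \<Gamma>\<^sup>0(16)\<close>. It
  acts on the forms for \<open>\<Gamma>(16)\<close> by the slash operators of weight \<open>k/4\<^sup>*\<close>, and \<open>\<Gamma>(16)\<close>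
  and \<open>-1\<close> act trivially. The characters \<open>\<chi>\<^sub>1\<^sub>6, c\<^sub>1\<^sub>6, b\<^sub>1\<^sub>6\<close> have order 4 and identify
  the quotient \<open>G / \<plusminus>\<Gamma>(16)\<close> with \<open>(\<int>/4)\<^sup>3\<close>, respectively with \<open>\<int>/4\<close> by \<open>\<chi>\<^sub>1\<^sub>6\<close>
  alone. The summands are the eigenspaces of this finite abelian group, and the projections
  onto them are averages over coset representatives (\<open>character_decomposition\<close>).

  For the cusp forms, every translate of a form by an element of \<open>SL\<^sub>2(\<int>)\<close> is, after division
  by \<open>E\<^sup>k\<close>, a function of \<open>w = q\<^bsup>1/16\<^esup>\<close> on the unit disc. For a cusp form it vanishes at
  \<open>w = 0\<close>, and \<open>\<eta>\<^bsup>3/2\<^esup>\<close> vanishes there to first order only and nowhere else. So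
  \<open>f / \<eta>\<^bsup>3/2\<^esup>\<close> stays bounded at all cusps, and it has weight \<open>(k-3)/4\<close> because
  \<open>E\<^sup>4 = c\<tau> + d\<close> on \<open>\<Gamma>(16)\<close> (\<open>cusp_forms_iff_eta32_multiple\<close>). If \<open>k < 3\<close>, this quotient
  has negative weight, hence tends to 0 at the real axis, that is for \<open>|w| \<rightarrow> 1\<close>, and the
  maximum modulus principle shows that it is 0 (\<open>no_cusp_forms_small_weight\<close>).

  The transformation law under \<open>\<tau> \<mapsto> -1/\<tau>\<close> is proved on the imaginary axis, where it is a
  statement about the real function \<open>\<Sum> ln (1 - e\<^bsup>-2\<pi>ny\<^esup>)\<close>. Expanding the logarithms and then
  the resulting terms \<open>1 / (e\<^bsup>2\<pi>my\<^esup> - 1)\<close> into partial fractions turns this function into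
  a double sum of \<open>y / (m\<^sup>2y\<^sup>2 + k\<^sup>2)\<close> together with a harmonic series. The double sum is
  formally symmetric under \<open>y \<mapsto> 1/y\<close>, but it diverges logarithmically. Truncating
  with \<open>m \<le> M\<close> for \<open>y\<close> and with \<open>k \<le> N \<approx> yM\<close> for \<open>1/y\<close> makes the double sums cancel in the
  limit, and the two harmonic sums leave the term \<open>1/2 ln y\<close> (\<open>euler_log_inversion\<close>).
\<close>

\<comment> \<open>From here on \<open>$\<close> denotes matrix entries only, not the coefficients of a power series.\<close>
no_notation fps_nth (infixl "$" 75)

section \<open>The logarithm of the Euler product on the imaginary axis\<close>

text \<open>
  Logarithmic derivative of the reflection formula \<open>1 / (\<Gamma>(z) \<Gamma>(1 - z)) = sin (\<pi>z) / \<pi>\<close>; it yields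
  the partial fractions of the cotangent from the series of the digamma function.
\<close>

lemma Digamma_reflection:
  fixes z :: complex
  assumes "z \<notin> \<int>"
  shows "(Digamma (1 - z) - Digamma z) * sin (pi * z) = pi * cos (pi * z)"
proof -
  have z: "z \<notin> \<int>\<^sub>\<le>\<^sub>0" "1 - z \<notin> \<int>\<^sub>\<le>\<^sub>0"
    using assms nonpos_Ints_Int[of z] nonpos_Ints_Int[of "1 - z"] Ints_diff[of 1 "1 - z"] by auto
  have eq: "(\<lambda>w. rGamma w * rGamma (1 - w)) = (\<lambda>w::complex. sin (of_real pi * w) / of_real pi)"
    using rGamma_reflection_complex by auto
  have "((\<lambda>w. rGamma w * rGamma (1 - w)) has_field_derivative
          (rGamma z * rGamma (1 - z)) * (Digamma (1 - z) - Digamma z)) (at z)"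
    using z by (auto intro!: derivative_eq_intros simp: algebra_simps)
  moreover have "((\<lambda>w. sin (of_real pi * w) / of_real pi) has_field_derivative cos (pi * z)) (at z)"
    by (auto intro!: derivative_eq_intros)
  ultimately have "(rGamma z * rGamma (1 - z)) * (Digamma (1 - z) - Digamma z) = cos (pi * z)"
    unfolding eq by (rule DERIV_unique)
  then show ?thesis
    using fun_cong[OF eq, of z] by (simp add: field_simps)
qed

lemma summable_lorentz: "summable (\<lambda>k. p / (p\<^sup>2 + (real (Suc k))\<^sup>2))"
proof (rule summable_comparison_test')
  show "summable (\<lambda>k. \<bar>p\<bar> * (1 / real (Suc k)^2))"
    using inverse_squares_sums by (intro summable_mult) (simp add: sums_iff add_ac)
  show "norm (p / (p\<^sup>2 + (real (Suc k))\<^sup>2)) \<le> \<bar>p\<bar> * (1 / real (Suc k)^2)" for k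
  proof -
    have "\<bar>p\<bar> / (p\<^sup>2 + (real (Suc k))\<^sup>2) \<le> \<bar>p\<bar> / (real (Suc k))\<^sup>2"
      by (intro divide_left_mono mult_pos_pos add_nonneg_pos) auto
    then show ?thesis by simp
  qed
qed

text \<open>
  The partial fraction expansion of \<open>coth (\<pi>x) = 1 + 2 / (e\<^bsup>2\<pi>x\<^esup> - 1)\<close>, which is that of the cotangent at
  the point \<open>ix\<close>.
\<close>

lemma planck_partial_fractions:
  assumes x: "x > (0::real)"
  shows "1 / (exp (2 * pi * x) - 1) =
           1 / (2 * pi * x) - 1 / 2 + (\<Sum>k. x / (x\<^sup>2 + (real (Suc k))\<^sup>2)) / pi"
proof -
  define z :: complex where "z = \<i> * of_real x"
  have zI: "z \<notin> \<int>" "- z \<notin> \<int>"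
    using x by (auto simp: z_def complex_eq_iff elim!: Ints_cases)
  have z0: "z \<noteq> 0" using x by (simp add: z_def)
  have "(\<lambda>k. inverse (of_nat (Suc k)) - inverse (w + of_nat k)) sums (Digamma w + euler_mascheroni)"
    if "w \<notin> \<int>" for w :: complex
  proof -
    have "w \<noteq> 0" using that by auto
    then show ?thesis
      using summable_sums[OF summable_Digamma] by (simp add: Digamma_def)
  qed
  from sums_diff[OF this[OF zI(2)] this[OF zI(1)]]
  have "(\<lambda>k. inverse (z + of_nat k) - inverse (- z + of_nat k)) sums (Digamma (- z) - Digamma z)"
    by (simp add: algebra_simps)
  moreover have "inverse (z + of_nat k) - inverse (- z + of_nat k)
      = complex_of_real (x / (x\<^sup>2 + (real k)\<^sup>2)) * (- 2 * \<i>)" for k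
  proof -
    have "z + of_nat k \<noteq> 0" "- z + of_nat k \<noteq> 0" using x by (auto simp: z_def complex_eq_iff)
    moreover have "complex_of_real x ^ 2 + of_nat k ^ 2 = (z + of_nat k) * (- z + of_nat k)"
      by (simp add: z_def algebra_simps power2_eq_square)
    ultimately show ?thesis
      by (simp add: divide_simps) (simp add: z_def algebra_simps)
  qed
  ultimately have "(\<lambda>k. complex_of_real (x / (x\<^sup>2 + (real k)\<^sup>2)) * (- 2 * \<i>))
                     sums (Digamma (- z) - Digamma z)" by simp
  then have D: "(\<lambda>k. complex_of_real (x / (x\<^sup>2 + (real (Suc k))\<^sup>2)) * (- 2 * \<i>))
                     sums (Digamma (- z) - Digamma z - complex_of_real (1 / x) * (- 2 * \<i>))"
    using x by (subst (asm) sums_iff_shift'[of _ 1, symmetric]) (simp add: power2_eq_square)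
  define C where "C = (\<Sum>k. x / (x\<^sup>2 + (real (Suc k))\<^sup>2))"
  have "(\<lambda>k. complex_of_real (x / (x\<^sup>2 + (real (Suc k))\<^sup>2)) * (- 2 * \<i>)) sums (of_real C * (- 2 * \<i>))"
    unfolding C_def by (intro sums_mult2 sums_of_real summable_sums summable_lorentz)
  with D have "Digamma (- z) - Digamma z = of_real (C + 1 / x) * (- 2 * \<i>)"
    by (auto dest: sums_unique2 simp: algebra_simps)
  moreover have "Digamma (1 - z) = Digamma (- z) + \<i> * of_real (1 / x)"
  proof -
    have "\<i> * of_real (1 / x) = 1 / (- z)" using x by (simp add: z_def field_simps)
    then show ?thesis using Digamma_plus1[of "- z"] z0 by simp
  qed
  \<comment> \<open>The term for \<open>k = 0\<close> of the series contributes \<open>-2i/x\<close>, the recurrence contributes \<open>i/x\<close>.\<close>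
  ultimately have "(Digamma (1 - z) - Digamma z) = - \<i> * of_real (2 * C + 1 / x)"
    by (simp add: algebra_simps)
  with Digamma_reflection[OF zI(1)]
  have "- \<i> * of_real (2 * C + 1 / x) * sin (pi * z) = pi * cos (pi * z)" by simp
  moreover have "sin (pi * z) = \<i> * of_real (sinh (pi * x))"
    by (simp add: z_def sin_exp_eq sinh_field_def exp_of_real[symmetric] field_simps)
  moreover have "cos (pi * z) = of_real (cosh (pi * x))"
    by (simp add: z_def cos_exp_eq cosh_field_def exp_of_real[symmetric] field_simps)
  ultimately have *: "- \<i> * of_real (2 * C + 1 / x) * (\<i> * of_real (sinh (pi * x))) = pi * of_real (cosh (pi * x))"
    by simp
  then have "complex_of_real ((2 * C + 1 / x) * sinh (pi * x)) = of_real (pi * cosh (pi * x))"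
  proof -
    have "- \<i> * X * (\<i> * Y) = X * Y" for X Y :: complex
      by (simp add: complex_eq_iff algebra_simps)
    with * show ?thesis by simp
  qed
  then have *: "(2 * C + 1 / x) * sinh (pi * x) = pi * cosh (pi * x)"
    unfolding of_real_eq_iff .
  define u where "u = exp (pi * x)"
  have u: "u > 1" using x by (simp add: u_def)
  have e: "exp (2 * pi * x) = u\<^sup>2" by (simp add: u_def exp_double[symmetric] mult_ac)
  have "sinh (pi * x) = (u - 1 / u) / 2" "cosh (pi * x) = (u + 1 / u) / 2"
    by (simp_all add: u_def sinh_field_def cosh_field_def exp_minus field_simps)
  with * u have "(2 * C + 1 / x) * (u\<^sup>2 - 1) = pi * (u\<^sup>2 + 1)"
    by (simp add: field_simps power2_eq_square)
  moreover have "u\<^sup>2 > 1" using u by (simp add: one_less_power)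
  moreover have "(2 * C + 1 / x) * (u\<^sup>2 - 1) = pi * (u\<^sup>2 + 1) \<Longrightarrow> u\<^sup>2 > 1 \<Longrightarrow>
      2 * C + 1 / x = pi + 2 * (pi / (u\<^sup>2 - 1))"
    by (simp add: divide_simps) (simp add: algebra_simps)
  ultimately have C: "C = pi / (u\<^sup>2 - 1) + pi / 2 - 1 / (2 * x)"
    by simp
  have "C / pi = 1 / (u\<^sup>2 - 1) + 1 / 2 - 1 / (2 * pi * x)"
    unfolding C by (simp add: add_divide_distrib diff_divide_distrib mult_ac)
  then show ?thesis unfolding C_def[symmetric] e by simp
qed

text \<open>
  Comparison of a series with an integral: \<open>t \<mapsto> -arctan (p / t)\<close> is a primitive of the decreasing
  function \<open>p / (p\<^sup>2 + t\<^sup>2)\<close>, and it vanishes at infinity.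
\<close>

lemma arctan_tail_bounds:
  fixes p :: real and N :: nat
  assumes p: "p > 0" and N: "N > 0"
  shows "arctan (p / real (N + 1)) \<le> (\<Sum>k. p / (p\<^sup>2 + (real (Suc (k + N)))\<^sup>2))"
    and "(\<Sum>k. p / (p\<^sup>2 + (real (Suc (k + N)))\<^sup>2)) \<le> arctan (p / real N)"
proof -
  define A where "A = (\<lambda>k. arctan (p / real k))"
  define a where "a = (\<lambda>k. p / (p\<^sup>2 + (real k)\<^sup>2))"
  have step: "a (Suc k) \<le> A k - A (Suc k) \<and> A k - A (Suc k) \<le> a k" if k: "k > 0" for k
  proof -
    have "((\<lambda>t. arctan (p / t)) has_real_derivative - (p / (p\<^sup>2 + t\<^sup>2))) (at t)"
      if "real k \<le> t" for t
    proof -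
      have "t > 0" using that k by auto
      then show ?thesis
        by (auto intro!: derivative_eq_intros simp: divide_simps power2_eq_square)
    qed
    from MVT2[of "real k" "real (Suc k)", OF _ this] obtain \<xi> where
      \<xi>: "real k < \<xi>" "\<xi> < real (Suc k)" "A (Suc k) - A k = - (p / (p\<^sup>2 + \<xi>\<^sup>2))"
      unfolding A_def by auto
    have "(real k)\<^sup>2 \<le> \<xi>\<^sup>2" "\<xi>\<^sup>2 \<le> (real (Suc k))\<^sup>2"
      using \<xi> k by (intro power_mono; simp)+
    then have "a (Suc k) \<le> p / (p\<^sup>2 + \<xi>\<^sup>2)" "p / (p\<^sup>2 + \<xi>\<^sup>2) \<le> a k"
      unfolding a_def using p k by (intro divide_left_mono; auto intro!: add_pos_nonneg mult_pos_pos)+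
    with \<xi> show ?thesis by simp
  qed
  have lim: "(\<lambda>k. A (k + n)) \<longlonglongrightarrow> 0" for n
  proof -
    have "A \<longlonglongrightarrow> arctan 0" unfolding A_def
      by (intro tendsto_arctan tendsto_divide_0[OF tendsto_const] filterlim_real_sequentially filterlim_at_top_imp_at_infinity)
    then show ?thesis by (simp add: LIMSEQ_ignore_initial_segment)
  qed
  have tele: "(\<lambda>k. A (k + n) - A (Suc (k + n))) sums A n" for n
    using telescope_sums'[OF lim[of n]] by simp
  have sm: "summable (\<lambda>k. a (Suc (k + n)))" for n
    using summable_ignore_initial_segment[OF summable_lorentz[of p], of n] by (simp add: a_def)
  have "(\<Sum>k. a (Suc (k + N))) \<le> A N"
    using suminf_le[OF _ sm sums_summable[OF tele[of N]]] step N sums_unique[OF tele[of N]] by fastforce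
  then show "(\<Sum>k. p / (p\<^sup>2 + (real (Suc (k + N)))\<^sup>2)) \<le> arctan (p / real N)"
    by (simp add: a_def A_def)
  have "A (N + 1) \<le> (\<Sum>k. a (Suc (k + N)))"
    using suminf_le[OF _ sums_summable[OF tele[of "N + 1"]] sm[of N]] step N
      sums_unique[OF tele[of "N+1"]] by fastforce
  then show "arctan (p / real (N + 1)) \<le> (\<Sum>k. p / (p\<^sup>2 + (real (Suc (k + N)))\<^sup>2))"
    by (simp add: a_def A_def)
qed

text \<open>
  The limit is the integral of \<open>g\<close>, but only the convergence matters: the same limit will
  occur twice with opposite signs.
\<close>

lemma riemann_sum_LIMSEQ:
  fixes g :: "real \<Rightarrow> real"
  assumes g: "continuous_on {0..1} g"
  shows "\<exists>I. (\<lambda>M. (\<Sum>m<M. g (real (Suc m) / real M)) / real M) \<longlonglongrightarrow> I"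
proof -
  obtain G where G: "\<And>x. x \<in> {0..1} \<Longrightarrow> (G has_vector_derivative g x) (at x within {0..1})"
    using antiderivative_continuous[OF g] by blast
  have "(\<lambda>M. (\<Sum>m<M. g (real (Suc m) / real M)) / real M) \<longlonglongrightarrow> G 1 - G 0"
  proof (rule LIMSEQ_I)
    fix e :: real assume e: "e > 0"
    have "uniformly_continuous_on {0..1} g"
      using g by (intro compact_uniformly_continuous) auto
    then obtain d where d: "d > 0" "\<And>x y. x \<in> {0..1} \<Longrightarrow> y \<in> {0..1} \<Longrightarrow> dist y x < d \<Longrightarrow> dist (g y) (g x) < e"
      using e unfolding uniformly_continuous_on_def by meson
    obtain K :: nat where K: "K > 0" "1 / real K < d"
      using d(1) by (metis nat_approx_posE zero_less_Suc)
    have "norm ((\<Sum>m<M. g (real (Suc m) / real M)) / real M - (G 1 - G 0)) < e" if M: "M \<ge> K" for M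
    proof -
      have M0: "M > 0" using K M by simp
      have "1 / real M \<le> 1 / real K" using K M by (intro divide_left_mono) auto
      with K have Md: "1 / real M < d" by simp
      define t where "t = (\<lambda>m. real m / real M)"
      have step: "\<bar>g (t (Suc m)) / real M - (G (t (Suc m)) - G (t m))\<bar> < e / real M" if m: "m < M" for m
      proof -
        have t: "0 \<le> t m" "t m < t (Suc m)" "t (Suc m) \<le> 1" "t (Suc m) - t m = 1 / real M"
          using m M0 by (auto simp: t_def field_simps)
        have "\<exists>\<xi>\<in>{t m<..<t (Suc m)}. G (t (Suc m)) - G (t m) = (t (Suc m) - t m) * g \<xi>"
        proof -
          have "\<exists>\<xi>\<in>{t m<..<t (Suc m)}. G (t (Suc m)) - G (t m) = (\<lambda>x. x * g \<xi>) (t (Suc m) - t m)"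
          proof (rule mvt_simple)
            show "(G has_derivative (\<lambda>y. y * g x)) (at x within {t m..t (Suc m)})"
              if "t m \<le> x" "x \<le> t (Suc m)" for x
            proof -
              have "(G has_vector_derivative g x) (at x within {t m..t (Suc m)})"
                using t that by (intro has_vector_derivative_within_subset[OF G]) auto
              then show ?thesis by (simp add: has_vector_derivative_def mult.commute)
            qed
          qed (use t in auto)
          then show ?thesis by simp
        qed
        then obtain \<xi> where \<xi>: "t m < \<xi>" "\<xi> < t (Suc m)" "G (t (Suc m)) - G (t m) = g \<xi> / real M"
          using t(4) by auto
        have "dist (g (t (Suc m))) (g \<xi>) < e"
          using t \<xi> Md by (intro d(2)) (auto simp: dist_real_def)
        moreover have "g (t (Suc m)) / real M - (G (t (Suc m)) - G (t m)) = (g (t (Suc m)) - g \<xi>) / real M"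
          by (simp add: \<xi>(3) diff_divide_distrib)
        ultimately show ?thesis using M0 by (simp add: dist_real_def divide_strict_right_mono)
      qed
      have "(\<Sum>m<M. G (t (Suc m)) - G (t m)) = G 1 - G 0"
        using M0 by (subst sum_lessThan_telescope) (simp add: t_def)
      then have "(\<Sum>m<M. g (real (Suc m) / real M)) / real M - (G 1 - G 0)
          = (\<Sum>m<M. g (t (Suc m)) / real M - (G (t (Suc m)) - G (t m)))"
        by (simp add: sum_subtractf sum_divide_distrib t_def)
      also have "\<bar>\<dots>\<bar> \<le> (\<Sum>m<M. \<bar>g (t (Suc m)) / real M - (G (t (Suc m)) - G (t m))\<bar>)"
        by (rule sum_abs)
      also have "\<dots> < (\<Sum>m<M. e / real M)" using M0 step by (intro sum_strict_mono) auto
      also have "\<dots> = e" using M0 by simp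
      finally show ?thesis by simp
    qed
    then show "\<exists>no. \<forall>n\<ge>no. norm ((\<Sum>m<n. g (real (Suc m) / real n)) / real n - (G 1 - G 0)) < e"
      by blast
  qed
  then show ?thesis by blast
qed

lemma abs_arctan_diff_le: "\<bar>arctan a - arctan b\<bar> \<le> \<bar>a - b\<bar>" for a b :: real
proof -
  have "norm (arctan a - arctan b) \<le> 1 * norm (a - b)"
  proof (rule field_differentiable_bound[of UNIV arctan "\<lambda>x. inverse (1 + x\<^sup>2)"])
    show "norm (inverse (1 + x\<^sup>2)) \<le> 1" for x :: real
      by (simp add: inverse_le_1_iff)
  qed (auto intro!: derivative_eq_intros)
  then show ?thesis by simp
qed

text \<open>
  For \<open>t = 1\<close> this is the Riemann sum of \<open>arctan x / x\<close> on \<open>[0, 1]\<close> with step \<open>1 / M\<close>.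
\<close>

definition arctan_sum :: "nat \<Rightarrow> real \<Rightarrow> real" where
  "arctan_sum M t = (\<Sum>m<M. arctan (t * real (Suc m) / real M) / real (Suc m))"

text \<open>
  The parameter \<open>t\<close> absorbs the rounding in \<open>N \<approx> yM\<close>: as \<open>arctan\<close> is 1-Lipschitz, changing \<open>t\<close>
  from 1 changes the sum by at most \<open>|t - 1|\<close>, uniformly in the number of terms.
\<close>

lemma arctan_sum_LIMSEQ:
  "\<exists>I. \<forall>N t. filterlim N at_top sequentially \<longrightarrow> t \<longlonglongrightarrow> 1 \<longrightarrow> (\<lambda>j::nat. arctan_sum (N j) (t j)) \<longlonglongrightarrow> I"
proof -
  define g :: "real \<Rightarrow> real" where "g = (\<lambda>x. if x = 0 then 1 else arctan x / x)"
  have "((\<lambda>x::real. arctan x / x) \<longlongrightarrow> 1) (at 0)" by real_asymp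
  then have "(g \<longlongrightarrow> 1) (at 0)"
    by (rule Lim_transform_eventually) (auto simp: g_def eventually_at_filter)
  then have "isCont g 0" by (simp add: isCont_def g_def)
  moreover have "isCont g x" if "x \<noteq> 0" for x
  proof -
    have "isCont (\<lambda>x. arctan x / x) x" using that by (intro continuous_intros) auto
    moreover have "\<forall>\<^sub>F u in nhds x. g u = arctan u / u"
      using t1_space_nhds[OF that] by eventually_elim (simp add: g_def)
    ultimately show ?thesis using isCont_cong[of g "\<lambda>x. arctan x / x" x] by simp
  qed
  ultimately have "continuous_on {0..1} g"
    by (metis continuous_at_imp_continuous_on)
  then obtain I where I: "(\<lambda>M. (\<Sum>m<M. g (real (Suc m) / real M)) / real M) \<longlonglongrightarrow> I"
    using riemann_sum_LIMSEQ by blast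
  have "(\<Sum>m<M. g (real (Suc m) / real M)) / real M = arctan_sum M 1" for M
    unfolding arctan_sum_def sum_divide_distrib
    by (intro sum.cong refl) (auto simp: g_def)
  with I have I: "(\<lambda>M. arctan_sum M 1) \<longlonglongrightarrow> I" by simp
  have diff: "\<bar>arctan_sum M t - arctan_sum M 1\<bar> \<le> \<bar>t - 1\<bar>" for M t
  proof -
    have "\<bar>arctan_sum M t - arctan_sum M 1\<bar> \<le>
        (\<Sum>m<M. \<bar>arctan (t * real (Suc m) / real M) / real (Suc m) - arctan (1 * real (Suc m) / real M) / real (Suc m)\<bar>)"
      unfolding arctan_sum_def sum_subtractf[symmetric] by (rule sum_abs)
    also have "\<dots> \<le> (\<Sum>m<M. \<bar>t - 1\<bar> / real M)"
    proof (rule sum_mono)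
      fix m
      have "\<bar>arctan (t * real (Suc m) / real M) - arctan (1 * real (Suc m) / real M)\<bar>
              \<le> \<bar>t * real (Suc m) / real M - 1 * real (Suc m) / real M\<bar>" by (rule abs_arctan_diff_le)
      also have "\<dots> = \<bar>(t - 1) * (real (Suc m) / real M)\<bar>"
        by (simp add: algebra_simps diff_divide_distrib)
      also have "\<dots> = \<bar>t - 1\<bar> / real M * real (Suc m)" by (simp add: abs_mult)
      finally show "\<bar>arctan (t * real (Suc m) / real M) / real (Suc m) - arctan (1 * real (Suc m) / real M) / real (Suc m)\<bar>
                     \<le> \<bar>t - 1\<bar> / real M"
        by (simp only: diff_divide_distrib[symmetric] abs_divide abs_of_nat pos_divide_le_eq of_nat_0_less_iff zero_less_Suc)
    qed
    also have "\<dots> \<le> \<bar>t - 1\<bar>" by (cases "M = 0") auto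
    finally show ?thesis .
  qed
  have "(\<lambda>j. arctan_sum (N j) (t j)) \<longlonglongrightarrow> I"
    if N: "filterlim N at_top sequentially" and t: "t \<longlonglongrightarrow> 1" for N t
  proof -
    have "(\<lambda>j. \<bar>t j - 1\<bar>) \<longlonglongrightarrow> 0" using tendsto_diff[OF t tendsto_const[of 1]] by (simp add: tendsto_rabs_zero)
    then have "(\<lambda>j. arctan_sum (N j) (t j) - arctan_sum (N j) 1) \<longlonglongrightarrow> 0"
      by (rule Lim_null_comparison[rotated]) (use diff in auto)
    from tendsto_add[OF this filterlim_compose[OF I N]] show ?thesis by simp
  qed
  then show ?thesis by blast
qed

text \<open>
  Both sides are the sum of \<open>q\<^bsup>mn\<^esup> / m\<close> over all \<open>m, n \<ge> 1\<close>, summed first over \<open>n\<close> (geometric series)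
  or first over \<open>m\<close> (logarithmic series).
\<close>

lemma planck_sums_ln_euler_product:
  assumes y: "y > (0::real)"
  shows "(\<lambda>m. 1 / real (Suc m) * (1 / (exp (2 * pi * (real (Suc m) * y)) - 1))) sums
           - (\<Sum>n. ln (1 - exp (- 2 * pi * y) ^ Suc n))"
    and "summable (\<lambda>n. ln (1 - exp (- 2 * pi * y) ^ Suc n))"
proof -
  define q where "q = exp (- 2 * pi * y)"
  have q: "0 < q" "q < 1" using y by (auto simp: q_def)
  have qn: "0 < q ^ Suc n" "q ^ Suc n < 1" for n
    using q power_strict_decreasing[of 0 "Suc n" q] by (simp_all del: power_Suc)
  define f where "f = (\<lambda>(m, n). (q ^ Suc n) ^ Suc m / real (Suc m))"
  define g where "g = (\<lambda>m. 1 / real (Suc m) * (1 / (exp (2 * pi * (real (Suc m) * y)) - 1)))"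
  have g_eq: "g m = (q ^ Suc m / (1 - q ^ Suc m)) / real (Suc m)" for m
  proof -
    have "exp (2 * pi * (real (Suc m) * y)) = 1 / q ^ Suc m"
      by (simp add: q_def exp_of_nat_mult[symmetric] exp_minus[symmetric] inverse_eq_divide[symmetric] algebra_simps del: power_Suc of_nat_Suc)
    moreover have "1 / (1 / r - 1) = r / (1 - r)" if "0 < r" "r < 1" for r :: real
      using that by (simp add: divide_simps)
    from this[OF qn[of m]] have "1 / (1 / q ^ Suc m - 1) = q ^ Suc m / (1 - q ^ Suc m)" .
    ultimately show ?thesis unfolding g_def by simp
  qed
  have f1: "((\<lambda>n. f (m, n)) has_sum g m) UNIV" for m
  proof (rule sums_nonneg_imp_has_sum)
    have "(\<lambda>n. (q ^ Suc m) ^ n) sums (1 / (1 - q ^ Suc m))"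
      using qn[of m] by (intro geometric_sums) simp
    then have "(\<lambda>n. (q ^ Suc m / real (Suc m)) * (q ^ Suc m) ^ n) sums ((q ^ Suc m / real (Suc m)) * (1 / (1 - q ^ Suc m)))"
      by (rule sums_mult)
    moreover have "(q ^ Suc m / real (Suc m)) * (q ^ Suc m) ^ n = f (m, n)" for n
      by (simp add: f_def power_mult[symmetric] power_add[symmetric] algebra_simps del: of_nat_Suc)
    ultimately show "(\<lambda>n. f (m, n)) sums g m" by (simp add: g_eq mult_ac del: power_Suc of_nat_Suc)
  qed (use q in \<open>auto simp: f_def\<close>)
  have f2: "((\<lambda>m. f (m, n)) has_sum (- ln (1 - q ^ Suc n))) UNIV" for n
  proof (rule sums_nonneg_imp_has_sum)
    have "(\<lambda>k. - ((q ^ Suc n) ^ k) / real k) sums ln (1 - q ^ Suc n)"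
      using ln_series'[of "- (q ^ Suc n)"] qn[of n] by simp
    then have "(\<lambda>k. (q ^ Suc n) ^ k / real k) sums (- ln (1 - q ^ Suc n))"
      using sums_minus by fastforce
    then show "(\<lambda>m. f (m, n)) sums (- ln (1 - q ^ Suc n))"
      by (subst (asm) sums_iff_shift'[of _ 1, symmetric]) (simp add: f_def)
  qed (use q in \<open>auto simp: f_def\<close>)
  have "summable g"
  proof (rule summable_comparison_test')
    show "summable (\<lambda>m. q ^ Suc m / (1 - q))"
      using q by (intro summable_divide) (simp add: summable_geometric)
    show "norm (g m) \<le> q ^ Suc m / (1 - q)" for m
    proof -
      have "q ^ Suc m \<le> q ^ 1" using q by (intro power_decreasing) auto
      then have "q ^ Suc m / (1 - q ^ Suc m) \<le> q ^ Suc m / (1 - q)"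
        using qn[of m] q by (intro divide_left_mono mult_pos_pos) auto
      moreover have "(q ^ Suc m / (1 - q ^ Suc m)) / real (Suc m) \<le> (q ^ Suc m / (1 - q ^ Suc m)) / 1"
        using qn[of m] by (intro divide_left_mono divide_nonneg_pos) auto
      ultimately show ?thesis using qn[of m] by (simp add: g_eq del: power_Suc of_nat_Suc)
    qed
  qed
  then have gs: "g summable_on UNIV"
    by (rule summable_nonneg_imp_summable_on) (use qn in \<open>simp add: g_eq less_imp_le del: power_Suc of_nat_Suc\<close>)
  have "f summable_on (UNIV \<times> UNIV)"
    by (rule summable_on_SigmaI[OF f1 gs]) (use q in \<open>auto simp: f_def\<close>)
  then obtain T where T: "(f has_sum T) (UNIV \<times> UNIV)" by (auto simp: summable_on_def)
  have gT: "(g has_sum T) UNIV" by (rule has_sum_SigmaD[OF T f1])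
  have "((\<lambda>n. - ln (1 - q ^ Suc n)) has_sum T) UNIV"
    by (rule has_sum_SigmaD[OF iffD1[OF has_sum_swap T]]) (use f2 in simp)
  then have "(\<lambda>n. - ln (1 - q ^ Suc n)) sums T" by (rule has_sum_imp_sums)
  from sums_minus[OF this] have L: "(\<lambda>n. ln (1 - q ^ Suc n)) sums (- T)" by simp
  then have "T = - (\<Sum>n. ln (1 - q ^ Suc n))" by (simp add: sums_iff)
  with has_sum_imp_sums[OF gT]
  show "(\<lambda>m. 1 / real (Suc m) * (1 / (exp (2 * pi * (real (Suc m) * y)) - 1))) sums
           - (\<Sum>n. ln (1 - exp (- 2 * pi * y) ^ Suc n))"
    by (simp add: g_def q_def)
  show "summable (\<lambda>n. ln (1 - exp (- 2 * pi * y) ^ Suc n))"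
    using L by (simp add: q_def sums_iff)
qed

definition lorentz_tail :: "nat \<Rightarrow> real \<Rightarrow> real" where
  "lorentz_tail N p = (\<Sum>k. p / (p\<^sup>2 + (real (Suc (k + N)))\<^sup>2))"

text \<open>
  The logarithm of \<open>\<Prod>(1 - q\<^sup>n)\<close> at \<open>\<tau> = iy\<close>.
\<close>

definition euler_log :: "real \<Rightarrow> real" where
  "euler_log y = (\<Sum>n. ln (1 - exp (- 2 * pi * y) ^ Suc n))"

definition planck_partial_sum :: "nat \<Rightarrow> real \<Rightarrow> real" where
  "planck_partial_sum M y = (\<Sum>m<M. 1 / real (Suc m) * (1 / (exp (2 * pi * (real (Suc m) * y)) - 1)))"

text \<open>
  The index \<open>N\<close> only splits the inner series into a finite part and a tail. It is a free parameter
  so that, in the expansions for \<open>y\<close> and for \<open>1/y\<close>, the finite parts can be chosen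
  as transposes of each other.
\<close>

lemma planck_partial_sum_eq:
  assumes y: "y > 0"
  shows "planck_partial_sum M y =
           (1 / (2 * pi * y)) * (\<Sum>m<M. 1 / (real (Suc m))\<^sup>2) - harm M / 2
           + ((\<Sum>m<M. \<Sum>k<N. y / ((real (Suc m) * y)\<^sup>2 + (real (Suc k))\<^sup>2))
              + (\<Sum>m<M. lorentz_tail N (real (Suc m) * y) / real (Suc m))) / pi"
proof -
  have "1 / real (Suc m) * (1 / (exp (2 * pi * (real (Suc m) * y)) - 1)) =
      (1 / (2 * pi * y)) * (1 / (real (Suc m))\<^sup>2) - inverse (real (Suc m)) / 2
      + ((\<Sum>k<N. y / ((real (Suc m) * y)\<^sup>2 + (real (Suc k))\<^sup>2))
              + lorentz_tail N (real (Suc m) * y) / real (Suc m)) / pi" for m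
  proof -
    define x where "x = real (Suc m) * y"
    have x: "x > 0" using y by (simp add: x_def)
    have "(\<Sum>k. x / (x\<^sup>2 + (real (Suc k))\<^sup>2))
        = lorentz_tail N x + (\<Sum>k<N. x / (x\<^sup>2 + (real (Suc k))\<^sup>2))"
      unfolding lorentz_tail_def
      using suminf_split_initial_segment[OF summable_lorentz[of x], of N] by (simp add: add_ac)
    moreover have "(\<Sum>k<N. x / (x\<^sup>2 + (real (Suc k))\<^sup>2)) = real (Suc m) * (\<Sum>k<N. y / (x\<^sup>2 + (real (Suc k))\<^sup>2))"
      by (simp add: sum_distrib_left x_def del: of_nat_Suc)
    ultimately have "(\<Sum>k. x / (x\<^sup>2 + (real (Suc k))\<^sup>2))
        = lorentz_tail N x + real (Suc m) * (\<Sum>k<N. y / (x\<^sup>2 + (real (Suc k))\<^sup>2))" by simp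
    with planck_partial_fractions[OF x]
    have "1 / (exp (2 * pi * x) - 1) = 1 / (2 * pi * x) - 1 / 2 +
           (lorentz_tail N x + real (Suc m) * (\<Sum>k<N. y / (x\<^sup>2 + (real (Suc k))\<^sup>2))) / pi" by simp
    then have "1 / real (Suc m) * (1 / (exp (2 * pi * x) - 1)) = 1 / real (Suc m) * (1 / (2 * pi * x) - 1 / 2 +
           (lorentz_tail N x + real (Suc m) * (\<Sum>k<N. y / (x\<^sup>2 + (real (Suc k))\<^sup>2))) / pi)" by simp
    also have "\<dots> = 1 / real (Suc m) * (1 / (2 * pi * x)) - 1 / real (Suc m) / 2 +
           (lorentz_tail N x / real (Suc m) + (\<Sum>k<N. y / (x\<^sup>2 + (real (Suc k))\<^sup>2))) / pi"
      by (simp add: ring_distribs add_divide_distrib mult_ac del: of_nat_Suc)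
    finally have "1 / real (Suc m) * (1 / (exp (2 * pi * x) - 1)) = 1 / real (Suc m) * (1 / (2 * pi * x)) - 1 / real (Suc m) / 2 +
           (lorentz_tail N x / real (Suc m) + (\<Sum>k<N. y / (x\<^sup>2 + (real (Suc k))\<^sup>2))) / pi" .
    moreover have "1 / real (Suc m) * (1 / (2 * pi * x)) = (1 / (2 * pi * y)) * (1 / (real (Suc m))\<^sup>2)"
      by (simp add: x_def power2_eq_square)
    ultimately show ?thesis
      by (simp add: x_def inverse_eq_divide add_ac del: of_nat_Suc)
  qed
  then show ?thesis
    unfolding planck_partial_sum_def
    by (simp add: sum.distrib sum_subtractf sum_distrib_left sum_divide_distrib harm_altdef add_divide_distrib del: of_nat_Suc)
qed

text \<open>
  The logarithmic form of \<open>\<eta>(i/y) = \<surd>y \<eta>(iy)\<close>. In the difference of the partial sums for \<open>y\<close>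
  (up to \<open>M\<close>) and for \<open>1/y\<close> (up to \<open>N = \<lfloor>My\<rfloor>\<close>), the finite double sums agree, the sums of the tails
  have the same limit, the sums of inverse squares give \<open>\<pi>/12 (1/y - y)\<close>, and the
  harmonic sums give \<open>(ln N - ln M) / 2 \<rightarrow> ln y / 2\<close>.
\<close>

lemma euler_log_inversion:
  assumes y: "y > 0"
  shows "euler_log (1 / y) = euler_log y + ln y / 2 + pi / 12 * (1 / y - y)"
proof -
  define N where "N = (\<lambda>M. nat \<lfloor>real M * y\<rfloor>)"
  define Q where "Q = (\<lambda>M::nat. \<Sum>m<M. 1 / (real (Suc m))\<^sup>2)"
  define T1 where "T1 = (\<lambda>M. \<Sum>m<M. lorentz_tail (N M) (real (Suc m) * y) / real (Suc m))"
  define T2 where "T2 = (\<lambda>M. \<Sum>k<N M. lorentz_tail M (real (Suc k) * (1 / y)) / real (Suc k))"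
  have NT: "filterlim N at_top sequentially"
    unfolding N_def using y by real_asymp
  have MN: "(\<lambda>M. real (N M) / real M) \<longlonglongrightarrow> y"
    unfolding N_def using y by real_asymp
  have ev: "\<forall>\<^sub>F M in sequentially. M > 0 \<and> N M > 0"
    using eventually_gt_at_top[of 0] eventually_compose_filterlim[OF eventually_gt_at_top[of 0] NT]
    by eventually_elim auto
  \<comment> \<open>The summand is invariant under exchanging \<open>m\<close> with \<open>k\<close> and \<open>y\<close> with \<open>1/y\<close>.\<close>
  have sw: "(\<Sum>m<M. \<Sum>k<N M. y / ((real (Suc m) * y)\<^sup>2 + (real (Suc k))\<^sup>2))
       = (\<Sum>k<N M. \<Sum>m<M. (1 / y) / ((real (Suc k) * (1 / y))\<^sup>2 + (real (Suc m))\<^sup>2))" for M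
  proof (subst sum.swap, intro sum.cong refl)
    fix k m :: nat
    have "((real (Suc k) * (1 / y))\<^sup>2 + (real (Suc m))\<^sup>2) = ((real (Suc m) * y)\<^sup>2 + (real (Suc k))\<^sup>2) / y\<^sup>2"
      using y by (simp add: field_simps power2_eq_square)
    then show "y / ((real (Suc m) * y)\<^sup>2 + (real (Suc k))\<^sup>2) = (1 / y) / ((real (Suc k) * (1 / y))\<^sup>2 + (real (Suc m))\<^sup>2)"
      using y by (simp add: power2_eq_square)
  qed
  have eq: "planck_partial_sum M y - planck_partial_sum (N M) (1 / y) =
     1 / (2 * pi) * ((1 / y) * Q M - y * Q (N M)) + (harm (N M) - harm M) / 2 + (T1 M - T2 M) / pi" for M
    using y unfolding planck_partial_sum_eq[OF y, of M "N M"]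
      planck_partial_sum_eq[of "1 / y" "N M" M, simplified y zero_less_divide_1_iff, OF TrueI]
      T1_def T2_def Q_def sw
    by (simp add: field_simps del: of_nat_Suc)
  have Q: "Q \<longlonglongrightarrow> pi\<^sup>2 / 6"
    using inverse_squares_sums unfolding sums_def Q_def by (simp add: add_ac)
  have harm: "(\<lambda>M. harm (N M) - harm M) \<longlonglongrightarrow> ln y"
  proof -
    have "(\<lambda>M. (harm (N M) - ln (real (N M))) - (harm M - ln (real M)) + ln (real (N M) / real M))
            \<longlonglongrightarrow> euler_mascheroni - euler_mascheroni + ln y"
      by (intro tendsto_intros filterlim_compose[OF euler_mascheroni_LIMSEQ NT] euler_mascheroni_LIMSEQ MN)
         (use y in auto)
    then have "(\<lambda>M. (harm (N M) - ln (real (N M))) - (harm M - ln (real M)) + ln (real (N M) / real M))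
            \<longlonglongrightarrow> ln y" by simp
    then show ?thesis
    proof (rule Lim_transform_eventually)
      show "\<forall>\<^sub>F M in sequentially. (harm (N M) - ln (real (N M))) - (harm M - ln (real M)) + ln (real (N M) / real M)
              = harm (N M) - harm M"
        using ev by eventually_elim (auto simp: ln_div)
    qed
  qed
  obtain I where I: "\<And>N t. filterlim N at_top sequentially \<Longrightarrow> t \<longlonglongrightarrow> 1 \<Longrightarrow> (\<lambda>j::nat. arctan_sum (N j) (t j)) \<longlonglongrightarrow> I"
    using arctan_sum_LIMSEQ by blast
  \<comment> \<open>The bounds for the tails are values of \<open>arctan_sum\<close> at parameters close to
     \<open>yM/N\<close> here and to \<open>N/(yM)\<close> for \<open>T2\<close>; both tend to 1.\<close>
  have T1: "T1 \<longlonglongrightarrow> I"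
  proof (rule tendsto_sandwich)
    show "(\<lambda>M. arctan_sum M (y * real M / real (N M + 1))) \<longlonglongrightarrow> I"
      using y by (intro I filterlim_ident) (unfold N_def, real_asymp)
    show "(\<lambda>M. arctan_sum M (y * real M / real (N M))) \<longlonglongrightarrow> I"
      using y by (intro I filterlim_ident) (unfold N_def, real_asymp)
    show "\<forall>\<^sub>F M in sequentially. arctan_sum M (y * real M / real (N M + 1)) \<le> T1 M"
      using ev
    proof eventually_elim
      case (elim M)
      show ?case unfolding T1_def arctan_sum_def
      proof (intro sum_mono divide_right_mono)
        fix m
        have "y * real M / real (N M + 1) * real (Suc m) / real M = (real (Suc m) * y) / real (N M + 1)"
          using elim by simp
        then show "arctan (y * real M / real (N M + 1) * real (Suc m) / real M) \<le> lorentz_tail (N M) (real (Suc m) * y)"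
          unfolding lorentz_tail_def using arctan_tail_bounds(1)[of "real (Suc m) * y" "N M"] elim y
          by (simp only: mult_pos_pos of_nat_0_less_iff zero_less_Suc zero_less_divide_1_iff simp_thms)
      qed simp
    qed
    show "\<forall>\<^sub>F M in sequentially. T1 M \<le> arctan_sum M (y * real M / real (N M))"
      using ev
    proof eventually_elim
      case (elim M)
      show ?case unfolding T1_def arctan_sum_def
      proof (intro sum_mono divide_right_mono)
        fix m
        have "y * real M / real (N M) * real (Suc m) / real M = (real (Suc m) * y) / real (N M)"
          using elim by simp
        then show "lorentz_tail (N M) (real (Suc m) * y) \<le> arctan (y * real M / real (N M) * real (Suc m) / real M)"
          unfolding lorentz_tail_def using arctan_tail_bounds(2)[of "real (Suc m) * y" "N M"] elim y
          by (simp only: mult_pos_pos of_nat_0_less_iff zero_less_Suc zero_less_divide_1_iff simp_thms)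
      qed simp
    qed
  qed
  have T2: "T2 \<longlonglongrightarrow> I"
  proof (rule tendsto_sandwich)
    show "(\<lambda>M. arctan_sum (N M) (real (N M) / (y * real (M + 1)))) \<longlonglongrightarrow> I"
      using y by (intro I NT) (unfold N_def, real_asymp)
    show "(\<lambda>M. arctan_sum (N M) (real (N M) / (y * real M))) \<longlonglongrightarrow> I"
      using y by (intro I NT) (unfold N_def, real_asymp)
    show "\<forall>\<^sub>F M in sequentially. arctan_sum (N M) (real (N M) / (y * real (M + 1))) \<le> T2 M"
      using ev
    proof eventually_elim
      case (elim M)
      show ?case unfolding T2_def arctan_sum_def
      proof (intro sum_mono divide_right_mono)
        fix m
        have "real (N M) / (y * real (M + 1)) * real (Suc m) / real (N M) = (real (Suc m) * (1 / y)) / real (M + 1)"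
          using elim by simp
        then show "arctan (real (N M) / (y * real (M + 1)) * real (Suc m) / real (N M)) \<le> lorentz_tail M (real (Suc m) * (1 / y))"
          unfolding lorentz_tail_def using arctan_tail_bounds(1)[of "real (Suc m) * (1 / y)" M] elim y
          by (simp only: mult_pos_pos of_nat_0_less_iff zero_less_Suc zero_less_divide_1_iff simp_thms)
      qed simp
    qed
    show "\<forall>\<^sub>F M in sequentially. T2 M \<le> arctan_sum (N M) (real (N M) / (y * real M))"
      using ev
    proof eventually_elim
      case (elim M)
      show ?case unfolding T2_def arctan_sum_def
      proof (intro sum_mono divide_right_mono)
        fix m
        have "real (N M) / (y * real M) * real (Suc m) / real (N M) = (real (Suc m) * (1 / y)) / real M"
          using elim by simp
        then show "lorentz_tail M (real (Suc m) * (1 / y)) \<le> arctan (real (N M) / (y * real M) * real (Suc m) / real (N M))"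
          unfolding lorentz_tail_def using arctan_tail_bounds(2)[of "real (Suc m) * (1 / y)" M] elim y
          by (simp only: mult_pos_pos of_nat_0_less_iff zero_less_Suc zero_less_divide_1_iff simp_thms)
      qed simp
    qed
  qed
  have P: "(\<lambda>M. planck_partial_sum M x) \<longlonglongrightarrow> - euler_log x" if "x > 0" for x
    using planck_sums_ln_euler_product(1)[OF that]
    unfolding sums_def planck_partial_sum_def euler_log_def .
  have "(\<lambda>M. planck_partial_sum M y - planck_partial_sum (N M) (1 / y)) \<longlonglongrightarrow>
          1 / (2 * pi) * ((1 / y) * (pi\<^sup>2 / 6) - y * (pi\<^sup>2 / 6)) + ln y / 2 + (I - I) / pi"
    unfolding eq by (intro tendsto_intros Q filterlim_compose[OF Q NT] harm T1 T2) auto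
  moreover have "(\<lambda>M. planck_partial_sum M y - planck_partial_sum (N M) (1 / y)) \<longlonglongrightarrow> - euler_log y - (- euler_log (1 / y))"
    using y by (intro tendsto_diff P filterlim_compose[OF P NT]) auto
  ultimately have "- euler_log y - (- euler_log (1 / y)) = 1 / (2 * pi) * ((1 / y) * (pi\<^sup>2 / 6) - y * (pi\<^sup>2 / 6)) + ln y / 2 + (I - I) / pi"
    using LIMSEQ_unique by blast
  also have "\<dots> = pi / 12 * (1 / y - y) + ln y / 2"
    using y by (simp add: field_simps power2_eq_square)
  finally show ?thesis by simp
qed

section \<open>The function \<open>\<eta>\<^bsup>3/2\<^esup>\<close> as a function of \<open>q\<^bsup>1/16\<^esup>\<close>\<close>

text \<open>
  A sum of principal logarithms rather than a logarithm of the product: with it, the product of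
  the powers with exponent \<open>3/2\<close> is an exponential, so that it has no zeros.
\<close>

definition euler_product_Ln :: "complex \<Rightarrow> complex" where
  "euler_product_Ln q = (\<Sum>n. Ln (1 - q ^ Suc n))"

definition euler_product32 :: "complex \<Rightarrow> complex" where
  "euler_product32 q = exp (3 / 2 * euler_product_Ln q)"

text \<open>
  The local parameter \<open>q\<^bsup>1/16\<^esup>\<close> at the cusps of \<open>\<Gamma>(16)\<close>.
\<close>

definition nome16 :: "complex \<Rightarrow> complex" where
  "nome16 \<tau> = exp (2 * pi * \<i> * \<tau> / 16)"

lemma uniform_limit_euler_product_Ln:
  assumes r: "0 \<le> r" "r < 1"
  shows "uniform_limit (cball 0 r) (\<lambda>m q. \<Sum>n<m. Ln (1 - q ^ Suc n)) euler_product_Ln sequentially"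
  unfolding euler_product_Ln_def
proof (rule Weierstrass_m_test_ev)
  have "(\<lambda>n. r ^ Suc n) \<longlonglongrightarrow> 0" using r by (intro LIMSEQ_Suc LIMSEQ_power_zero) auto
  then have "\<forall>\<^sub>F n in sequentially. r ^ Suc n < 1 / 2" by (rule order_tendstoD) simp
  then show "\<forall>\<^sub>F n in sequentially. \<forall>q\<in>cball 0 r. norm (Ln (1 - q ^ Suc n)) \<le> 2 * r ^ Suc n"
  proof eventually_elim
    case (elim n)
    show ?case
    proof
      fix q :: complex assume q: "q \<in> cball 0 r"
      then have "norm (- (q ^ Suc n)) \<le> r ^ Suc n"
        by (simp add: norm_power norm_mult power_mono mult_mono del: power_Suc)
      then show "norm (Ln (1 - q ^ Suc n)) \<le> 2 * r ^ Suc n"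
        using norm_Ln_le[of "- (q ^ Suc n)"] elim by simp
    qed
  qed
  show "summable (\<lambda>n. 2 * r ^ Suc n)" using r by (simp add: summable_geometric)
qed

text \<open>
  The factors of the Euler product stay away from the cut of the principal logarithm.
\<close>

lemma one_minus_power_Re_pos:
  fixes q :: complex
  assumes "norm q < 1"
  shows "Re (1 - q ^ Suc n) > 0"
proof -
  have "norm (q ^ Suc n) < 1"
    using assms power_strict_decreasing[of 0 "Suc n" "norm q"] by (cases "q = 0") (simp_all add: norm_power del: power_Suc)
  then show ?thesis using complex_Re_le_cmod[of "q ^ Suc n"] by simp
qed

lemma holomorphic_euler_product_Ln: "euler_product_Ln holomorphic_on ball 0 1"
proof (rule holomorphic_uniform_sequence)
  show "(\<lambda>q. \<Sum>n<m. Ln (1 - q ^ Suc n)) holomorphic_on ball 0 1" for m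
  proof (intro holomorphic_intros)
    fix n and q :: complex assume "q \<in> ball 0 1"
    then have "Re (1 - q ^ Suc n) > 0" by (intro one_minus_power_Re_pos) simp
    then show "1 - q ^ Suc n \<notin> \<real>\<^sub>\<le>\<^sub>0" by (auto simp: complex_nonpos_Reals_iff simp del: power_Suc)
  qed
  show "\<exists>d>0. cball x d \<subseteq> ball 0 1 \<and> uniform_limit (cball x d) (\<lambda>m q. \<Sum>n<m. Ln (1 - q ^ Suc n)) euler_product_Ln sequentially"
    if x: "x \<in> ball 0 1" for x :: complex
  proof (intro exI[of _ "(1 - norm x) / 2"] conjI)
    have *: "cball x ((1 - norm x) / 2) \<subseteq> cball 0 ((1 + norm x) / 2)"
      using x by (simp add: cball_subset_cball_iff) (simp add: field_simps)
    then show "uniform_limit (cball x ((1 - norm x) / 2)) (\<lambda>m q. \<Sum>n<m. Ln (1 - q ^ Suc n)) euler_product_Ln sequentially"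
      using x by (intro uniform_limit_on_subset[OF uniform_limit_euler_product_Ln]) auto
    have "cball 0 ((1 + norm x) / 2) \<subseteq> ball (0::complex) 1" using x by auto
    with * show "cball x ((1 - norm x) / 2) \<subseteq> ball 0 1" by blast
  qed (use x in auto)
qed auto

lemma holomorphic_euler_product32 [holomorphic_intros]:
  assumes "f holomorphic_on A" "\<And>z. z \<in> A \<Longrightarrow> norm (f z) < 1"
  shows "(\<lambda>z. euler_product32 (f z)) holomorphic_on A"
proof -
  have "euler_product32 holomorphic_on ball 0 1"
    unfolding euler_product32_def by (intro holomorphic_intros holomorphic_euler_product_Ln)
  then show ?thesis
    using holomorphic_on_compose_gen[OF assms(1), of euler_product32 "ball 0 1"] assms(2) by (force simp: o_def)
qed

lemma euler_product32_nonzero [simp]: "euler_product32 q \<noteq> 0"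
  by (simp add: euler_product32_def)

lemma norm_nome16: "norm (nome16 \<tau>) = exp (- (pi * Im \<tau> / 8))"
  by (simp add: nome16_def norm_exp_eq_Re)

lemma norm_nome16_less_1: "\<tau> \<in> upper_half_plane \<Longrightarrow> norm (nome16 \<tau>) < 1"
  by (simp add: norm_nome16 upper_half_plane_def)

lemma nome16_nonzero [simp]: "nome16 \<tau> \<noteq> 0"
  by (simp add: nome16_def)

lemma nome16_add: "nome16 (\<tau> + \<sigma>) = nome16 \<tau> * nome16 \<sigma>"
  by (simp add: nome16_def exp_add[symmetric] add_divide_distrib ring_distribs)

lemma nome16_power: "nome16 \<tau> ^ n = nome16 (of_nat n * \<tau>)"
  by (simp add: nome16_def exp_of_nat_mult[symmetric] mult_ac)

lemma nome16_16 [simp]: "nome16 16 = 1"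
  using exp_two_pi_i by (simp add: nome16_def mult_ac)

lemma eta32_eq:
  assumes "\<tau> \<in> upper_half_plane"
  shows "eta32 \<tau> = nome16 \<tau> * euler_product32 (nome16 \<tau> ^ 16)"
proof -
  define q where "q = nome16 \<tau> ^ 16"
  have q: "norm q < 1"
    using norm_nome16_less_1[OF assms] by (simp add: q_def norm_power power_less_one_iff)
  have qn: "exp (2 * pi * \<i> * of_nat (Suc n) * \<tau>) = q ^ Suc n" for n
    by (simp add: q_def nome16_def exp_of_nat_mult[symmetric] power_mult[symmetric] mult_ac del: power_Suc of_nat_Suc)
  have "summable (\<lambda>n. Ln (1 - q ^ Suc n))"
    using uniform_limit_euler_product_Ln[of "norm q", THEN tendsto_uniform_limitI, of q] q
    by (auto simp: summable_def sums_def)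
  then have "(\<Prod>n. exp (3 / 2 * Ln (1 - q ^ Suc n))) = exp (\<Sum>n. 3 / 2 * Ln (1 - q ^ Suc n))"
    by (intro prodinf_exp summable_mult)
  also have "\<dots> = euler_product32 q"
    unfolding euler_product32_def euler_product_Ln_def
    using \<open>summable _\<close> by (subst suminf_mult) auto
  also have "(\<lambda>n. exp (3 / 2 * Ln (1 - q ^ Suc n))) = (\<lambda>n. (1 - exp (2 * pi * \<i> * of_nat (Suc n) * \<tau>)) powr (3/2))"
  proof
    fix n
    have "1 - q ^ Suc n \<noteq> 0" using one_minus_power_Re_pos[OF q, of n] by (metis less_irrefl zero_complex.sel(1))
    then show "exp (3 / 2 * Ln (1 - q ^ Suc n)) = (1 - exp (2 * pi * \<i> * of_nat (Suc n) * \<tau>)) powr (3/2)"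
      unfolding qn by (simp add: powr_def del: power_Suc)
  qed
  finally show ?thesis using assms by (simp add: eta32_def nome16_def q_def)
qed

lemma eta32_nonzero: "\<tau> \<in> upper_half_plane \<Longrightarrow> eta32 \<tau> \<noteq> 0"
  by (simp add: eta32_eq)

lemma holomorphic_nome16: "nome16 holomorphic_on A"
  unfolding nome16_def by (intro holomorphic_intros) auto

lemma holomorphic_eta32: "eta32 holomorphic_on upper_half_plane"
proof (rule holomorphic_transform)
  show "(\<lambda>\<tau>. nome16 \<tau> * euler_product32 (nome16 \<tau> ^ 16)) holomorphic_on upper_half_plane"
    using norm_nome16_less_1
    by (intro holomorphic_intros holomorphic_nome16) (auto simp: norm_power power_less_one_iff)
qed (simp add: eta32_eq)

lemma eta32_add_1:
  assumes "\<tau> \<in> upper_half_plane"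
  shows "eta32 (\<tau> + 1) = nome16 1 * eta32 \<tau>"
proof -
  have "\<tau> + 1 \<in> upper_half_plane" using assms by (simp add: upper_half_plane_def)
  moreover have "nome16 1 ^ 16 = 1" by (simp add: nome16_power)
  ultimately show ?thesis using assms by (simp add: eta32_eq nome16_add power_mult_distrib)
qed

lemma eta32_imaginary_axis:
  assumes y: "y > 0"
  shows "eta32 (\<i> * of_real y) = of_real (exp (3 / 2 * euler_log y - pi * y / 8))"
proof -
  have "\<i> * of_real y \<in> upper_half_plane" using y by (simp add: upper_half_plane_def)
  moreover have "nome16 (\<i> * of_real y) = of_real (exp (- (pi * y / 8)))"
    by (simp add: nome16_def exp_of_real[symmetric] mult_ac)
  moreover have "nome16 (\<i> * of_real y) ^ 16 = of_real (exp (- 2 * pi * y))"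
    by (simp add: nome16_def exp_of_real[symmetric] exp_of_nat_mult[symmetric] mult_ac)
  moreover have "euler_product_Ln (of_real (exp (- 2 * pi * y))) = of_real (euler_log y)"
  proof -
    have "Ln (1 - of_real (exp (- 2 * pi * y)) ^ Suc n) = of_real (ln (1 - exp (- 2 * pi * y) ^ Suc n))" for n
    proof -
      have "1 - exp (- 2 * pi * y) ^ Suc n > 0"
        using one_minus_power_Re_pos[of "of_real (exp (- 2 * pi * y))" n] y
        by (simp flip: of_real_power del: power_Suc)
      moreover have "1 - complex_of_real (exp (- 2 * pi * y)) ^ Suc n = of_real (1 - exp (- 2 * pi * y) ^ Suc n)"
        by simp
      ultimately show ?thesis by (simp only: Ln_of_real)
    qed
    then show ?thesis
      unfolding euler_product_Ln_def euler_log_def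
      using planck_sums_ln_euler_product(2)[OF y] by (simp only: suminf_of_real)
  qed
  ultimately show ?thesis
    by (simp add: eta32_eq euler_product32_def exp_of_real[symmetric] exp_add[symmetric])
qed

text \<open>
  The fourth power clears the roots from \<open>\<eta>\<^bsup>3/2\<^esup>(i/y) = y\<^bsup>3/4\<^esup> \<eta>\<^bsup>3/2\<^esup>(iy)\<close>. On the imaginary axis
  \<open>y\<^sup>3 = i\<tau>\<^sup>3\<close>, so both sides are holomorphic on the half plane and agree on a set with a limit point.
\<close>

lemma eta32_power4_inversion:
  assumes "\<tau> \<in> upper_half_plane"
  shows "eta32 (- 1 / \<tau>) ^ 4 = \<i> * \<tau> ^ 3 * eta32 \<tau> ^ 4"
proof -
  define F where "F = (\<lambda>\<tau>. eta32 (- 1 / \<tau>) ^ 4 - \<i> * \<tau> ^ 3 * eta32 \<tau> ^ 4)"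
  define U where "U = (\<lambda>y. \<i> * of_real y) ` {0<..}"
  have inv: "- 1 / \<tau> \<in> upper_half_plane" if "\<tau> \<in> upper_half_plane" for \<tau>
  proof -
    have "- 1 / \<tau> = - cnj \<tau> / of_real ((norm \<tau>)\<^sup>2)"
      using that by (subst complex_div_cnj) simp
    moreover have "norm \<tau> > 0" using that by (auto simp: upper_half_plane_def)
    ultimately show ?thesis using that by (simp add: upper_half_plane_def)
  qed
  have "F \<tau> = 0"
  proof (rule analytic_continuation[of F upper_half_plane U \<i>])
    have "(\<lambda>\<tau>. eta32 (- 1 / \<tau>)) holomorphic_on upper_half_plane"
      using inv by (intro holomorphic_on_compose_gen[OF _ holomorphic_eta32, unfolded o_def] holomorphic_intros)
        (auto simp: upper_half_plane_def)
    then show "F holomorphic_on upper_half_plane"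
      unfolding F_def by (intro holomorphic_intros holomorphic_eta32)
    show "connected upper_half_plane"
      unfolding upper_half_plane_def by (intro convex_connected convex_halfspace_Im_gt)
    have "connected U" unfolding U_def by (intro connected_continuous_image continuous_intros) auto
    moreover have "\<i> \<in> U" "2 * \<i> \<in> U" unfolding U_def by (auto intro!: image_eqI[of _ _ 1] image_eqI[of _ _ 2])
    ultimately show "\<i> islimpt U"
      by (intro connected_imp_perfect) auto
    show "F z = 0" if "z \<in> U" for z
    proof -
      from that obtain y where y: "y > 0" "z = \<i> * of_real y" by (auto simp: U_def)
      have "- 1 / z = \<i> * of_real (1 / y)" using y by (simp add: field_simps)
      moreover have "eta32 (\<i> * of_real (1 / y)) ^ 4 = of_real (y ^ 3) * eta32 (\<i> * of_real y) ^ 4"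
      proof -
        define u v where "u = 3 / 2 * euler_log (1 / y) - pi * (1 / y) / 8" and "v = 3 / 2 * euler_log y - pi * y / 8"
        have "4 * u = 3 * ln y + 4 * v"
          using euler_log_inversion[OF y(1)] by (simp add: u_def v_def right_diff_distrib distrib_left)
        then have "exp u ^ 4 = exp (ln y) ^ 3 * exp v ^ 4"
          by (simp add: exp_of_nat_mult[symmetric] exp_add[symmetric])
        then have "of_real (exp u) ^ 4 = (of_real (y ^ 3) * of_real (exp v) ^ 4 :: complex)"
          using y by (simp only: exp_ln of_real_power of_real_mult flip: of_real_power of_real_mult)
        then show ?thesis
          using y by (simp only: eta32_imaginary_axis zero_less_divide_1_iff u_def v_def)
      qed
      ultimately have "eta32 (- 1 / z) ^ 4 = of_real (y ^ 3) * eta32 z ^ 4" by (simp only: y(2))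
      moreover have "\<i> * z ^ 3 = of_real (y ^ 3)"
      proof -
        have "\<i> * z ^ 3 = (\<i> * \<i>) * (\<i> * \<i>) * of_real y ^ 3"
          unfolding y(2) by (simp only: power3_eq_cube mult_ac)
        then show ?thesis by simp
      qed
      ultimately show ?thesis unfolding F_def by (metis right_minus_eq)
    qed
  qed (use assms in \<open>auto simp: U_def upper_half_plane_def open_halfspace_Im_gt\<close>)
  then show ?thesis by (simp add: F_def)
qed

section \<open>The transformation law of \<open>\<eta>\<^sup>6\<close> under \<open>SL\<^sub>2(\<int>)\<close>\<close>

lemma matrix_mult_2x2:
  fixes A B :: "int^2^2"
  shows "(A ** B)$1$1 = A$1$1 * B$1$1 + A$1$2 * B$2$1" "(A ** B)$1$2 = A$1$1 * B$1$2 + A$1$2 * B$2$2"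
    and "(A ** B)$2$1 = A$2$1 * B$1$1 + A$2$2 * B$2$1" "(A ** B)$2$2 = A$2$1 * B$1$2 + A$2$2 * B$2$2"
  by (simp_all add: matrix_matrix_mult_def sum_2)

definition mat2 :: "int \<Rightarrow> int \<Rightarrow> int \<Rightarrow> int \<Rightarrow> int^2^2" where
  "mat2 a b c d = vector [vector [a, b], vector [c, d]]"

lemma mat2_nth [simp]:
  "mat2 a b c d $ 1 $ 1 = a" "mat2 a b c d $ 1 $ 2 = b" "mat2 a b c d $ 2 $ 1 = c" "mat2 a b c d $ 2 $ 2 = d"
  by (simp_all add: mat2_def)

lemma mat2_eq_iff:
  fixes A B :: "int^2^2"
  shows "A = B \<longleftrightarrow> A$1$1 = B$1$1 \<and> A$1$2 = B$1$2 \<and> A$2$1 = B$2$1 \<and> A$2$2 = B$2$2"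
  by (auto simp: vec_eq_iff forall_2)

text \<open>
  The adjugate, which is the inverse in \<open>SL\<^sub>2(\<int>)\<close> and avoids inverting integer matrices.
\<close>

definition adj2 :: "int^2^2 \<Rightarrow> int^2^2" where
  "adj2 \<gamma> = mat2 (\<gamma>$2$2) (- \<gamma>$1$2) (- \<gamma>$2$1) (\<gamma>$1$1)"

lemma SL2Z_det: "\<gamma> \<in> SL2Z \<longleftrightarrow> \<gamma>$1$1 * \<gamma>$2$2 - \<gamma>$1$2 * \<gamma>$2$1 = 1"
  by (simp add: SL2Z_def det_2)

lemma SL2Z_mult: "A \<in> SL2Z \<Longrightarrow> B \<in> SL2Z \<Longrightarrow> A ** B \<in> SL2Z"
  by (simp add: SL2Z_def det_mul)

lemma SL2Z_adj2: "\<gamma> \<in> SL2Z \<Longrightarrow> adj2 \<gamma> \<in> SL2Z"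
  by (simp add: SL2Z_det adj2_def mult_ac)

lemma adj2_mult:
  assumes "\<gamma> \<in> SL2Z"
  shows "adj2 \<gamma> ** \<gamma> = mat 1" "\<gamma> ** adj2 \<gamma> = mat 1"
  using assms by (simp_all add: mat2_eq_iff matrix_mult_2x2 adj2_def SL2Z_det mat_def algebra_simps)

lemma adj2_cancel:
  assumes "\<gamma> \<in> SL2Z"
  shows "adj2 \<gamma> ** (\<gamma> ** B) = B" "\<gamma> ** (adj2 \<gamma> ** B) = B" "(B ** adj2 \<gamma>) ** \<gamma> = B"  "(B ** \<gamma>) ** adj2 \<gamma> = B"
  using adj2_mult[OF assms] by (metis matrix_mul_assoc matrix_mul_lid matrix_mul_rid)+

lemma denom_nonzero:
  assumes "\<gamma> \<in> SL2Z" "\<tau> \<in> upper_half_plane"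
  shows "denom \<gamma> \<tau> \<noteq> 0"
proof
  assume "denom \<gamma> \<tau> = 0"
  then have "Im (denom \<gamma> \<tau>) = 0" "Re (denom \<gamma> \<tau>) = 0" by simp_all
  then have "\<gamma>$2$1 = 0" "\<gamma>$2$2 = 0" using assms(2) by (auto simp: denom_def upper_half_plane_def)
  then show False using assms(1) by (simp add: SL2Z_det)
qed

lemma Im_mobius:
  assumes "\<gamma> \<in> SL2Z"
  shows "Im (mobius \<gamma> \<tau>) = Im \<tau> / (norm (denom \<gamma> \<tau>))\<^sup>2"
proof -
  have "Im (mobius \<gamma> \<tau>) = Im ((of_int (\<gamma>$1$1) * \<tau> + of_int (\<gamma>$1$2)) * cnj (denom \<gamma> \<tau>)) / (norm (denom \<gamma> \<tau>))\<^sup>2"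
    unfolding mobius_def by (subst complex_div_cnj) (simp only: Im_divide_of_real)
  also have "Im ((of_int (\<gamma>$1$1) * \<tau> + of_int (\<gamma>$1$2)) * cnj (denom \<gamma> \<tau>))
      = of_int (\<gamma>$1$1 * \<gamma>$2$2 - \<gamma>$1$2 * \<gamma>$2$1) * Im \<tau>"
    by (simp add: denom_def algebra_simps)
  finally show ?thesis using assms by (simp only: SL2Z_det of_int_1 mult_1_left)
qed

lemma mobius_upper:
  assumes "\<gamma> \<in> SL2Z" "\<tau> \<in> upper_half_plane"
  shows "mobius \<gamma> \<tau> \<in> upper_half_plane"
  using assms denom_nonzero[OF assms] by (simp add: upper_half_plane_def Im_mobius)

lemma denom_mult:
  assumes "B \<in> SL2Z" "\<tau> \<in> upper_half_plane"
  shows "denom (A ** B) \<tau> = denom A (mobius B \<tau>) * denom B \<tau>"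
  using denom_nonzero[OF assms]
  by (simp add: denom_def[of A] denom_def[of "A ** B"] mobius_def matrix_mult_2x2 field_simps)
     (simp add: denom_def algebra_simps)

lemma mobius_mult:
  assumes "A \<in> SL2Z" "B \<in> SL2Z" "\<tau> \<in> upper_half_plane"
  shows "mobius (A ** B) \<tau> = mobius A (mobius B \<tau>)"
proof -
  have B: "denom B \<tau> \<noteq> 0" and A: "denom A (mobius B \<tau>) \<noteq> 0"
    using denom_nonzero[OF assms(2,3)] denom_nonzero[OF assms(1) mobius_upper[OF assms(2,3)]] by blast+
  have "(of_int ((A ** B)$1$1) * \<tau> + of_int ((A ** B)$1$2))
      = (of_int (A$1$1) * mobius B \<tau> + of_int (A$1$2)) * denom B \<tau>"
    using B by (simp add: mobius_def matrix_mult_2x2 field_simps) (simp add: denom_def algebra_simps)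
  then show ?thesis
    using A B denom_mult[OF assms(2,3), of A] by (simp add: mobius_def[of "A ** B"] mobius_def[of A])
qed

lemma denom_one [simp]: "denom (mat 1) \<tau> = 1" and mobius_one [simp]: "mobius (mat 1) \<tau> = \<tau>"
  by (simp_all add: denom_def mobius_def mat_def)

text \<open>
  The multiplier of \<open>\<eta>\<close> is, by Petersson's formula, a quadratic residue symbol times \<open>e\<^bsup>2\<pi>ix/24\<^esup>\<close> with
  an explicit integer \<open>x\<close>. Its sixth power is \<open>i\<^sup>x\<close>; the present exponent is \<open>x\<close>, simplified modulo 4.
\<close>

definition eta6_exponent :: "int^2^2 \<Rightarrow> int" where
  "eta6_exponent \<gamma> = (if even (\<gamma>$2$1) then \<gamma>$1$1 * \<gamma>$2$1 + \<gamma>$1$2 * \<gamma>$2$2 - \<gamma>$2$2 + 1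
                      else (\<gamma>$1$1 + \<gamma>$2$2 + 1) * \<gamma>$2$1)"

definition mat_T :: "int^2^2" where "mat_T = mat2 1 1 0 1"
definition mat_S :: "int^2^2" where "mat_S = mat2 0 (-1) 1 0"

text \<open>
  Under \<open>\<tau> \<mapsto> \<tau> + 1\<close> as well as under \<open>\<tau> \<mapsto> -1/\<tau>\<close> the multiplier of \<open>\<eta>\<^sup>6\<close> is \<open>i\<close>. The exponent modulo 4
  depends only on the entries modulo 4, so there are finitely many cases.
\<close>

lemma eta6_exponent_step:
  assumes "\<gamma> \<in> SL2Z"
  shows "[eta6_exponent (mat_T ** \<gamma>) = eta6_exponent \<gamma> + 1] (mod 4)"
    and "[eta6_exponent (mat_S ** \<gamma>) = eta6_exponent \<gamma> + 1] (mod 4)"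
proof -
  define e :: "int \<Rightarrow> int \<Rightarrow> int \<Rightarrow> int \<Rightarrow> int" where
    "e = (\<lambda>a b c d. if even c then a * c + b * d - d + 1 else (a + d + 1) * c)"
  have e_mod: "e a b c d mod 4 = e (a mod 4) (b mod 4) (c mod 4) (d mod 4) mod 4" for a b c d
  proof -
    have "even (c mod 4) = even c" by (simp add: dvd_mod_iff)
    moreover have "[x = x mod 4] (mod 4)" for x :: int by (simp add: cong_def)
    ultimately show ?thesis unfolding e_def cong_def[symmetric]
      by (auto intro!: cong_add cong_mult cong_diff)
  qed
  have fin: "\<forall>a\<in>set [0,1,2,3]. \<forall>b\<in>set [0,1,2,3]. \<forall>c\<in>set [0,1,2,3]. \<forall>d\<in>set [0,1,2,3].
      (a * d - b * c) mod 4 = 1 \<longrightarrow>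
      e ((a + c) mod 4) ((b + d) mod 4) c d mod 4 = (e a b c d + 1) mod 4 \<and>
      e (- c mod 4) (- d mod 4) a b mod 4 = (e a b c d + 1) mod 4"
    unfolding e_def by code_simp
  obtain a b c d where abcd: "\<gamma>$1$1 = a" "\<gamma>$1$2 = b" "\<gamma>$2$1 = c" "\<gamma>$2$2 = d" by blast
  have res: "x mod 4 \<in> set [0,1,2,3]" for x :: int
    using pos_mod_bound[of 4 x] pos_mod_sign[of 4 x] by auto
  have cm: "[x mod 4 = x] (mod 4)" for x :: int by (simp add: cong_def)
  have "[(a mod 4) * (d mod 4) - (b mod 4) * (c mod 4) = a * d - b * c] (mod 4)"
    by (intro cong_diff cong_mult cm)
  then have "((a mod 4) * (d mod 4) - (b mod 4) * (c mod 4)) mod 4 = 1"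
    using assms by (simp add: SL2Z_det abcd cong_def)
  with fin res have
    "e (((a mod 4) + (c mod 4)) mod 4) (((b mod 4) + (d mod 4)) mod 4) (c mod 4) (d mod 4) mod 4
       = (e (a mod 4) (b mod 4) (c mod 4) (d mod 4) + 1) mod 4 \<and>
      e (- (c mod 4) mod 4) (- (d mod 4) mod 4) (a mod 4) (b mod 4) mod 4 = (e (a mod 4) (b mod 4) (c mod 4) (d mod 4) + 1) mod 4"
    by blast
  then have "e (a + c) (b + d) c d mod 4 = (e a b c d + 1) mod 4 \<and> e (- c) (- d) a b mod 4 = (e a b c d + 1) mod 4"
    unfolding mod_add_eq mod_minus_eq
    using e_mod[of "a + c" "b + d" c d] e_mod[of "- c" "- d" a b] e_mod[of a b c d]
      mod_add_left_eq[of "e a b c d" 4 1]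
      mod_add_left_eq[of "e (a mod 4) (b mod 4) (c mod 4) (d mod 4)" 4 1] by presburger
  moreover have "eta6_exponent (mat_T ** \<gamma>) = e (a + c) (b + d) c d" "eta6_exponent (mat_S ** \<gamma>) = e (- c) (- d) a b"
    "eta6_exponent \<gamma> = e a b c d"
    by (simp_all add: eta6_exponent_def e_def matrix_mult_2x2 mat_T_def mat_S_def abcd)
  ultimately show "[eta6_exponent (mat_T ** \<gamma>) = eta6_exponent \<gamma> + 1] (mod 4)"
    "[eta6_exponent (mat_S ** \<gamma>) = eta6_exponent \<gamma> + 1] (mod 4)"
    by (simp_all add: cong_def)
qed

lemma i_powi_cong:
  assumes "[m = n] (mod 4)"
  shows "\<i> powi m = \<i> powi n"
proof -
  obtain k where "m = n + 4 * k" using assms by (metis cong_iff_lin cong_sym)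
  moreover have "\<i> powi (4 * k) = 1" using power_int_mult[of \<i> 4 k] by simp
  ultimately show ?thesis by (simp add: power_int_add)
qed

text \<open>
  The Euclidean algorithm on the first column: a power of \<open>T\<close> reduces the upper left entry modulo the
  lower left one, and \<open>S\<close> moves the remainder to the lower left corner. The steps are
  equivalences because inverses of \<open>T\<close> and \<open>S\<close> are needed as well.
\<close>

lemma SL2Z_induct [consumes 1, case_names one minus_one T S]:
  assumes "\<gamma> \<in> SL2Z"
    and one: "P (mat 1)" and minus_one: "P (mat2 (-1) 0 0 (-1))"
    and T: "\<And>\<gamma>. \<gamma> \<in> SL2Z \<Longrightarrow> P (mat_T ** \<gamma>) \<longleftrightarrow> P \<gamma>"
    and S: "\<And>\<gamma>. \<gamma> \<in> SL2Z \<Longrightarrow> P (mat_S ** \<gamma>) \<longleftrightarrow> P \<gamma>"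
  shows "P \<gamma>"
proof -
  have Tpow: "P (mat2 1 n 0 1 ** \<gamma>) \<longleftrightarrow> P \<gamma>" if "\<gamma> \<in> SL2Z" for n \<gamma>
  proof (induction n rule: int_induct[where k = 0])
    case base
    have "mat2 1 0 0 1 ** \<gamma> = \<gamma>" by (simp add: mat2_eq_iff matrix_mult_2x2)
    then show ?case by simp
  next
    case (step1 n)
    have "mat2 1 (n + 1) 0 1 ** \<gamma> = mat_T ** (mat2 1 n 0 1 ** \<gamma>)"
      by (simp add: mat2_eq_iff matrix_mult_2x2 mat_T_def algebra_simps)
    moreover have "mat2 1 n 0 1 ** \<gamma> \<in> SL2Z" using that by (intro SL2Z_mult) (auto simp: SL2Z_det)
    ultimately show ?case using step1 T by simp
  next
    case (step2 n)
    have "mat2 1 n 0 1 ** \<gamma> = mat_T ** (mat2 1 (n - 1) 0 1 ** \<gamma>)"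
      by (simp add: mat2_eq_iff matrix_mult_2x2 mat_T_def algebra_simps)
    moreover have "mat2 1 (n - 1) 0 1 ** \<gamma> \<in> SL2Z" using that by (intro SL2Z_mult) (auto simp: SL2Z_det)
    ultimately show ?case using step2 T by simp
  qed
  show ?thesis using assms(1)
  proof (induction "nat \<bar>\<gamma>$2$1\<bar>" arbitrary: \<gamma> rule: less_induct)
    case less
    show ?case
    proof (cases "\<gamma>$2$1 = 0")
      case True
      with less.prems have "\<gamma>$1$1 * \<gamma>$2$2 = 1" by (simp add: SL2Z_det)
      then consider "\<gamma>$1$1 = 1" "\<gamma>$2$2 = 1" | "\<gamma>$1$1 = -1" "\<gamma>$2$2 = -1"
        by (auto simp: zmult_eq_1_iff)
      then show ?thesis
      proof cases
        case 1
        then have "\<gamma> = mat2 1 (\<gamma>$1$2) 0 1 ** mat 1" using True by (simp add: mat2_eq_iff)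
        then show ?thesis using Tpow[of "mat 1" "\<gamma>$1$2"] one by (simp add: SL2Z_def)
      next
        case 2
        then have "\<gamma> = mat2 1 (- \<gamma>$1$2) 0 1 ** mat2 (-1) 0 0 (-1)"
          using True by (simp add: mat2_eq_iff matrix_mult_2x2)
        moreover have "mat2 (-1) 0 0 (-1) \<in> SL2Z" by (simp add: SL2Z_det)
        ultimately show ?thesis using Tpow minus_one by metis
      qed
    next
      case False
      define \<delta> where "\<delta> = mat2 1 (- (\<gamma>$1$1 div \<gamma>$2$1)) 0 1 ** \<gamma>"
      have \<delta>: "\<delta> \<in> SL2Z" unfolding \<delta>_def using less.prems by (intro SL2Z_mult) (auto simp: SL2Z_det)
      have "(mat_S ** \<delta>)$2$1 = \<gamma>$1$1 mod \<gamma>$2$1"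
        by (simp add: \<delta>_def mat_S_def matrix_mult_2x2 minus_mult_div_eq_mod mult.commute)
      then have "P (mat_S ** \<delta>)"
        using False \<delta> by (intro less.hyps SL2Z_mult) (auto simp: abs_mod_less mat_S_def SL2Z_det)
      then show ?thesis using S[OF \<delta>] Tpow[OF less.prems] by (simp add: \<delta>_def)
    qed
  qed
qed

lemma nome16_4: "nome16 4 = \<i>"
proof -
  have "nome16 4 = cis (pi / 2)"
    unfolding cis_conv_exp nome16_def by (rule arg_cong[of _ _ exp]) simp
  then show ?thesis by simp
qed

lemma eta32_power4_mobius:
  assumes "\<gamma> \<in> SL2Z" "\<tau> \<in> upper_half_plane"
  shows "eta32 (mobius \<gamma> \<tau>) ^ 4 = \<i> powi eta6_exponent \<gamma> * denom \<gamma> \<tau> ^ 3 * eta32 \<tau> ^ 4"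
proof -
  define P where "P = (\<lambda>\<gamma>. \<forall>\<tau>\<in>upper_half_plane. eta32 (mobius \<gamma> \<tau>) ^ 4 = \<i> powi eta6_exponent \<gamma> * denom \<gamma> \<tau> ^ 3 * eta32 \<tau> ^ 4)"
  have "P \<gamma>" using assms(1)
  proof (induction rule: SL2Z_induct)
    case one
    have "eta6_exponent (mat 1) = 0" by (simp add: eta6_exponent_def mat_def)
    then show ?case by (simp add: P_def)
  next
    case minus_one
    then show ?case by (simp add: P_def eta6_exponent_def mobius_def denom_def)
  next
    case (T \<gamma>)
    have "eta32 (mobius (mat_T ** \<gamma>) \<tau>) ^ 4 = \<i> * eta32 (mobius \<gamma> \<tau>) ^ 4"
      "denom (mat_T ** \<gamma>) \<tau> = denom \<gamma> \<tau>"
      if \<tau>: "\<tau> \<in> upper_half_plane" for \<tau>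
    proof -
      have "mobius mat_T \<sigma> = \<sigma> + 1" "denom mat_T \<sigma> = 1" for \<sigma> by (simp_all add: mobius_def denom_def mat_T_def)
      moreover have "nome16 1 ^ 4 = \<i>" by (simp add: nome16_power nome16_4)
      moreover have "mat_T \<in> SL2Z" by (simp add: mat_T_def SL2Z_det)
      ultimately show "eta32 (mobius (mat_T ** \<gamma>) \<tau>) ^ 4 = \<i> * eta32 (mobius \<gamma> \<tau>) ^ 4"
          "denom (mat_T ** \<gamma>) \<tau> = denom \<gamma> \<tau>"
        using T \<tau> by (simp_all add: mobius_mult denom_mult eta32_add_1 mobius_upper power_mult_distrib)
    qed
    moreover have "\<i> powi eta6_exponent (mat_T ** \<gamma>) = \<i> * \<i> powi eta6_exponent \<gamma>"
      using i_powi_cong[OF eta6_exponent_step(1)[OF T]] by (simp add: power_int_add)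
    ultimately show ?case by (auto simp: P_def mult.assoc)
  next
    case (S \<gamma>)
    have "eta32 (mobius (mat_S ** \<gamma>) \<tau>) ^ 4 = \<i> * (mobius \<gamma> \<tau> ^ 3 * eta32 (mobius \<gamma> \<tau>) ^ 4)"
      "denom (mat_S ** \<gamma>) \<tau> = mobius \<gamma> \<tau> * denom \<gamma> \<tau>" "mobius \<gamma> \<tau> \<noteq> 0"
      if \<tau>: "\<tau> \<in> upper_half_plane" for \<tau>
    proof -
      have "mobius mat_S \<sigma> = - 1 / \<sigma>" "denom mat_S \<sigma> = \<sigma>" for \<sigma> by (simp_all add: mobius_def denom_def mat_S_def)
      moreover have "mat_S \<in> SL2Z" by (simp add: mat_S_def SL2Z_det)
      ultimately show "eta32 (mobius (mat_S ** \<gamma>) \<tau>) ^ 4 = \<i> * (mobius \<gamma> \<tau> ^ 3 * eta32 (mobius \<gamma> \<tau>) ^ 4)"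
          "denom (mat_S ** \<gamma>) \<tau> = mobius \<gamma> \<tau> * denom \<gamma> \<tau>"
        using S \<tau> eta32_power4_inversion[OF mobius_upper[OF S \<tau>]]
        by (simp_all add: mobius_mult denom_mult mult.assoc)
      show "mobius \<gamma> \<tau> \<noteq> 0" using mobius_upper[OF S \<tau>] by (auto simp: upper_half_plane_def)
    qed
    moreover have "\<i> powi eta6_exponent (mat_S ** \<gamma>) = \<i> * \<i> powi eta6_exponent \<gamma>"
      using i_powi_cong[OF eta6_exponent_step(2)[OF S]] by (simp add: power_int_add)
    ultimately show ?case by (auto simp: P_def mult.assoc mult.left_commute power_mult_distrib)
  qed
  then show ?thesis using assms(2) by (simp add: P_def)
qed

text \<open>
  The multiplier has absolute value 1, so fourth roots can be taken in absolute value.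
\<close>

lemma norm_eta32_mobius:
  assumes "\<gamma> \<in> SL2Z" "\<tau> \<in> upper_half_plane"
  shows "norm (eta32 (mobius \<gamma> \<tau>)) = norm (denom \<gamma> \<tau>) powr (3 / 4) * norm (eta32 \<tau>)"
proof -
  have "norm (denom \<gamma> \<tau>) > 0" using denom_nonzero[OF assms] by simp
  then have "(norm (denom \<gamma> \<tau>) powr (3 / 4)) ^ 4 = norm (denom \<gamma> \<tau>) ^ 3"
    by (simp add: powr_power powr_numeral)
  moreover have "norm (eta32 (mobius \<gamma> \<tau>)) ^ 4 = norm (denom \<gamma> \<tau>) ^ 3 * norm (eta32 \<tau>) ^ 4"
    using arg_cong[OF eta32_power4_mobius[OF assms], of norm] by (simp add: norm_mult norm_power norm_power_int)
  ultimately have "norm (eta32 (mobius \<gamma> \<tau>)) ^ 4 = (norm (denom \<gamma> \<tau>) powr (3 / 4) * norm (eta32 \<tau>)) ^ 4"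
    by (simp add: power_mult_distrib)
  then show ?thesis by (rule power_eq_imp_eq_base) auto
qed

section \<open>The automorphy factors\<close>

text \<open>
  A cocycle on all of \<open>SL\<^sub>2(\<int>)\<close> that agrees with the factor of weight \<open>1/4\<close> on \<open>\<Gamma>(16)\<close>. It makes it
  possible to translate forms to the other cusps.
\<close>

definition eta_factor :: "int^2^2 \<Rightarrow> complex \<Rightarrow> complex" where
  "eta_factor \<gamma> \<tau> = denom \<gamma> \<tau> * eta32 \<tau> / eta32 (mobius \<gamma> \<tau>)"

lemma eta_factor_mult:
  assumes "A \<in> SL2Z" "B \<in> SL2Z" "\<tau> \<in> upper_half_plane"
  shows "eta_factor (A ** B) \<tau> = eta_factor A (mobius B \<tau>) * eta_factor B \<tau>"
  using assms eta32_nonzero[OF mobius_upper[OF assms(2,3)]]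
  by (simp add: eta_factor_def denom_mult mobius_mult)

lemma eta_factor_nonzero:
  assumes "\<gamma> \<in> SL2Z" "\<tau> \<in> upper_half_plane"
  shows "eta_factor \<gamma> \<tau> \<noteq> 0"
  using assms denom_nonzero[OF assms] eta32_nonzero eta32_nonzero[OF mobius_upper[OF assms]]
  by (simp add: eta_factor_def)

lemma norm_eta_factor:
  assumes "\<gamma> \<in> SL2Z" "\<tau> \<in> upper_half_plane"
  shows "norm (eta_factor \<gamma> \<tau>) = norm (denom \<gamma> \<tau>) powr (1 / 4)"
proof -
  define x where "x = norm (denom \<gamma> \<tau>)"
  have x: "x > 0" using denom_nonzero[OF assms] by (simp add: x_def)
  have "x = x powr (1 / 4) * x powr (3 / 4)" using x by (simp add: powr_add[symmetric])
  then have "x / x powr (3 / 4) = x powr (1 / 4)" using x by (simp add: field_simps)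
  then show ?thesis
    using eta32_nonzero[OF assms(2)] by (simp add: eta_factor_def norm_mult norm_divide norm_eta32_mobius[OF assms] x_def)
qed

lemma J14_eq_eta_factor:
  "J14 \<gamma> \<tau> = chi4 (\<gamma>$2$2) * c16 \<gamma> * b16 \<gamma> * eta_factor \<gamma> \<tau>"
  by (simp add: J14_def J34_def eta_factor_def field_simps b16_def c16_def)

lemma norm_J:
  assumes "\<gamma> \<in> SL2Z" "\<tau> \<in> upper_half_plane"
  shows "norm (J k \<gamma> \<tau>) = norm (denom \<gamma> \<tau>) powr (real k / 4)"
proof -
  have "norm (chi4 (\<gamma>$2$2)) = 1" "norm (b16 \<gamma>) = 1" "norm (c16 \<gamma>) = 1"
    by (simp_all add: chi4_def norm_power_int b16_def c16_def norm_exp_eq_Re)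
  moreover have "denom \<gamma> \<tau> \<noteq> 0" using denom_nonzero[OF assms] .
  ultimately show ?thesis
    by (simp add: J_def J14_eq_eta_factor norm_power norm_mult norm_eta_factor[OF assms] powr_power mult.commute)
qed

lemma J_nonzero:
  assumes "\<gamma> \<in> SL2Z" "\<tau> \<in> upper_half_plane"
  shows "J k \<gamma> \<tau> \<noteq> 0"
  using norm_J[OF assms, of k] denom_nonzero[OF assms] by auto

lemma holomorphic_mobius:
  assumes "\<gamma> \<in> SL2Z"
  shows "mobius \<gamma> holomorphic_on upper_half_plane"
  unfolding mobius_def using denom_nonzero[OF assms]
  by (intro holomorphic_intros) (auto simp: denom_def[abs_def] intro!: holomorphic_intros)

lemma holomorphic_eta_factor:
  assumes "\<gamma> \<in> SL2Z"
  shows "eta_factor \<gamma> holomorphic_on upper_half_plane"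
proof -
  have "(\<lambda>\<tau>. eta32 (mobius \<gamma> \<tau>)) holomorphic_on upper_half_plane"
    by (rule holomorphic_on_compose_gen[OF holomorphic_mobius[OF assms] holomorphic_eta32, unfolded o_def])
       (use mobius_upper[OF assms] in blast)
  then show ?thesis
    unfolding eta_factor_def denom_def using eta32_nonzero mobius_upper[OF assms]
    by (intro holomorphic_intros holomorphic_eta32) auto
qed

lemma holomorphic_J:
  assumes "\<gamma> \<in> SL2Z"
  shows "J k \<gamma> holomorphic_on upper_half_plane"
  unfolding J_def J14_eq_eta_factor by (intro holomorphic_intros holomorphic_eta_factor assms)

definition Gamma4 :: "(int^2^2) set" where
  "Gamma4 = Gamma_lower0 4 \<inter> Gamma_upper0 4"

lemma Gamma4_SL2Z: "\<gamma> \<in> Gamma4 \<Longrightarrow> \<gamma> \<in> SL2Z"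
  by (simp add: Gamma4_def Gamma_lower0_def)

lemma odd_square_mod_8:
  fixes d :: int
  assumes "odd d"
  obtains k where "d * d = 1 + 8 * k"
proof -
  obtain n where n: "d = 2 * n + 1" using assms by (rule oddE)
  have "even (n * (n + 1))" by simp
  then obtain k where "n * (n + 1) = 2 * k" by (rule evenE)
  then have "d * d = 1 + 8 * k" unfolding n by (simp add: algebra_simps)
  then show ?thesis by (rule that)
qed

lemma Gamma4_odd:
  assumes "\<gamma> \<in> Gamma4"
  shows "odd (\<gamma>$2$2)" "odd (\<gamma>$1$1)"
proof -
  have "\<gamma>$1$1 * \<gamma>$2$2 = 1 + \<gamma>$1$2 * \<gamma>$2$1" "even (\<gamma>$1$2)"
    using assms by (auto simp: Gamma4_def Gamma_lower0_def Gamma_upper0_def SL2Z_det elim: dvd_trans[rotated])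
  then have "odd (\<gamma>$1$1 * \<gamma>$2$2)" by simp
  then show "odd (\<gamma>$2$2)" "odd (\<gamma>$1$1)" by simp_all
qed

text \<open>
  At integers, \<open>nome16\<close> is the standard additive character modulo 16; this and its converse reduce
  questions about \<open>b\<^sub>1\<^sub>6\<close> and \<open>c\<^sub>1\<^sub>6\<close> to congruences.
\<close>

lemma nome16_of_int_cong:
  assumes "[m = n] (mod 16)"
  shows "nome16 (of_int m) = nome16 (of_int n)"
proof -
  obtain k where k: "m = n + 16 * k" using assms by (metis cong_iff_lin cong_sym)
  have "nome16 (of_int (16 * k)) = 1"
    unfolding nome16_def exp_eq_1 by (auto intro!: exI[of _ k])
  then show ?thesis by (simp add: k nome16_add)
qed

lemma nome16_of_int_eq_1D:
  assumes "nome16 (of_int m) = 1"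
  shows "16 dvd m"
proof -
  obtain n where "2 * pi * real_of_int m / 16 = of_int (2 * n) * pi"
    using assms unfolding nome16_def exp_eq_1 by auto
  then have "real_of_int m = of_int (16 * n)" by (simp add: field_simps)
  then show ?thesis by (simp only: of_int_eq_iff dvd_triv_left)
qed

lemma b16_nome16: "b16 \<gamma> = nome16 (of_int (\<gamma>$1$2 * \<gamma>$2$2))"
  and c16_nome16: "c16 \<gamma> = nome16 (of_int (- (\<gamma>$2$1 * \<gamma>$2$2)))"
  by (simp_all add: b16_def c16_def nome16_def mult_ac)

lemma chi4_odd:
  assumes "odd d"
  shows "chi4 d = (if [d = 1] (mod 4) then 1 else - 1)"
proof -
  obtain n where n: "d = 2 * n + 1" using assms by (rule oddE)
  then have "chi4 d = (if even n then 1 else - 1)" by (simp add: chi4_def power_int_minus_left)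
  moreover have "[d = 1] (mod 4) \<longleftrightarrow> even n" unfolding n cong_def by presburger
  ultimately show ?thesis by simp
qed

text \<open>
  With \<open>4 | b, c\<close> and \<open>ad - bc = 1\<close>, all cross terms in \<open>b d\<close> and \<open>c d\<close> of a product are divisible by 16;
  the remaining terms have the form \<open>b d d'\<^sup>2\<close>, where \<open>d'\<^sup>2 \<equiv> 1\<close> modulo 8.
\<close>

lemma Gamma4_character_mult:
  assumes "A \<in> Gamma4" "B \<in> Gamma4"
  shows "b16 (A ** B) = b16 A * b16 B" "c16 (A ** B) = c16 A * c16 B"
    "chi16 ((A ** B)$2$2) = chi16 (A$2$2) * chi16 (B$2$2)"
    "chi4 ((A ** B)$2$2) = chi4 (A$2$2) * chi4 (B$2$2)"
proof -
  obtain a b c d where A: "A$1$1 = a" "A$1$2 = 4 * b" "A$2$1 = 4 * c" "A$2$2 = d"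
    using assms(1) unfolding Gamma4_def Gamma_lower0_def Gamma_upper0_def by (auto elim!: dvdE)
  obtain a' b' c' d' where B: "B$1$1 = a'" "B$1$2 = 4 * b'" "B$2$1 = 4 * c'" "B$2$2 = d'"
    using assms(2) unfolding Gamma4_def Gamma_lower0_def Gamma_upper0_def by (auto elim!: dvdE)
  have det: "a * d = 1 + 16 * b * c" "a' * d' = 1 + 16 * b' * c'"
    using Gamma4_SL2Z[OF assms(1)] Gamma4_SL2Z[OF assms(2)] by (simp_all add: SL2Z_det A B)
  have odd: "odd d" "odd d'" using Gamma4_odd[OF assms(1)] Gamma4_odd[OF assms(2)] by (simp_all add: A B)
  obtain k k' where k: "d * d = 1 + 8 * k" "d' * d' = 1 + 8 * k'"
    using odd_square_mod_8[OF odd(1)] odd_square_mod_8[OF odd(2)] by metis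
  have b: "(a * (4 * b') + 4 * b * d') * (4 * c * (4 * b') + d * d')
      = 4 * b * d + 4 * b' * d' + 16 * (4 * a * c * b' * b' + 8 * b * c * b' * d' + 2 * b * d * k')"
  proof -
    have "(a * (4 * b') + 4 * b * d') * (4 * c * (4 * b') + d * d')
      = 64 * a * c * b' * b' + 4 * b' * d' * (a * d) + 64 * b * c * b' * d' + 4 * b * d * (d' * d')"
      by (simp add: algebra_simps)
    then show ?thesis unfolding det k by (simp add: algebra_simps)
  qed
  have c: "(4 * c * a' + d * (4 * c')) * (4 * c * (4 * b') + d * d')
      = 4 * c * d + 4 * c' * d' + 16 * (4 * c * c * a' * b' + 8 * c * d * b' * c' + 2 * c' * d' * k)"
  proof -
    have "(4 * c * a' + d * (4 * c')) * (4 * c * (4 * b') + d * d')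
      = 64 * c * c * a' * b' + 4 * c * d * (a' * d') + 64 * c * d * b' * c' + 4 * c' * d' * (d * d)"
      by (simp add: algebra_simps)
    then show ?thesis unfolding det k by (simp add: algebra_simps)
  qed
  have d: "(A ** B)$2$2 = d * d' + 16 * (c * b')"
    by (simp add: matrix_mult_2x2 A B)
  have cong16: "[x + 16 * y = x] (mod 16)" for x y :: int by (simp add: cong_def)
  have "b16 (A ** B) = nome16 (of_int (4 * b * d + 4 * b' * d'))"
    unfolding b16_nome16 matrix_mult_2x2 A B b by (rule nome16_of_int_cong[OF cong16])
  then show "b16 (A ** B) = b16 A * b16 B" by (simp add: b16_nome16 A B nome16_add)
  have "c16 (A ** B) = nome16 (of_int (- (4 * c * d + 4 * c' * d')))"
    unfolding c16_nome16 matrix_mult_2x2 A B c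
    by (rule nome16_of_int_cong[OF iffD2[OF cong_minus_minus_iff cong16]])
  also have "\<dots> = nome16 (of_int (- (4 * c * d)) + of_int (- (4 * c' * d')))" by simp
  finally show "c16 (A ** B) = c16 A * c16 B" by (simp only: c16_nome16 A B nome16_add)
  show "chi16 ((A ** B)$2$2) = chi16 (A$2$2) * chi16 (B$2$2)"
    using chi16_cong[of "d * d' + 16 * (c * b')" "d * d'"] unfolding d A B by (simp add: cong_def chi16_mult)
  have "[d * d' + 16 * (c * b') = 1] (mod 4) \<longleftrightarrow> ([d = 1] (mod 4) \<longleftrightarrow> [d' = 1] (mod 4))"
  proof -
    obtain m m' where "d = 2 * m + 1" "d' = 2 * m' + 1" using odd by (auto elim!: oddE)
    then have "d * d' + 16 * (c * b') - 1 = 4 * (m * m' + 4 * c * b') + 2 * (m + m')" "d - 1 = 2 * m" "d' - 1 = 2 * m'"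
      by (simp_all add: algebra_simps)
    then show ?thesis unfolding cong_iff_dvd_diff by presburger
  qed
  then show "chi4 ((A ** B)$2$2) = chi4 (A$2$2) * chi4 (B$2$2)"
    unfolding d A B using odd by (subst (1 2 3) chi4_odd) auto
qed

lemma J_mult:
  assumes "A \<in> Gamma4" "B \<in> Gamma4" "\<tau> \<in> upper_half_plane"
  shows "J k (A ** B) \<tau> = J k A (mobius B \<tau>) * J k B \<tau>"
proof -
  have "J14 (A ** B) \<tau> = J14 A (mobius B \<tau>) * J14 B \<tau>"
    by (simp add: J14_eq_eta_factor Gamma4_character_mult[OF assms(1,2)]
        eta_factor_mult[OF Gamma4_SL2Z[OF assms(1)] Gamma4_SL2Z[OF assms(2)] assms(3)])
  then show ?thesis by (simp add: J_def power_mult_distrib)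
qed

lemma J_uminus:
  assumes "\<gamma> \<in> Gamma4"
  shows "J k (- \<gamma>) \<tau> = J k \<gamma> \<tau>" "mobius (- \<gamma>) \<tau> = mobius \<gamma> \<tau>"
proof -
  have d: "denom (- \<gamma>) \<tau> = - denom \<gamma> \<tau>" by (simp add: denom_def)
  have n: "of_int ((- \<gamma>)$1$1) * \<tau> + of_int ((- \<gamma>)$1$2) = - (of_int (\<gamma>$1$1) * \<tau> + complex_of_int (\<gamma>$1$2))" by simp
  show m: "mobius (- \<gamma>) \<tau> = mobius \<gamma> \<tau>" unfolding mobius_def d n minus_divide_divide ..
  have "chi4 (- (\<gamma>$2$2)) = - chi4 (\<gamma>$2$2)"
  proof -
    have "[- d = 1] (mod 4) \<longleftrightarrow> \<not> [d = 1] (mod 4)" if "odd d" for d :: int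
      using that unfolding cong_iff_dvd_diff by presburger
    from this[OF Gamma4_odd(1)[OF assms]]
    have "[- (\<gamma>$2$2) = 1] (mod 4) \<longleftrightarrow> \<not> [\<gamma>$2$2 = 1] (mod 4)" .
    then show ?thesis using Gamma4_odd[OF assms] by (simp add: chi4_odd)
  qed
  moreover have "eta_factor (- \<gamma>) \<tau> = - eta_factor \<gamma> \<tau>" by (simp add: eta_factor_def m d)
  ultimately show "J k (- \<gamma>) \<tau> = J k \<gamma> \<tau>"
    by (simp add: J_def J14_eq_eta_factor b16_def c16_def)
qed

section \<open>The slash operators\<close>

text \<open>
  The value 0 outside the half plane keeps functions on the half plane in their canonical
  representation.
\<close>

definition slash :: "nat \<Rightarrow> int^2^2 \<Rightarrow> (complex \<Rightarrow> complex) \<Rightarrow> complex \<Rightarrow> complex" where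
  "slash k \<gamma> f \<tau> = (if \<tau> \<in> upper_half_plane then f (mobius \<gamma> \<tau>) / J k \<gamma> \<tau> else 0)"

lemma slash_mult:
  assumes "A \<in> Gamma4" "B \<in> Gamma4"
  shows "slash k (A ** B) f = slash k B (slash k A f)"
proof
  fix \<tau>
  show "slash k (A ** B) f \<tau> = slash k B (slash k A f) \<tau>"
    using J_mult[OF assms, of \<tau> k] mobius_mult[OF Gamma4_SL2Z[OF assms(1)] Gamma4_SL2Z[OF assms(2)], of \<tau>]
      mobius_upper[OF Gamma4_SL2Z[OF assms(2)], of \<tau>]
    by (simp add: slash_def)
qed

text \<open>
  In \<open>J\<close> the sign of \<open>\<chi>\<^sub>4(d)\<close> compensates that of \<open>c\<tau> + d\<close>.
\<close>

lemma slash_uminus: "\<gamma> \<in> Gamma4 \<Longrightarrow> slash k (- \<gamma>) f = slash k \<gamma> f"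
  unfolding slash_def[abs_def] by (simp only: J_uminus)

text \<open>
  The conditions on modular forms that do not involve a group: they are preserved by the slash
  operators and by linear combinations.
\<close>

definition moderate_growth :: "nat \<Rightarrow> (complex \<Rightarrow> complex) set" where
  "moderate_growth k = {f. f holomorphic_on upper_half_plane \<and> (\<forall>\<tau>. \<tau> \<notin> upper_half_plane \<longrightarrow> f \<tau> = 0) \<and>
     (\<forall>\<gamma>\<in>SL2Z. Bfun (cusp_abs k f \<gamma>) (filtercomap Im at_top))}"

text \<open>
  As the automorphy factor has no zeros, the transformation law is an eigenvector condition.
\<close>

lemma modular_forms_slash:
  assumes "\<Gamma> \<subseteq> SL2Z"
  shows "modular_forms \<Gamma> k chi = {f \<in> moderate_growth k. \<forall>\<gamma>\<in>\<Gamma>. slash k \<gamma> f = (\<lambda>\<tau>. chi \<gamma> * f \<tau>)}"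
proof -
  have key: "(\<forall>\<tau>\<in>upper_half_plane. f (mobius \<gamma> \<tau>) = chi \<gamma> * J k \<gamma> \<tau> * f \<tau>) \<longleftrightarrow> slash k \<gamma> f = (\<lambda>\<tau>. chi \<gamma> * f \<tau>)"
    if \<gamma>: "\<gamma> \<in> \<Gamma>" and f: "f \<in> moderate_growth k" for f \<gamma>
  proof -
    have "f (mobius \<gamma> \<tau>) = chi \<gamma> * J k \<gamma> \<tau> * f \<tau> \<longleftrightarrow> slash k \<gamma> f \<tau> = chi \<gamma> * f \<tau>" if "\<tau> \<in> upper_half_plane" for \<tau>
    proof -
      have "J k \<gamma> \<tau> \<noteq> 0" using J_nonzero that \<gamma> assms by blast
      then show ?thesis using that by (simp add: slash_def divide_eq_eq mult_ac)
    qed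
    moreover have "slash k \<gamma> f \<tau> = chi \<gamma> * f \<tau>" if "\<tau> \<notin> upper_half_plane" for \<tau>
      using that f by (simp add: slash_def moderate_growth_def)
    ultimately show ?thesis unfolding fun_eq_iff by metis
  qed
  have "modular_forms \<Gamma> k chi =
      {f. f \<in> moderate_growth k \<and> (\<forall>\<gamma>\<in>\<Gamma>. \<forall>\<tau>\<in>upper_half_plane. f (mobius \<gamma> \<tau>) = chi \<gamma> * J k \<gamma> \<tau> * f \<tau>)}"
    unfolding modular_forms_def automorphic_def moderate_growth_def mem_Collect_eq
    by (intro Collect_cong) argo
  also have "\<dots> = {f. f \<in> moderate_growth k \<and> (\<forall>\<gamma>\<in>\<Gamma>. slash k \<gamma> f = (\<lambda>\<tau>. chi \<gamma> * f \<tau>))}"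
    by (intro Collect_cong conj_cong refl ball_cong key)
  finally show ?thesis .
qed

lemma eventually_upper_half_plane: "\<forall>\<^sub>F \<tau> in filtercomap Im at_top. \<tau> \<in> upper_half_plane"
  unfolding upper_half_plane_def using eventually_filtercomapI[OF eventually_gt_at_top[of 0]] by simp

lemma cusp_abs_slash:
  assumes r: "r \<in> SL2Z" and \<gamma>: "\<gamma> \<in> SL2Z" and \<tau>: "\<tau> \<in> upper_half_plane"
  shows "cusp_abs k (slash k r f) \<gamma> \<tau> = cusp_abs k f (r ** \<gamma>) \<tau>"
proof -
  have "norm (slash k r f (mobius \<gamma> \<tau>)) =
      norm (denom r (mobius \<gamma> \<tau>)) powr (- (real k / 4)) * norm (f (mobius (r ** \<gamma>) \<tau>))"
    using mobius_upper[OF \<gamma> \<tau>]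
    by (simp add: slash_def norm_divide norm_J[OF r] mobius_mult[OF r \<gamma> \<tau>] powr_minus_divide)
  then show ?thesis
    unfolding cusp_abs_def denom_mult[OF \<gamma> \<tau>] norm_mult by (simp only: powr_mult norm_ge_zero mult_ac)
qed

lemma Bfun_cong:
  assumes "Bfun f F" "\<forall>\<^sub>F x in F. norm (g x) = norm (f x)"
  shows "Bfun g F"
proof -
  obtain K where "K > 0" "\<forall>\<^sub>F x in F. norm (f x) \<le> K" using assms(1) by (auto simp: Bfun_def)
  with assms(2) have "\<forall>\<^sub>F x in F. norm (g x) \<le> K" by (auto elim: eventually_elim2)
  with \<open>K > 0\<close> show ?thesis by (auto simp: Bfun_def)
qed

lemma moderate_growth_slash:
  assumes r: "r \<in> SL2Z" and f: "f \<in> moderate_growth k"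
  shows "slash k r f \<in> moderate_growth k"
proof -
  have "(\<lambda>\<tau>. f (mobius r \<tau>) / J k r \<tau>) holomorphic_on upper_half_plane"
  proof (intro holomorphic_on_divide holomorphic_J r)
    show "(\<lambda>\<tau>. f (mobius r \<tau>)) holomorphic_on upper_half_plane"
      using holomorphic_on_compose_gen[OF holomorphic_mobius[OF r], of f upper_half_plane] mobius_upper[OF r] f
      by (fastforce simp: o_def moderate_growth_def)
  qed (use J_nonzero[OF r] in auto)
  then have "slash k r f holomorphic_on upper_half_plane"
    by (rule holomorphic_transform) (simp add: slash_def)
  moreover have "Bfun (cusp_abs k (slash k r f) \<gamma>) (filtercomap Im at_top)" if \<gamma>: "\<gamma> \<in> SL2Z" for \<gamma>
  proof (rule Bfun_cong)
    show "Bfun (cusp_abs k f (r ** \<gamma>)) (filtercomap Im at_top)"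
      using f SL2Z_mult[OF r \<gamma>] by (simp add: moderate_growth_def)
    show "\<forall>\<^sub>F \<tau> in filtercomap Im at_top. norm (cusp_abs k (slash k r f) \<gamma> \<tau>) = norm (cusp_abs k f (r ** \<gamma>) \<tau>)"
      using eventually_upper_half_plane by eventually_elim (simp add: cusp_abs_slash r \<gamma>)
  qed
  ultimately show ?thesis by (simp add: moderate_growth_def slash_def)
qed

lemma moderate_growthD:
  "f \<in> moderate_growth k \<Longrightarrow> \<gamma> \<in> SL2Z \<Longrightarrow> Bfun (cusp_abs k f \<gamma>) (filtercomap Im at_top)"
  by (simp add: moderate_growth_def)

lemma moderate_growth_scale:
  assumes f: "f \<in> moderate_growth k"
  shows "(\<lambda>\<tau>. c * f \<tau>) \<in> moderate_growth k"
proof -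
  have "Bfun (cusp_abs k (\<lambda>\<tau>. c * f \<tau>) \<gamma>) (filtercomap Im at_top)" if \<gamma>: "\<gamma> \<in> SL2Z" for \<gamma>
  proof -
    obtain K where K: "K > 0" "\<forall>\<^sub>F \<tau> in filtercomap Im at_top. norm (cusp_abs k f \<gamma> \<tau>) \<le> K"
      using moderate_growthD[OF f \<gamma>] by (blast elim: BfunE)
    have "\<forall>\<^sub>F \<tau> in filtercomap Im at_top. norm (cusp_abs k (\<lambda>\<tau>. c * f \<tau>) \<gamma> \<tau>) \<le> norm c * K"
      using K(2)
    proof eventually_elim
      case (elim \<tau>)
      have "norm (cusp_abs k (\<lambda>\<tau>. c * f \<tau>) \<gamma> \<tau>) = norm c * norm (cusp_abs k f \<gamma> \<tau>)"
        by (simp add: cusp_abs_def norm_mult)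
      also have "\<dots> \<le> norm c * K" using elim by (intro mult_left_mono) auto
      finally show ?case .
    qed
    then show ?thesis by (rule BfunI)
  qed
  with f show ?thesis by (auto simp: moderate_growth_def intro!: holomorphic_intros)
qed

lemma moderate_growth_add:
  assumes f: "f \<in> moderate_growth k" and g: "g \<in> moderate_growth k"
  shows "(\<lambda>\<tau>. f \<tau> + g \<tau>) \<in> moderate_growth k"
proof -
  have "Bfun (cusp_abs k (\<lambda>\<tau>. f \<tau> + g \<tau>) \<gamma>) (filtercomap Im at_top)" if \<gamma>: "\<gamma> \<in> SL2Z" for \<gamma>
  proof -
    obtain K where K: "\<forall>\<^sub>F \<tau> in filtercomap Im at_top. norm (cusp_abs k f \<gamma> \<tau>) \<le> K"
      using moderate_growthD[OF f \<gamma>] by (blast elim: BfunE)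
    obtain L where L: "\<forall>\<^sub>F \<tau> in filtercomap Im at_top. norm (cusp_abs k g \<gamma> \<tau>) \<le> L"
      using moderate_growthD[OF g \<gamma>] by (blast elim: BfunE)
    from K L have "\<forall>\<^sub>F \<tau> in filtercomap Im at_top. norm (cusp_abs k (\<lambda>\<tau>. f \<tau> + g \<tau>) \<gamma> \<tau>) \<le> K + L"
    proof eventually_elim
      case (elim \<tau>)
      have "cusp_abs k (\<lambda>\<tau>. f \<tau> + g \<tau>) \<gamma> \<tau> \<le> cusp_abs k f \<gamma> \<tau> + cusp_abs k g \<gamma> \<tau>"
        unfolding cusp_abs_def distrib_left[symmetric]
        by (intro mult_left_mono norm_triangle_ineq) auto
      moreover have "cusp_abs k (\<lambda>\<tau>. f \<tau> + g \<tau>) \<gamma> \<tau> \<ge> 0" by (simp add: cusp_abs_def)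
      ultimately show ?case using elim by simp
    qed
    then show ?thesis by (rule BfunI)
  qed
  with f g show ?thesis by (auto simp: moderate_growth_def intro!: holomorphic_intros)
qed

lemma moderate_growth_sum:
  assumes "\<And>i. i \<in> I \<Longrightarrow> F i \<in> moderate_growth k"
  shows "(\<lambda>\<tau>. \<Sum>i\<in>I. F i \<tau>) \<in> moderate_growth k"
proof -
  have zero: "(\<lambda>_. 0) \<in> moderate_growth k"
    by (simp add: moderate_growth_def cusp_abs_def[abs_def])
  show ?thesis using assms
    by (induction I rule: infinite_finite_induct) (auto simp: zero moderate_growth_add)
qed

section \<open>Decomposition into eigenspaces of a finite group\<close>

abbreviation (input) Gamma16 :: "(int^2^2) set" where "Gamma16 \<equiv> Gamma_principal 16"

lemma Gamma16_Gamma4: "\<gamma> \<in> Gamma16 \<Longrightarrow> \<gamma> \<in> Gamma4"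
proof -
  assume "\<gamma> \<in> Gamma16"
  then have "\<gamma> \<in> SL2Z" "16 dvd \<gamma>$1$2" "16 dvd \<gamma>$2$1"
    by (simp_all add: Gamma_principal_def cong_0_iff)
  moreover have "(4::int) dvd 16" by simp
  ultimately show "\<gamma> \<in> Gamma4"
    unfolding Gamma4_def Gamma_lower0_def Gamma_upper0_def using dvd_trans by blast
qed

lemma slash_Gamma16:
  assumes "f \<in> modular_forms Gamma16 k (\<lambda>_. 1)" "\<delta> \<in> Gamma4" "\<delta> \<in> Gamma16 \<or> - \<delta> \<in> Gamma16"
  shows "slash k \<delta> f = f"
proof -
  have *: "slash k \<gamma> f = f" if "\<gamma> \<in> Gamma16" for \<gamma>
  proof -
    have "Gamma16 \<subseteq> SL2Z" by (auto simp: Gamma_principal_def)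
    from modular_forms_slash[OF this] show ?thesis using assms(1) that by simp
  qed
  from assms(3) show ?thesis
  proof
    assume "- \<delta> \<in> Gamma16"
    from *[OF this] show ?thesis using slash_uminus[OF assms(2)] by simp
  qed (rule *)
qed

text \<open>
  Fourier analysis on the finite abelian group \<open>G / \<plusminus>\<Gamma>(16)\<close>. The matrices \<open>r \<kappa>\<close> represent its
  elements, and the characters \<open>chi i\<close> are its dual group. The two orthogonality relations say that the
  averages \<open>P i\<close> reproduce every form and separate the eigenspaces.
\<close>

theorem character_decomposition:
  fixes G :: "(int^2^2) set" and chi :: "'i \<Rightarrow> int^2^2 \<Rightarrow> complex" and r :: "'j \<Rightarrow> int^2^2"
  assumes G: "G \<subseteq> Gamma4" "\<And>A B. A \<in> G \<Longrightarrow> B \<in> G \<Longrightarrow> A ** B \<in> G" "\<And>A. A \<in> G \<Longrightarrow> adj2 A \<in> G" "Gamma16 \<subseteq> G"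
    and fin: "finite I" "finite K"
    and mult: "\<And>i A B. i \<in> I \<Longrightarrow> A \<in> G \<Longrightarrow> B \<in> G \<Longrightarrow> chi i (A ** B) = chi i A * chi i B"
    and nonzero: "\<And>i A. i \<in> I \<Longrightarrow> A \<in> G \<Longrightarrow> chi i A \<noteq> 0"
    and triv: "\<And>i A. i \<in> I \<Longrightarrow> A \<in> Gamma16 \<Longrightarrow> chi i A = 1"
    and ker: "\<And>A. A \<in> G \<Longrightarrow> \<forall>i\<in>I. chi i A = 1 \<Longrightarrow> A \<in> Gamma16 \<or> - A \<in> Gamma16"
    and r: "\<And>\<kappa>. \<kappa> \<in> K \<Longrightarrow> r \<kappa> \<in> G"
    and surj: "\<And>A. A \<in> G \<Longrightarrow> \<exists>\<kappa>\<in>K. \<forall>i\<in>I. chi i A = chi i (r \<kappa>)"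
    and inj: "\<And>\<kappa> \<kappa>'. \<kappa> \<in> K \<Longrightarrow> \<kappa>' \<in> K \<Longrightarrow> \<forall>i\<in>I. chi i (r \<kappa>) = chi i (r \<kappa>') \<Longrightarrow> \<kappa> = \<kappa>'"
    and orth1: "\<And>i j. i \<in> I \<Longrightarrow> j \<in> I \<Longrightarrow> (\<Sum>\<kappa>\<in>K. chi i (r \<kappa>) / chi j (r \<kappa>)) = (if i = j then of_nat (card K) else 0)"
    and orth2: "\<And>\<kappa>. \<kappa> \<in> K \<Longrightarrow> \<not> (\<forall>i\<in>I. chi i (r \<kappa>) = 1) \<Longrightarrow> (\<Sum>i\<in>I. 1 / chi i (r \<kappa>)) = 0"
    and card: "card I = card K"
  shows "internal_direct_sum I (\<lambda>i. modular_forms G k (chi i)) (modular_forms Gamma16 k (\<lambda>_. 1))"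
proof -
  define W where "W = modular_forms Gamma16 k (\<lambda>_. 1)"
  define V where "V = (\<lambda>i. modular_forms G k (chi i))"
  have GS: "G \<subseteq> SL2Z" using G(1) Gamma4_SL2Z by blast
  have G16S: "Gamma16 \<subseteq> SL2Z" using GS G(4) by blast
  have W_iff: "f \<in> W \<longleftrightarrow> f \<in> moderate_growth k \<and> (\<forall>\<gamma>\<in>Gamma16. slash k \<gamma> f = f)" for f
    unfolding W_def modular_forms_slash[OF G16S] by simp
  have V_iff: "f \<in> V i \<longleftrightarrow> f \<in> moderate_growth k \<and> (\<forall>\<gamma>\<in>G. slash k \<gamma> f = (\<lambda>\<tau>. chi i \<gamma> * f \<tau>))" for f i
    unfolding V_def modular_forms_slash[OF GS] by simp
  have one: "mat 1 \<in> G" 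
  proof -
    have "mat 1 \<in> Gamma16" unfolding Gamma_principal_def SL2Z_det mem_Collect_eq by (simp add: mat_def)
    then show ?thesis using G(4) by blast
  qed
  have VW: "f \<in> W" if "i \<in> I" "f \<in> V i" for i f
    using that G(4) triv[OF \<open>i \<in> I\<close>] unfolding W_iff V_iff by auto
  have slash_eq: "slash k A f = slash k B f"
    if f: "f \<in> W" and AB: "A \<in> G" "B \<in> G" "\<forall>i\<in>I. chi i A = chi i B" for f A B
  proof -
    define \<delta> where "\<delta> = A ** adj2 B"
    have B: "B \<in> SL2Z" using AB GS by blast
    have \<delta>: "\<delta> \<in> G" "\<delta> ** B = A"
      using G AB adj2_cancel(3)[OF B] by (auto simp: \<delta>_def)
    have "chi i \<delta> = 1" if "i \<in> I" for i
      using mult[OF that \<delta>(1) AB(2)] nonzero[OF that AB(2)] AB(3) that \<delta>(2) by auto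
    then have "slash k \<delta> f = f"
      using f \<delta>(1) G(1) ker[OF \<delta>(1)] unfolding W_def by (intro slash_Gamma16) auto
    moreover have "slash k (\<delta> ** B) f = slash k B (slash k \<delta> f)"
      using \<delta>(1) AB(2) G(1) by (intro slash_mult) auto
    ultimately show ?thesis by (simp add: \<delta>(2))
  qed
  define n :: complex where "n = of_nat (card K)"
  have n: "n \<noteq> 0" using surj[OF one] fin(2) by (auto simp: n_def)
  \<comment> \<open>The projection to the eigenspace of \<open>chi i\<close>.\<close>
  define P where "P = (\<lambda>i f \<tau>. (\<Sum>\<kappa>\<in>K. slash k (r \<kappa>) f \<tau> / chi i (r \<kappa>)) / n)"
  have PV: "P i f \<in> V i" if i: "i \<in> I" and f: "f \<in> W" for i f
    unfolding V_iff
  proof (intro conjI ballI)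
    have "P i f = (\<lambda>\<tau>. \<Sum>\<kappa>\<in>K. (1 / (chi i (r \<kappa>) * n)) * slash k (r \<kappa>) f \<tau>)"
      by (simp add: P_def sum_divide_distrib mult_ac)
    moreover have "(\<lambda>\<tau>. \<Sum>\<kappa>\<in>K. (1 / (chi i (r \<kappa>) * n)) * slash k (r \<kappa>) f \<tau>) \<in> moderate_growth k"
      using f r GS unfolding W_iff
      by (intro moderate_growth_sum moderate_growth_scale moderate_growth_slash) auto
    ultimately show "P i f \<in> moderate_growth k" by simp
  next
    fix \<gamma> assume \<gamma>: "\<gamma> \<in> G"
    \<comment> \<open>Right translation by \<open>\<gamma>\<close> permutes the representatives up to \<open>\<plusminus>\<Gamma>(16)\<close>.\<close>
    have "\<forall>\<kappa>\<in>K. \<exists>\<kappa>'\<in>K. \<forall>i\<in>I. chi i (r \<kappa> ** \<gamma>) = chi i (r \<kappa>')"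
      using surj G(2)[OF r \<gamma>] by blast
    then obtain \<sigma> where \<sigma>: "\<And>\<kappa>. \<kappa> \<in> K \<Longrightarrow> \<sigma> \<kappa> \<in> K"
        "\<And>\<kappa> i. \<kappa> \<in> K \<Longrightarrow> i \<in> I \<Longrightarrow> chi i (r \<kappa> ** \<gamma>) = chi i (r (\<sigma> \<kappa>))"
      by metis
    have "inj_on \<sigma> K"
    proof (rule inj_onI)
      fix \<kappa> \<kappa>' assume \<kappa>: "\<kappa> \<in> K" "\<kappa>' \<in> K" "\<sigma> \<kappa> = \<sigma> \<kappa>'"
      have "chi i (r \<kappa>) = chi i (r \<kappa>')" if "i \<in> I" for i
      proof -
        have "chi i (r \<kappa>) * chi i \<gamma> = chi i (r \<kappa>') * chi i \<gamma>"
          using \<sigma>(2)[OF \<kappa>(1) that] \<sigma>(2)[OF \<kappa>(2) that] mult[OF that r[OF \<kappa>(1)] \<gamma>] mult[OF that r[OF \<kappa>(2)] \<gamma>] \<kappa>(3) by simp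
        then show ?thesis using nonzero[OF that \<gamma>] by simp
      qed
      then show "\<kappa> = \<kappa>'" using inj[OF \<kappa>(1,2)] by blast
    qed
    then have bij: "bij_betw \<sigma> K K"
      using \<sigma>(1) fin(2) by (intro bij_betw_imageI endo_inj_surj) auto
    show "slash k \<gamma> (P i f) = (\<lambda>\<tau>. chi i \<gamma> * P i f \<tau>)"
    proof
      fix \<tau>
      have term_eq: "slash k \<gamma> (slash k (r \<kappa>) f) \<tau> / chi i (r \<kappa>) =
              chi i \<gamma> * (slash k (r (\<sigma> \<kappa>)) f \<tau> / chi i (r (\<sigma> \<kappa>)))" if \<kappa>: "\<kappa> \<in> K" for \<kappa>
      proof -
        have "slash k \<gamma> (slash k (r \<kappa>) f) = slash k (r \<kappa> ** \<gamma>) f"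
          using r[OF \<kappa>] \<gamma> G(1) by (subst slash_mult) auto
        also have "\<dots> = slash k (r (\<sigma> \<kappa>)) f"
          using \<sigma> \<kappa> r \<gamma> G(2) by (intro slash_eq[OF f]) auto
        finally have "slash k \<gamma> (slash k (r \<kappa>) f) = slash k (r (\<sigma> \<kappa>)) f" .
        moreover have "chi i (r (\<sigma> \<kappa>)) = chi i (r \<kappa>) * chi i \<gamma>"
          using \<sigma>(2)[OF \<kappa> i] mult[OF i r[OF \<kappa>] \<gamma>] by simp
        ultimately show ?thesis using nonzero[OF i \<gamma>] nonzero[OF i r[OF \<kappa>]] by simp
      qed
      have "slash k \<gamma> (P i f) \<tau> = (\<Sum>\<kappa>\<in>K. slash k \<gamma> (slash k (r \<kappa>) f) \<tau> / chi i (r \<kappa>)) / n"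
        by (simp add: slash_def[of k \<gamma>] P_def sum_divide_distrib mult_ac)
      also have "(\<Sum>\<kappa>\<in>K. slash k \<gamma> (slash k (r \<kappa>) f) \<tau> / chi i (r \<kappa>))
          = (\<Sum>\<kappa>\<in>K. chi i \<gamma> * (slash k (r (\<sigma> \<kappa>)) f \<tau> / chi i (r (\<sigma> \<kappa>))))"
        by (intro sum.cong refl term_eq)
      also have "\<dots> = chi i \<gamma> * (\<Sum>\<kappa>\<in>K. slash k (r \<kappa>) f \<tau> / chi i (r \<kappa>))"
        using sum.reindex_bij_betw[OF bij, of "\<lambda>\<kappa>. slash k (r \<kappa>) f \<tau> / chi i (r \<kappa>)"]
        by (simp only: sum_distrib_left[symmetric])
      finally show "slash k \<gamma> (P i f) \<tau> = chi i \<gamma> * P i f \<tau>" by (simp add: P_def)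
    qed
  qed
  have sum_P: "(\<lambda>\<tau>. \<Sum>i\<in>I. P i f \<tau>) = f" if f: "f \<in> W" for f
  proof
    fix \<tau>
    obtain \<kappa>0 where \<kappa>0: "\<kappa>0 \<in> K" "\<And>i. i \<in> I \<Longrightarrow> chi i (mat 1) = chi i (r \<kappa>0)" using surj[OF one] by blast
    have chi_one: "chi i (mat 1) = 1" if "i \<in> I" for i
      using mult[OF that one one] nonzero[OF that one] by simp
    have S: "(\<Sum>i\<in>I. 1 / chi i (r \<kappa>)) = (if \<kappa> = \<kappa>0 then n else 0)" if \<kappa>: "\<kappa> \<in> K" for \<kappa>
    proof (cases "\<kappa> = \<kappa>0")
      case True
      have "(\<Sum>i\<in>I. 1 / chi i (r \<kappa>)) = (\<Sum>i\<in>I. 1)"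
        using \<kappa>0 chi_one True by (intro sum.cong) simp_all
      then show ?thesis using True card by (simp add: n_def)
    next
      case False
      then have "\<not> (\<forall>i\<in>I. chi i (r \<kappa>) = 1)"
        using inj[OF \<kappa> \<kappa>0(1)] \<kappa>0(2) chi_one by auto
      then show ?thesis using orth2[OF \<kappa>] False by simp
    qed
    have "(\<Sum>i\<in>I. P i f \<tau>) = (\<Sum>i\<in>I. \<Sum>\<kappa>\<in>K. slash k (r \<kappa>) f \<tau> * (1 / chi i (r \<kappa>)) / n)"
      by (simp add: P_def sum_divide_distrib)
    also have "\<dots> = (\<Sum>\<kappa>\<in>K. \<Sum>i\<in>I. slash k (r \<kappa>) f \<tau> * (1 / chi i (r \<kappa>)) / n)"
      by (rule sum.swap)
    also have "\<dots> = (\<Sum>\<kappa>\<in>K. slash k (r \<kappa>) f \<tau> * (\<Sum>i\<in>I. 1 / chi i (r \<kappa>)) / n)"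
      by (simp only: sum_distrib_left sum_divide_distrib)
    also have "\<dots> = (\<Sum>\<kappa>\<in>K. if \<kappa> = \<kappa>0 then slash k (r \<kappa>) f \<tau> else 0)"
      using n by (intro sum.cong refl) (simp add: S)
    also have "\<dots> = slash k (r \<kappa>0) f \<tau>" using \<kappa>0(1) fin(2) by simp
    also have "slash k (r \<kappa>0) f = f"
      using f r[OF \<kappa>0(1)] G(1) ker[OF r[OF \<kappa>0(1)]] \<kappa>0(2) chi_one unfolding W_def
      by (intro slash_Gamma16) auto
    finally show "(\<Sum>i\<in>I. P i f \<tau>) = f \<tau>" .
  qed
  have P_sum: "P j (\<lambda>\<tau>. \<Sum>i\<in>I. F i \<tau>) = F j" if F: "\<And>i. i \<in> I \<Longrightarrow> F i \<in> V i" and j: "j \<in> I" for F j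
  proof
    fix \<tau>
    have "slash k (r \<kappa>) (\<lambda>\<tau>. \<Sum>i\<in>I. F i \<tau>) \<tau> = (\<Sum>i\<in>I. chi i (r \<kappa>) * F i \<tau>)" if \<kappa>: "\<kappa> \<in> K" for \<kappa>
    proof -
      have "slash k (r \<kappa>) (\<lambda>\<tau>. \<Sum>i\<in>I. F i \<tau>) \<tau> = (\<Sum>i\<in>I. slash k (r \<kappa>) (F i) \<tau>)"
        by (simp add: slash_def sum_divide_distrib)
      also have "\<dots> = (\<Sum>i\<in>I. chi i (r \<kappa>) * F i \<tau>)"
        using F r[OF \<kappa>] unfolding V_iff by (intro sum.cong refl) (simp add: fun_eq_iff)
      finally show ?thesis .
    qed
    then have "P j (\<lambda>\<tau>. \<Sum>i\<in>I. F i \<tau>) \<tau> = (\<Sum>\<kappa>\<in>K. \<Sum>i\<in>I. F i \<tau> * (chi i (r \<kappa>) / chi j (r \<kappa>)) / n)"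
      by (simp add: P_def sum_divide_distrib mult_ac)
    also have "\<dots> = (\<Sum>i\<in>I. \<Sum>\<kappa>\<in>K. F i \<tau> * (chi i (r \<kappa>) / chi j (r \<kappa>)) / n)"
      by (rule sum.swap)
    also have "\<dots> = (\<Sum>i\<in>I. F i \<tau> * (\<Sum>\<kappa>\<in>K. chi i (r \<kappa>) / chi j (r \<kappa>)) / n)"
      by (simp only: sum_distrib_left sum_divide_distrib)
    also have "\<dots> = (\<Sum>i\<in>I. if i = j then F i \<tau> else 0)"
      using n j by (intro sum.cong refl) (simp add: orth1 n_def)
    also have "\<dots> = F j \<tau>" using j fin(1) by simp
    finally show "P j (\<lambda>\<tau>. \<Sum>i\<in>I. F i \<tau>) \<tau> = F j \<tau>" .
  qed
  have sum_W: "(\<lambda>\<tau>. \<Sum>i\<in>I. F i \<tau>) \<in> W" if F: "\<And>i. i \<in> I \<Longrightarrow> F i \<in> W" for F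
    unfolding W_iff
  proof (intro conjI ballI)
    show "(\<lambda>\<tau>. \<Sum>i\<in>I. F i \<tau>) \<in> moderate_growth k"
      using F unfolding W_iff by (intro moderate_growth_sum) auto
    fix \<gamma> assume "\<gamma> \<in> Gamma16"
    then have "slash k \<gamma> (F i) \<tau> = F i \<tau>" if "i \<in> I" for i \<tau>
      using F[OF that] unfolding W_iff by simp
    moreover have "slash k \<gamma> (\<lambda>\<tau>. \<Sum>i\<in>I. F i \<tau>) \<tau> = (\<Sum>i\<in>I. slash k \<gamma> (F i) \<tau>)" for \<tau>
      by (simp add: slash_def sum_divide_distrib)
    ultimately show "slash k \<gamma> (\<lambda>\<tau>. \<Sum>i\<in>I. F i \<tau>) = (\<lambda>\<tau>. \<Sum>i\<in>I. F i \<tau>)" by (intro ext) simp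
  qed
  have "bij_betw (\<lambda>F \<tau>. \<Sum>i\<in>I. F i \<tau>) (Pi\<^sub>E I V) W"
  proof (rule bij_betwI[where g = "\<lambda>f. restrict (\<lambda>i. P i f) I"])
    show "(\<lambda>F \<tau>. \<Sum>i\<in>I. F i \<tau>) \<in> Pi\<^sub>E I V \<rightarrow> W"
      using VW by (intro Pi_I sum_W) (auto simp: PiE_mem)
    show "(\<lambda>f. restrict (\<lambda>i. P i f) I) \<in> W \<rightarrow> Pi\<^sub>E I V"
      using PV by auto
    show "restrict (\<lambda>i. P i (\<lambda>\<tau>. \<Sum>i\<in>I. F i \<tau>)) I = F" if "F \<in> Pi\<^sub>E I V" for F
    proof
      fix j
      show "restrict (\<lambda>i. P i (\<lambda>\<tau>. \<Sum>i\<in>I. F i \<tau>)) I j = F j"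
      proof (cases "j \<in> I")
        case True
        with P_sum[OF PiE_mem[OF that] True] show ?thesis by simp
      next
        case False
        with PiE_arb[OF that False] show ?thesis by simp
      qed
    qed
    show "(\<lambda>\<tau>. \<Sum>i\<in>I. restrict (\<lambda>i. P i f) I i \<tau>) = f" if "f \<in> W" for f
      using sum_P[OF that] by simp
  qed
  then show ?thesis unfolding internal_direct_sum_def V_def W_def .
qed

section \<open>The characters of level 16 and level 4\<close>

lemma Gamma0_Gamma0_group:
  assumes "A \<in> Gamma_lower0 N \<inter> Gamma_upper0 N" "B \<in> Gamma_lower0 N \<inter> Gamma_upper0 N"
  shows "A ** B \<in> Gamma_lower0 N \<inter> Gamma_upper0 N" "adj2 A \<in> Gamma_lower0 N \<inter> Gamma_upper0 N"
proof -
  show "A ** B \<in> Gamma_lower0 N \<inter> Gamma_upper0 N"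
    using assms by (auto simp: Gamma_lower0_def Gamma_upper0_def SL2Z_mult matrix_mult_2x2)
  have "adj2 A$1$2 = - A$1$2" "adj2 A$2$1 = - A$2$1" by (simp_all add: adj2_def)
  then show "adj2 A \<in> Gamma_lower0 N \<inter> Gamma_upper0 N"
    using assms by (auto simp: Gamma_lower0_def Gamma_upper0_def SL2Z_adj2)
qed

lemma Gamma16_subset:
  assumes "N dvd 16"
  shows "Gamma16 \<subseteq> Gamma_lower0 N \<inter> Gamma_upper0 N"
  using assms by (auto simp: Gamma_principal_def Gamma_lower0_def Gamma_upper0_def cong_0_iff intro: dvd_trans)

text \<open>
  This identifies \<open>\<plusminus>\<Gamma>(16)\<close> as the common kernel of the three characters: \<open>\<chi>\<^sub>1\<^sub>6(d) = 1\<close> means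
  \<open>d \<equiv> \<plusminus>1\<close> modulo 16, the other two conditions mean \<open>16 | b, c\<close> since \<open>d\<close> is odd, and then \<open>a \<equiv> d\<close>
  because \<open>ad \<equiv> 1\<close>.
\<close>

lemma character_kernel:
  assumes A: "A \<in> Gamma4" and chi: "chi16 (A$2$2) = 1" and c: "c16 A = 1" and b: "b16 A = 1"
  shows "A \<in> Gamma16 \<or> - A \<in> Gamma16"
proof -
  have odd: "odd (A$2$2)" using Gamma4_odd[OF A] by simp
  have cop: "coprime 16 (A$2$2)"
  proof -
    have "coprime (2 ^ 4) (A$2$2)" using odd by (intro coprime_power_left_iff[THEN iffD2] disjI1) simp
    then show ?thesis by simp
  qed
  have "16 dvd A$1$2 * A$2$2" using b unfolding b16_nome16 by (rule nome16_of_int_eq_1D)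
  then have b0: "16 dvd A$1$2" using cop by (simp add: coprime_dvd_mult_left_iff)
  have "16 dvd - (A$2$1 * A$2$2)" using c unfolding c16_nome16 by (rule nome16_of_int_eq_1D)
  then have c0: "16 dvd A$2$1" using cop by (simp add: coprime_dvd_mult_left_iff)
  have det: "A$1$1 * A$2$2 - A$1$2 * A$2$1 = 1" using Gamma4_SL2Z[OF A] by (simp add: SL2Z_det)
  have ad: "[A$1$1 * A$2$2 = 1] (mod 16)"
    unfolding cong_iff_dvd_diff using det b0 by (metis add_diff_cancel_left' diff_add_cancel dvd_mult2)
  have "A$2$2 mod 16 = 1 \<or> A$2$2 mod 16 = 15"
    using odd_residues_16[OF odd] chi chi16_mod[of "A$2$2"] by (auto simp: chi16_residues complex_eq_iff)
  then show ?thesis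
  proof
    assume "A$2$2 mod 16 = 1"
    then have d: "[A$2$2 = 1] (mod 16)" by (simp add: cong_def)
    have "[A$1$1 * A$2$2 = A$1$1 * 1] (mod 16)" by (intro cong_mult cong_refl d)
    from cong_trans[OF cong_sym[OF this] ad] have "[A$1$1 = 1] (mod 16)" by simp
    then show ?thesis using d b0 c0 Gamma4_SL2Z[OF A] by (simp add: Gamma_principal_def cong_0_iff)
  next
    assume "A$2$2 mod 16 = 15"
    then have d: "[A$2$2 = - 1] (mod 16)" by (simp add: cong_def)
    have "[A$1$1 * A$2$2 = A$1$1 * (- 1)] (mod 16)" by (intro cong_mult cong_refl d)
    from cong_trans[OF cong_sym[OF this] ad] have "[- A$1$1 = 1] (mod 16)" by simp
    moreover have "[- A$2$2 = 1] (mod 16)" using d cong_minus_minus_iff[of "A$2$2" "-1" 16] by simp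
    ultimately show ?thesis using b0 c0 Gamma4_SL2Z[OF A] by (simp add: Gamma_principal_def cong_0_iff SL2Z_det)
  qed
qed

lemma fourth_root_of_unity:
  fixes z :: complex
  assumes "z ^ 4 = 1"
  shows "\<exists>m\<in>{0..3}. z = \<i> ^ m"
proof -
  have "(z - 1) * (z + 1) * ((z - \<i>) * (z + \<i>)) = z ^ 4 - 1"
    by (simp add: algebra_simps eval_nat_numeral)
  then have "z = 1 \<or> z = - 1 \<or> z = \<i> \<or> z = - \<i>"
    using assms by (auto simp: eq_neg_iff_add_eq_0)
  moreover have "\<i> ^ 0 = 1" "\<i> ^ 1 = \<i>" "\<i> ^ 2 = - 1" "\<i> ^ 3 = - \<i>" by (simp_all add: eval_nat_numeral)
  moreover have "(0::nat) \<in> {0..3}" "(1::nat) \<in> {0..3}" "(2::nat) \<in> {0..3}" "(3::nat) \<in> {0..3}" by auto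
  ultimately show ?thesis by metis
qed

lemma atMost_3: "{0..3::nat} = {0, 1, 2, 3}" by auto

lemma i_powers: "\<i> ^ 2 = - 1" "\<i> ^ 3 = - \<i>"
  by (simp_all add: eval_nat_numeral)

lemma i_power_inj: "m \<in> {0..3} \<Longrightarrow> n \<in> {0..3} \<Longrightarrow> \<i> ^ m = \<i> ^ n \<Longrightarrow> m = (n::nat)"
  unfolding atMost_3 by (auto simp: i_powers complex_eq_iff)

lemma i_power_orthogonal:
  assumes "a \<in> {0..3}" "b \<in> {0..3::nat}"
  shows "(\<Sum>m\<in>{0..3::nat}. (\<i> ^ m) ^ a / (\<i> ^ m) ^ b) = (if a = b then 4 else 0)"
  using assms unfolding atMost_3 by (auto simp: i_powers power3_eq_cube power2_eq_square)

lemma i_power_orthogonal':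
  assumes "m \<in> {0..3::nat}"
  shows "(\<Sum>a\<in>{0..3::nat}. 1 / (\<i> ^ m) ^ a) = (if m = 0 then 4 else 0)"
  using assms unfolding atMost_3 by (auto simp: i_powers power3_eq_cube power2_eq_square)

primrec mat2_power :: "int^2^2 \<Rightarrow> nat \<Rightarrow> int^2^2" where
  "mat2_power A 0 = mat 1"
| "mat2_power A (Suc n) = A ** mat2_power A n"

lemma mat2_power_mem:
  assumes "A \<in> G" "mat 1 \<in> G" "\<And>A B. A \<in> G \<Longrightarrow> B \<in> G \<Longrightarrow> A ** B \<in> G"
  shows "mat2_power A n \<in> G"
  using assms by (induction n) auto

lemma one_mem_Gamma0_Gamma0: "mat 1 \<in> Gamma_lower0 N \<inter> Gamma_upper0 N"
  by (simp add: Gamma_lower0_def Gamma_upper0_def SL2Z_def) (simp add: mat_def)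

lemma one_mem_Gamma4: "mat 1 \<in> Gamma4"
  unfolding Gamma4_def by (rule one_mem_Gamma0_Gamma0)

lemma Gamma4_mult: "A \<in> Gamma4 \<Longrightarrow> B \<in> Gamma4 \<Longrightarrow> A ** B \<in> Gamma4"
  unfolding Gamma4_def by (rule Gamma0_Gamma0_group(1))

lemma characters_one: "chi16 ((mat 1 :: int^2^2)$2$2) = 1" "c16 (mat 1) = 1" "b16 (mat 1) = 1"
  by (simp_all add: chi16_residues c16_def b16_def mat_def)

lemma characters_power:
  assumes "A \<in> Gamma4"
  shows "chi16 (mat2_power A n $2$2) = chi16 (A$2$2) ^ n" "c16 (mat2_power A n) = c16 A ^ n" "b16 (mat2_power A n) = b16 A ^ n"
proof -
  have "mat2_power A n \<in> Gamma4" for n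
    by (intro mat2_power_mem assms one_mem_Gamma4 Gamma4_mult)
  then show "chi16 (mat2_power A n $2$2) = chi16 (A$2$2) ^ n" "c16 (mat2_power A n) = c16 A ^ n" "b16 (mat2_power A n) = b16 A ^ n"
    by (induction n) (simp_all add: characters_one Gamma4_character_mult[OF assms])
qed

text \<open>
  Generators of \<open>(\<int>/4)\<^sup>3 = (\<Gamma>\<^sub>0(4) \<inter> \<Gamma>\<^sup>0(4)) / \<plusminus>\<Gamma>(16)\<close>, each with value \<open>i\<close> under one of the characters
  \<open>\<chi>\<^sub>1\<^sub>6, c\<^sub>1\<^sub>6, b\<^sub>1\<^sub>6\<close> and value 1 under the other two. The first one has \<open>d = 5\<close> and off-diagonal entries divisible by 16;
  \<open>205 \<cdot> 5 = 1 + 16 \<cdot> 64\<close>.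
\<close>

definition gen_d :: "int^2^2" where "gen_d = mat2 205 16 64 5"
definition gen_c :: "int^2^2" where "gen_c = mat2 1 0 (-4) 1"
definition gen_b :: "int^2^2" where "gen_b = mat2 1 4 0 1"

lemma gens_Gamma4: "gen_d \<in> Gamma4" "gen_c \<in> Gamma4" "gen_b \<in> Gamma4"
  by (simp_all add: gen_d_def gen_c_def gen_b_def Gamma4_def Gamma_lower0_def Gamma_upper0_def SL2Z_det)

lemma gens_characters:
  "chi16 (gen_d$2$2) = \<i>" "c16 gen_d = 1" "b16 gen_d = 1"
  "chi16 (gen_c$2$2) = 1" "c16 gen_c = \<i>" "b16 gen_c = 1"
  "chi16 (gen_b$2$2) = 1" "c16 gen_b = 1" "b16 gen_b = \<i>"
proof -
  have z: "nome16 0 = 1" by (simp add: nome16_def)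
  show "chi16 (gen_d$2$2) = \<i>" "chi16 (gen_c$2$2) = 1" "chi16 (gen_b$2$2) = 1"
    by (simp_all add: gen_d_def gen_c_def gen_b_def chi16_residues)
  show "c16 gen_c = \<i>" "b16 gen_c = 1" "c16 gen_b = 1" "b16 gen_b = \<i>"
    by (simp_all add: c16_nome16 b16_nome16 gen_c_def gen_b_def nome16_4 z)
  have "nome16 (of_int (- (64 * 5))) = nome16 (of_int 0)" by (rule nome16_of_int_cong) (simp add: cong_def)
  then show "c16 gen_d = 1" by (simp only: c16_nome16 gen_d_def mat2_nth of_int_0 z)
  have "nome16 (of_int (16 * 5)) = nome16 (of_int 0)" by (rule nome16_of_int_cong) (simp add: cong_def)
  then show "b16 gen_d = 1" by (simp only: b16_nome16 gen_d_def mat2_nth of_int_0 z)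
qed

lemma characters_nonzero:
  "c16 A \<noteq> 0" "b16 A \<noteq> 0" "A \<in> Gamma4 \<Longrightarrow> chi16 (A$2$2) \<noteq> 0"
  using odd_residues_16[of "A$2$2"] chi16_mod[of "A$2$2"] Gamma4_odd[of A]
  by (auto simp: c16_def b16_def chi16_residues)

text \<open>
  By \<open>4 | b, c\<close>, the values of \<open>b\<^sub>1\<^sub>6\<close> and \<open>c\<^sub>1\<^sub>6\<close> are fourth roots of unity.
\<close>

lemma characters_power_4:
  assumes "A \<in> Gamma4"
  shows "c16 A ^ 4 = 1" "b16 A ^ 4 = 1" "chi16 (A$2$2) ^ 4 = 1"
proof -
  obtain b c where bc: "A$1$2 = 4 * b" "A$2$1 = 4 * c"
    using assms unfolding Gamma4_def Gamma_lower0_def Gamma_upper0_def by (auto elim!: dvdE)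
  have one: "nome16 (of_int (16 * m)) = 1" for m
    using nome16_of_int_cong[of "16 * m" 0] by (simp add: cong_def nome16_def)
  show "c16 A ^ 4 = 1" "b16 A ^ 4 = 1"
    using one[of "- (c * A$2$2)"] one[of "b * A$2$2"]
    by (simp_all add: c16_nome16 b16_nome16 bc nome16_power)
  have "chi16 (A$2$2) \<in> {1, \<i>, - 1, - \<i>}"
    using odd_residues_16[of "A$2$2"] chi16_mod[of "A$2$2"] Gamma4_odd(1)[OF assms]
    by (auto simp: chi16_residues)
  then show "chi16 (A$2$2) ^ 4 = 1" by (auto simp: eval_nat_numeral)
qed

lemma characters_Gamma16:
  assumes "A \<in> Gamma16"
  shows "chi16 (A$2$2) = 1" "c16 A = 1" "b16 A = 1"
proof -
  have *: "[A$2$2 = 1] (mod 16)" "16 dvd A$1$2" "16 dvd A$2$1"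
    using assms by (simp_all add: Gamma_principal_def cong_0_iff)
  show "chi16 (A$2$2) = 1" using chi16_cong[OF *(1)] by (simp add: chi16_residues)
  have "[- (A$2$1 * A$2$2) = 0] (mod 16)" "[A$1$2 * A$2$2 = 0] (mod 16)" using * by (simp_all add: cong_0_iff)
  from this[THEN nome16_of_int_cong] show "c16 A = 1" "b16 A = 1"
    by (simp_all add: c16_nome16 b16_nome16 nome16_def)
qed

text \<open>
  On \<open>\<Gamma>\<^sub>0(16) \<inter> \<Gamma>\<^sup>0(16)\<close> the characters \<open>b\<^sub>1\<^sub>6\<close> and \<open>c\<^sub>1\<^sub>6\<close> are trivial, so \<open>\<chi>\<^sub>1\<^sub>6\<close> alone identifies the quotient
  by \<open>\<plusminus>\<Gamma>(16)\<close> with \<open>\<int>/4\<close>.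
\<close>

theorem decomposition_level_16:
  "internal_direct_sum {0..3::nat} (\<lambda>j. modular_forms_level 16 k (\<lambda>\<gamma>. chi16 (\<gamma>$2$2) ^ j)) (modular_forms Gamma16 k (\<lambda>_. 1))"
  unfolding modular_forms_level_def
proof (rule character_decomposition[where K = "{0..3}" and r = "mat2_power gen_d"])
  let ?G = "Gamma_lower0 16 \<inter> Gamma_upper0 16"
  show G: "?G \<subseteq> Gamma4"
    unfolding Gamma4_def Gamma_lower0_def Gamma_upper0_def by (auto intro: dvd_trans[of 4 16])
  show "A ** B \<in> ?G" if "A \<in> ?G" "B \<in> ?G" for A B using Gamma0_Gamma0_group(1)[OF that] .
  show "adj2 A \<in> ?G" if "A \<in> ?G" for A using Gamma0_Gamma0_group(2)[OF that that] .
  show "Gamma16 \<subseteq> ?G" by (rule Gamma16_subset) simp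
  show "chi16 ((A ** B)$2$2) ^ i = chi16 (A$2$2) ^ i * chi16 (B$2$2) ^ i" if "A \<in> ?G" "B \<in> ?G" for A B i
    using that G by (subst Gamma4_character_mult) (auto simp: power_mult_distrib)
  show "chi16 (A$2$2) ^ i \<noteq> 0" if "A \<in> ?G" for A i using characters_nonzero(3) that G by auto
  show "chi16 (A$2$2) ^ i = 1" if "A \<in> Gamma16" for A i using characters_Gamma16(1)[OF that] by simp
  have cb: "c16 A = 1" "b16 A = 1" if "A \<in> ?G" for A
  proof -
    have "[- (A$2$1 * A$2$2) = 0] (mod 16)" "[A$1$2 * A$2$2 = 0] (mod 16)"
      using that by (simp_all add: Gamma_lower0_def Gamma_upper0_def cong_0_iff)
    from this[THEN nome16_of_int_cong] show "c16 A = 1" "b16 A = 1"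
      by (simp_all add: c16_nome16 b16_nome16 nome16_def)
  qed
  show "A \<in> Gamma16 \<or> - A \<in> Gamma16" if "A \<in> ?G" "\<forall>i\<in>{0..3::nat}. chi16 (A$2$2) ^ i = 1" for A
  proof (rule character_kernel)
    show "chi16 (A$2$2) = 1" using that(2)[rule_format, of 1] by simp
  qed (use that G cb in auto)
  have gen: "gen_d \<in> ?G" by (simp add: gen_d_def Gamma_lower0_def Gamma_upper0_def SL2Z_det)
  show "mat2_power gen_d \<kappa> \<in> ?G" for \<kappa>
    by (rule mat2_power_mem[OF gen one_mem_Gamma0_Gamma0 Gamma0_Gamma0_group(1)])
  have val: "chi16 (mat2_power gen_d \<kappa> $2$2) = \<i> ^ \<kappa>" for \<kappa>
    by (simp add: characters_power gens_Gamma4 gens_characters)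
  show "\<exists>\<kappa>\<in>{0..3}. \<forall>i\<in>{0..3::nat}. chi16 (A$2$2) ^ i = chi16 (mat2_power gen_d \<kappa> $2$2) ^ i" if "A \<in> ?G" for A
  proof -
    have "A \<in> Gamma4" using that G by blast
    from fourth_root_of_unity[OF characters_power_4(3)[OF this]]
    obtain m where m: "m \<in> {0..3}" "chi16 (A$2$2) = \<i> ^ m" by blast
    show ?thesis unfolding val m(2) by (rule bexI[OF _ m(1)]) simp
  qed
  show "\<kappa> = \<kappa>'" if "\<kappa> \<in> {0..3}" "\<kappa>' \<in> {0..3}"
    "\<forall>i\<in>{0..3::nat}. chi16 (mat2_power gen_d \<kappa> $2$2) ^ i = chi16 (mat2_power gen_d \<kappa>' $2$2) ^ i" for \<kappa> \<kappa>'
    using that(3)[rule_format, of 1] i_power_inj[OF that(1,2)] unfolding val by simp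
  show "(\<Sum>\<kappa>\<in>{0..3}. chi16 (mat2_power gen_d \<kappa> $2$2) ^ i / chi16 (mat2_power gen_d \<kappa> $2$2) ^ j)
      = (if i = j then of_nat (card {0..3::nat}) else 0)" if "i \<in> {0..3}" "j \<in> {0..3}" for i j
    using i_power_orthogonal[OF that] unfolding val by simp
  show "(\<Sum>i\<in>{0..3}. 1 / chi16 (mat2_power gen_d \<kappa> $2$2) ^ i) = 0"
    if "\<kappa> \<in> {0..3}" "\<not> (\<forall>i\<in>{0..3::nat}. chi16 (mat2_power gen_d \<kappa> $2$2) ^ i = 1)" for \<kappa>
  proof -
    have "\<kappa> \<noteq> 0" using that(2) unfolding val by (metis power_0 power_one)
    then show ?thesis using i_power_orthogonal'[OF that(1)] unfolding val by simp
  qed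
qed auto

lemma sum_product_3:
  fixes f g h :: "'a \<Rightarrow> 'b::comm_semiring_1"
  shows "(\<Sum>(x, y, z)\<in>A \<times> B \<times> C. f x * g y * h z) = sum f A * sum g B * sum h C"
  by (simp add: sum.cartesian_product[symmetric] mult.assoc sum_distrib_left[symmetric] sum_distrib_right[symmetric])

text \<open>
  The orthogonality relations for \<open>(\<int>/4)\<^sup>3\<close> are products of those for the three factors \<open>\<int>/4\<close>.
\<close>

theorem decomposition_level_4:
  "internal_direct_sum ({0..3::nat} \<times> {0..3::nat} \<times> {0..3::nat})
     (\<lambda>(j, l, m). modular_forms_level 4 k (\<lambda>\<gamma>. chi16 (\<gamma>$2$2) ^ j * c16 \<gamma> ^ l * b16 \<gamma> ^ m))
     (modular_forms Gamma16 k (\<lambda>_. 1))"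
proof -
  let ?I = "{0..3::nat} \<times> {0..3::nat} \<times> {0..3::nat}"
  define chi where "chi = (\<lambda>(j, l, m) \<gamma>. chi16 (\<gamma>$2$2) ^ j * c16 \<gamma> ^ l * b16 \<gamma> ^ m :: complex)"
  define r where "r = (\<lambda>(j, l, m). mat2_power gen_d j ** (mat2_power gen_c l ** mat2_power gen_b m))"
  have pow: "mat2_power A n \<in> Gamma4" if "A \<in> Gamma4" for A n
    by (intro mat2_power_mem that one_mem_Gamma4 Gamma4_mult)
  have r_mem: "r \<kappa> \<in> Gamma4" for \<kappa>
    unfolding r_def by (auto split: prod.split intro!: Gamma4_mult pow gens_Gamma4)
  have val: "chi16 (r (a, b, c) $2$2) = \<i> ^ a" "c16 (r (a, b, c)) = \<i> ^ b" "b16 (r (a, b, c)) = \<i> ^ c" for a b c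
    unfolding r_def
    by (simp_all add: Gamma4_character_mult Gamma4_mult pow gens_Gamma4 characters_power gens_characters)
  have chi_r: "chi (j, l, m) (r (a, b, c)) = (\<i> ^ a) ^ j * (\<i> ^ b) ^ l * (\<i> ^ c) ^ m" for j l m a b c
    by (simp add: chi_def val)
  have chi_gens: "chi (1, 0, 0) A = chi16 (A$2$2)" "chi (0, 1, 0) A = c16 A" "chi (0, 0, 1) A = b16 A" for A
    by (simp_all add: chi_def)
  have I: "(1, 0, 0) \<in> ?I" "(0, 1, 0) \<in> ?I" "(0, 0, 1) \<in> ?I" by auto
  have "internal_direct_sum ?I (\<lambda>i. modular_forms Gamma4 k (chi i)) (modular_forms Gamma16 k (\<lambda>_. 1))"
  proof (rule character_decomposition[where K = ?I and r = r])
    show "A ** B \<in> Gamma4" if "A \<in> Gamma4" "B \<in> Gamma4" for A B using Gamma4_mult that .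
    show "adj2 A \<in> Gamma4" if "A \<in> Gamma4" for A using Gamma0_Gamma0_group(2)[of A 4 A] that by (simp add: Gamma4_def)
    show "Gamma16 \<subseteq> Gamma4" using Gamma16_Gamma4 by blast
    show "chi i (A ** B) = chi i A * chi i B" if "A \<in> Gamma4" "B \<in> Gamma4" for i A B
      using that by (cases i) (simp add: chi_def Gamma4_character_mult power_mult_distrib)
    show "chi i A \<noteq> 0" if "A \<in> Gamma4" for i A
      using that characters_nonzero[of A] by (cases i) (simp add: chi_def)
    show "chi i A = 1" if "A \<in> Gamma16" for i A
      using characters_Gamma16[OF that] by (cases i) (simp add: chi_def)
    show "A \<in> Gamma16 \<or> - A \<in> Gamma16" if "A \<in> Gamma4" "\<forall>i\<in>?I. chi i A = 1" for A
      using that I by (intro character_kernel) (simp_all flip: chi_gens)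
    show "r \<kappa> \<in> Gamma4" for \<kappa> by (rule r_mem)
    show "\<exists>\<kappa>\<in>?I. \<forall>i\<in>?I. chi i A = chi i (r \<kappa>)" if A: "A \<in> Gamma4" for A
    proof -
      obtain a b c where "a \<in> {0..3}" "b \<in> {0..3}" "c \<in> {0..3}"
        and eq: "chi16 (A$2$2) = \<i> ^ a" "c16 A = \<i> ^ b" "b16 A = \<i> ^ c"
        using characters_power_4[OF A, THEN fourth_root_of_unity] by blast
      then have "(a, b, c) \<in> ?I" by blast
      moreover have "chi i A = chi i (r (a, b, c))" for i
        by (cases i) (simp add: chi_r, simp add: chi_def eq)
      ultimately show ?thesis by blast
    qed
    show "\<kappa> = \<kappa>'" if "\<kappa> \<in> ?I" "\<kappa>' \<in> ?I" "\<forall>i\<in>?I. chi i (r \<kappa>) = chi i (r \<kappa>')" for \<kappa> \<kappa>'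
    proof -
      obtain a b c a' b' c' where \<kappa>: "\<kappa> = (a, b, c)" "\<kappa>' = (a', b', c')" by (metis prod_cases3)
      have "chi16 (r \<kappa> $2$2) = chi16 (r \<kappa>' $2$2)" "c16 (r \<kappa>) = c16 (r \<kappa>')" "b16 (r \<kappa>) = b16 (r \<kappa>')"
        using that(3) I unfolding chi_gens[symmetric] by blast+
      then show ?thesis using that(1,2) i_power_inj unfolding \<kappa> val by blast
    qed
    show "(\<Sum>\<kappa>\<in>?I. chi i (r \<kappa>) / chi j (r \<kappa>)) = (if i = j then of_nat (card ?I) else 0)"
      if "i \<in> ?I" "j \<in> ?I" for i j
    proof -
      obtain a b c a' b' c' where ij: "i = (a, b, c)" "j = (a', b', c')" by (metis prod_cases3)
      have mem: "a \<in> {0..3}" "b \<in> {0..3}" "c \<in> {0..3}" "a' \<in> {0..3}" "b' \<in> {0..3}" "c' \<in> {0..3}"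
        using that unfolding ij by auto
      have "(\<Sum>\<kappa>\<in>?I. chi i (r \<kappa>) / chi j (r \<kappa>)) =
          (\<Sum>(x, y, z)\<in>?I. ((\<i> ^ x) ^ a / (\<i> ^ x) ^ a') * ((\<i> ^ y) ^ b / (\<i> ^ y) ^ b') * ((\<i> ^ z) ^ c / (\<i> ^ z) ^ c'))"
        by (intro sum.cong refl) (auto simp: ij chi_r simp del: power_eq_0_iff)
      also have "\<dots> = (if a = a' then 4 else 0) * (if b = b' then 4 else 0) * (if c = c' then 4 else 0)"
        unfolding sum_product_3 by (simp only: i_power_orthogonal mem)
      finally show ?thesis unfolding ij by auto
    qed
    show "(\<Sum>i\<in>?I. 1 / chi i (r \<kappa>)) = 0" if "\<kappa> \<in> ?I" "\<not> (\<forall>i\<in>?I. chi i (r \<kappa>) = 1)" for \<kappa>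
    proof -
      obtain a b c where \<kappa>: "\<kappa> = (a, b, c)" by (metis prod_cases3)
      have mem: "a \<in> {0..3}" "b \<in> {0..3}" "c \<in> {0..3}" using that unfolding \<kappa> by auto
      have "\<not> (a = 0 \<and> b = 0 \<and> c = 0)"
      proof
        assume "a = 0 \<and> b = 0 \<and> c = 0"
        then have "chi i (r \<kappa>) = 1" for i by (cases i) (simp add: \<kappa> chi_r)
        then show False using that(2) by blast
      qed
      moreover have "(\<Sum>i\<in>?I. 1 / chi i (r \<kappa>)) =
          (\<Sum>(x, y, z)\<in>?I. (1 / (\<i> ^ a) ^ x) * (1 / (\<i> ^ b) ^ y) * (1 / (\<i> ^ c) ^ z))"
        by (intro sum.cong refl) (auto simp: \<kappa> chi_r simp del: power_eq_0_iff)
      moreover have "\<dots> = (if a = 0 then 4 else 0) * (if b = 0 then 4 else 0) * (if c = 0 then 4 else 0)"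
        unfolding sum_product_3 by (simp only: i_power_orthogonal' mem)
      ultimately show ?thesis by auto
    qed
  qed auto
  moreover have "(\<lambda>(j, l, m). modular_forms_level 4 k (\<lambda>\<gamma>. chi16 (\<gamma>$2$2) ^ j * c16 \<gamma> ^ l * b16 \<gamma> ^ m))
      = (\<lambda>i. modular_forms Gamma4 k (chi i))"
    by (auto simp: fun_eq_iff chi_def modular_forms_level_def Gamma4_def)
  ultimately show ?thesis by simp
qed

section \<open>Expansions at the cusps\<close>

lemma eta32_add_16: "\<tau> \<in> upper_half_plane \<Longrightarrow> eta32 (\<tau> + 16) = eta32 \<tau>"
  by (simp add: eta32_eq nome16_add upper_half_plane_def)

lemma J_Gamma16:
  assumes "\<gamma> \<in> Gamma16"
  shows "J k \<gamma> \<tau> = eta_factor \<gamma> \<tau> ^ k"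
proof -
  have "[\<gamma>$2$2 = 1] (mod 16)" using assms by (simp add: Gamma_principal_def)
  then have d: "[\<gamma>$2$2 = 1] (mod 4)" by (rule cong_dvd_modulus) simp
  then have "odd (\<gamma>$2$2)" using Gamma4_odd(1)[OF Gamma16_Gamma4[OF assms]] by simp
  then have "chi4 (\<gamma>$2$2) = 1" using d by (simp add: chi4_odd)
  then show ?thesis using characters_Gamma16[OF assms] by (simp add: J_def J14_eq_eta_factor)
qed

text \<open>
  This is \<open>E\<^sup>4 = c\<tau> + d\<close> for \<open>E = eta_factor \<gamma> \<tau>\<close>, written as \<open>(c\<tau> + d) / E = E\<^sup>3\<close>: on \<open>\<Gamma>(16)\<close> the exponent
  \<open>eta6_exponent\<close> is divisible by 4. It says that \<open>\<eta>\<^bsup>3/2\<^esup>\<close> has weight \<open>3/4\<close>.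
\<close>

lemma eta32_Gamma16:
  assumes \<gamma>: "\<gamma> \<in> Gamma16" and \<tau>: "\<tau> \<in> upper_half_plane"
  shows "eta32 (mobius \<gamma> \<tau>) = J 3 \<gamma> \<tau> * eta32 \<tau>"
proof -
  have S: "\<gamma> \<in> SL2Z" using \<gamma> by (simp add: Gamma_principal_def)
  have nz: "eta32 \<tau> \<noteq> 0" "eta32 (mobius \<gamma> \<tau>) \<noteq> 0" "denom \<gamma> \<tau> \<noteq> 0"
    using eta32_nonzero[OF \<tau>] eta32_nonzero[OF mobius_upper[OF S \<tau>]] denom_nonzero[OF S \<tau>] by auto
  obtain b c d where bcd: "\<gamma>$1$2 = 16 * b" "\<gamma>$2$1 = 16 * c" "\<gamma>$2$2 = 1 + 16 * d"
  proof -
    have "16 dvd \<gamma>$1$2" "16 dvd \<gamma>$2$1" "16 dvd \<gamma>$2$2 - 1"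
      using \<gamma> by (simp_all add: Gamma_principal_def cong_0_iff cong_iff_dvd_diff)
    then obtain b c d where "\<gamma>$1$2 = 16 * b" "\<gamma>$2$1 = 16 * c" "\<gamma>$2$2 - 1 = 16 * d" by (metis dvdE)
    then show ?thesis by (intro that[of b c d]) auto
  qed
  have "[eta6_exponent \<gamma> = 0] (mod 4)"
  proof -
    have "eta6_exponent \<gamma> = 4 * (4 * \<gamma>$1$1 * c + 4 * b * (1 + 16 * d) - 4 * d)"
      by (simp add: eta6_exponent_def bcd algebra_simps)
    then show ?thesis by (simp add: cong_0_iff)
  qed
  then have "\<i> powi eta6_exponent \<gamma> = 1" using i_powi_cong[of "eta6_exponent \<gamma>" 0] by simp
  then have e4: "eta32 (mobius \<gamma> \<tau>) ^ 4 = denom \<gamma> \<tau> ^ 3 * eta32 \<tau> ^ 4"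
    using eta32_power4_mobius[OF S \<tau>] by simp
  have "J 3 \<gamma> \<tau> * eta32 \<tau> = denom \<gamma> \<tau> ^ 3 * eta32 \<tau> ^ 4 / eta32 (mobius \<gamma> \<tau>) ^ 3"
    by (simp add: J_Gamma16[OF \<gamma>] eta_factor_def power_mult_distrib power_divide eval_nat_numeral)
  also have "\<dots> = eta32 (mobius \<gamma> \<tau>)"
    unfolding e4[symmetric] using nz by (simp add: eval_nat_numeral)
  finally show ?thesis by simp
qed

text \<open>
  The translate of \<open>f\<close> to the cusp \<open>\<gamma>\<infinity>\<close>. It differs from \<open>slash\<close> by the absence of the characters, which
  are not available for general \<open>\<gamma>\<close> in \<open>SL\<^sub>2(\<int>)\<close>.
\<close>

definition slash_at_cusp :: "nat \<Rightarrow> (complex \<Rightarrow> complex) \<Rightarrow> int^2^2 \<Rightarrow> complex \<Rightarrow> complex" where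
  "slash_at_cusp k f \<gamma> \<tau> = f (mobius \<gamma> \<tau>) / eta_factor \<gamma> \<tau> ^ k"

lemma norm_slash_at_cusp:
  assumes "\<gamma> \<in> SL2Z" "\<tau> \<in> upper_half_plane"
  shows "norm (slash_at_cusp k f \<gamma> \<tau>) = cusp_abs k f \<gamma> \<tau>"
proof -
  have "norm (denom \<gamma> \<tau>) > 0" using denom_nonzero[OF assms] by simp
  then have "norm (eta_factor \<gamma> \<tau> ^ k) = norm (denom \<gamma> \<tau>) powr (real k / 4)"
    by (simp add: norm_power norm_eta_factor[OF assms] powr_power mult.commute)
  then show ?thesis
    by (simp add: slash_at_cusp_def cusp_abs_def norm_divide powr_minus_divide)
qed

lemma modular_forms_Gamma16_D:
  assumes "f \<in> modular_forms Gamma16 k (\<lambda>_. 1)"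
  shows "f holomorphic_on upper_half_plane" "\<tau> \<notin> upper_half_plane \<Longrightarrow> f \<tau> = 0"
    "\<gamma> \<in> Gamma16 \<Longrightarrow> \<tau> \<in> upper_half_plane \<Longrightarrow> f (mobius \<gamma> \<tau>) = J k \<gamma> \<tau> * f \<tau>"
    "\<gamma> \<in> SL2Z \<Longrightarrow> Bfun (cusp_abs k f \<gamma>) (filtercomap Im at_top)"
  using assms by (simp_all add: modular_forms_def automorphic_def)

lemma slash_at_cusp_left_mult:
  assumes f: "f \<in> modular_forms Gamma16 k (\<lambda>_. 1)" and \<delta>: "\<delta> \<in> Gamma16" and \<gamma>: "\<gamma> \<in> SL2Z" and \<tau>: "\<tau> \<in> upper_half_plane"
  shows "slash_at_cusp k f (\<delta> ** \<gamma>) \<tau> = slash_at_cusp k f \<gamma> \<tau>"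
proof -
  have S: "\<delta> \<in> SL2Z" using \<delta> by (simp add: Gamma_principal_def)
  have "eta_factor \<delta> (mobius \<gamma> \<tau>) \<noteq> 0" using S \<gamma> \<tau> by (intro eta_factor_nonzero mobius_upper)
  then show ?thesis
    using modular_forms_Gamma16_D(3)[OF f \<delta> mobius_upper[OF \<gamma> \<tau>]]
    by (simp add: slash_at_cusp_def mobius_mult[OF S \<gamma> \<tau>] eta_factor_mult[OF S \<gamma> \<tau>] J_Gamma16[OF \<delta>] power_mult_distrib)
qed

text \<open>
  \<open>\<Gamma>(16)\<close> is the kernel of reduction modulo 16, so congruent matrices differ by a left factor in
  \<open>\<Gamma>(16)\<close>, under which \<open>f\<close> is invariant. Two consequences: the translates have period 16, and
  there are only finitely many of them.
\<close>

lemma slash_at_cusp_cong_16: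
  assumes f: "f \<in> modular_forms Gamma16 k (\<lambda>_. 1)" and \<gamma>: "\<gamma> \<in> SL2Z" and \<gamma>': "\<gamma>' \<in> SL2Z" and \<tau>: "\<tau> \<in> upper_half_plane"
    and cong: "\<And>i j. [\<gamma>'$i$j = \<gamma>$i$j] (mod 16)"
  shows "slash_at_cusp k f \<gamma>' \<tau> = slash_at_cusp k f \<gamma> \<tau>"
proof -
  define \<delta> where "\<delta> = \<gamma>' ** adj2 \<gamma>"
  have c: "[(\<gamma>' ** adj2 \<gamma>)$i$j = (\<gamma> ** adj2 \<gamma>)$i$j] (mod 16)" for i j
  proof -
    have "[\<gamma>'$i$1 * adj2 \<gamma>$1$j + \<gamma>'$i$2 * adj2 \<gamma>$2$j = \<gamma>$i$1 * adj2 \<gamma>$1$j + \<gamma>$i$2 * adj2 \<gamma>$2$j] (mod 16)"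
      by (intro cong_add cong_mult cong_refl cong)
    then show ?thesis by (simp add: matrix_matrix_mult_def sum_2)
  qed
  have "\<delta> \<in> SL2Z" unfolding \<delta>_def using \<gamma> \<gamma>' by (intro SL2Z_mult SL2Z_adj2)
  moreover have "(mat 1 :: int^2^2)$1$1 = 1" "(mat 1 :: int^2^2)$1$2 = 0" "(mat 1 :: int^2^2)$2$1 = 0" "(mat 1 :: int^2^2)$2$2 = 1"
    by (simp_all add: mat_def)
  ultimately have "\<delta> \<in> Gamma16"
    using c[of 1 1] c[of 1 2] c[of 2 1] c[of 2 2] unfolding adj2_mult(2)[OF \<gamma>] \<delta>_def[symmetric]
    by (simp add: Gamma_principal_def)
  moreover have "\<delta> ** \<gamma> = \<gamma>'" by (simp add: \<delta>_def adj2_cancel[OF \<gamma>])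
  ultimately show ?thesis using slash_at_cusp_left_mult[OF f _ \<gamma> \<tau>] by metis
qed

lemma slash_at_cusp_periodic:
  assumes f: "f \<in> modular_forms Gamma16 k (\<lambda>_. 1)" and \<gamma>: "\<gamma> \<in> SL2Z" and \<tau>: "\<tau> \<in> upper_half_plane"
  shows "slash_at_cusp k f \<gamma> (\<tau> + 16) = slash_at_cusp k f \<gamma> \<tau>"
proof -
  define T where "T = mat2 1 16 0 1"
  have T: "T \<in> SL2Z" "mobius T \<tau> = \<tau> + 16" "eta_factor T \<tau> = 1"
    using eta32_nonzero[OF \<tau>] by (simp_all add: T_def SL2Z_det mobius_def denom_def eta_factor_def eta32_add_16[OF \<tau>])
  have "slash_at_cusp k f (\<gamma> ** T) \<tau> = slash_at_cusp k f \<gamma> (\<tau> + 16)"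
    by (simp add: slash_at_cusp_def mobius_mult[OF \<gamma> T(1) \<tau>] eta_factor_mult[OF \<gamma> T(1) \<tau>] T)
  moreover have "[(\<gamma> ** T)$i$j = \<gamma>$i$j] (mod 16)" for i j
  proof -
    have "\<forall>i j. [(\<gamma> ** T)$i$j = \<gamma>$i$j] (mod 16)"
      unfolding forall_2 matrix_mult_2x2 by (simp add: T_def cong_def)
    then show ?thesis by blast
  qed
  ultimately show ?thesis
    using slash_at_cusp_cong_16[OF f \<gamma> SL2Z_mult[OF \<gamma> T(1)] \<tau>] by simp
qed

lemma holomorphic_slash_at_cusp:
  assumes f: "f holomorphic_on upper_half_plane" and \<gamma>: "\<gamma> \<in> SL2Z"
  shows "slash_at_cusp k f \<gamma> holomorphic_on upper_half_plane"
proof -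
  have "(\<lambda>\<tau>. f (mobius \<gamma> \<tau>)) holomorphic_on upper_half_plane"
    by (rule holomorphic_on_compose_gen[OF holomorphic_mobius[OF \<gamma>] f, unfolded o_def]) (use mobius_upper[OF \<gamma>] in blast)
  moreover have "eta_factor \<gamma> holomorphic_on upper_half_plane"
    by (rule holomorphic_eta_factor[OF \<gamma>])
  ultimately show ?thesis unfolding slash_at_cusp_def
    using eta_factor_nonzero[OF \<gamma>] by (intro holomorphic_intros) auto
qed

text \<open>
  A branch of the inverse of \<open>nome16\<close> on the half plane \<open>Re (w / w0) > 0\<close> around any given point \<open>w0\<close>; for
  \<open>w0 = w\<close> it is the principal branch at \<open>w\<close>.
\<close>

lemma nome16_surj:
  assumes "w \<noteq> 0" "w0 \<noteq> 0" "\<tau>0 = - \<i> * (8 / pi) * Ln w0"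
  shows "nome16 (\<tau>0 - \<i> * (8 / pi) * Ln (w / w0)) = w"
    "Im (\<tau>0 - \<i> * (8 / pi) * Ln (w / w0)) = - (8 / pi) * ln (norm w)"
proof -
  have "2 * pi * \<i> * (\<tau>0 - \<i> * (8 / pi) * Ln (w / w0)) / 16 = Ln w0 + Ln (w / w0)"
    unfolding assms(3) by (simp add: field_simps)
  then show "nome16 (\<tau>0 - \<i> * (8 / pi) * Ln (w / w0)) = w"
    using assms by (simp only: nome16_def exp_add exp_Ln) (simp add: exp_Ln)
  have "Im (\<tau>0 - \<i> * (8 / pi) * Ln (w / w0)) = - (8 / pi) * (ln (norm w0) + ln (norm (w / w0)))"
    using assms by (simp add: algebra_simps)
  also have "ln (norm w0) + ln (norm (w / w0)) = ln (norm w)"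
    using assms by (simp add: norm_divide ln_div)
  finally show "Im (\<tau>0 - \<i> * (8 / pi) * Ln (w / w0)) = - (8 / pi) * ln (norm w)" .
qed

lemma nome16_eqD:
  assumes "nome16 \<tau> = nome16 \<tau>'"
  obtains n :: int where "\<tau> = \<tau>' + 16 * of_int n"
proof -
  obtain n :: int where "2 * pi * \<i> * \<tau> / 16 = 2 * pi * \<i> * \<tau>' / 16 + (of_int (2 * n) * pi) * \<i>"
    using assms unfolding nome16_def exp_eq by auto
  then have "(pi * \<i>) * \<tau> = (pi * \<i>) * (\<tau>' + 16 * of_int n)"
    by (simp add: field_simps)
  then have "\<tau> = \<tau>' + 16 * of_int n" by (subst (asm) mult_left_cancel) auto
  then show ?thesis by (rule that)
qed

text \<open>
  The function \<open>G\<close> is \<open>g\<close> composed with a logarithm. By periodicity the choice of the branch does not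
  matter, so \<open>G\<close> is holomorphic on the punctured disc, and boundedness at \<open>i\<infinity>\<close> makes the
  singularity at 0 removable.
\<close>

lemma periodic_factors_through_nome16:
  assumes hol: "g holomorphic_on upper_half_plane"
    and per: "\<And>\<tau>. \<tau> \<in> upper_half_plane \<Longrightarrow> g (\<tau> + 16) = g \<tau>"
    and bdd: "Bfun g (filtercomap Im at_top)"
  obtains G where "G holomorphic_on ball 0 1" "\<And>\<tau>. \<tau> \<in> upper_half_plane \<Longrightarrow> g \<tau> = G (nome16 \<tau>)"
proof -
  have per_int: "g (\<tau> + 16 * of_int n) = g \<tau>" if \<tau>: "\<tau> \<in> upper_half_plane" for \<tau> n
  proof (induction n rule: int_induct[where k = 0])
    case (step1 n)
    have "\<tau> + 16 * of_int n \<in> upper_half_plane" using \<tau> by (simp add: upper_half_plane_def)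
    from per[OF this] step1 show ?case by (simp add: algebra_simps)
  next
    case (step2 n)
    have "\<tau> + 16 * of_int (n - 1) \<in> upper_half_plane" using \<tau> by (simp add: upper_half_plane_def)
    from per[OF this] step2 show ?case by (simp add: algebra_simps)
  qed simp
  define G0 where "G0 = (\<lambda>w. g (- \<i> * (8 / pi) * Ln w))"
  have eq: "g \<tau> = g \<tau>'" if "\<tau>' \<in> upper_half_plane" "nome16 \<tau> = nome16 \<tau>'" for \<tau> \<tau>'
    using nome16_eqD[OF that(2)] per_int[OF that(1)] by metis
  have dom: "- (8 / pi) * ln (norm w) > 0" if "w \<in> ball 0 1 - {0}" for w :: complex
  proof -
    have "ln (norm w) < 0" using that by simp
    then show ?thesis by (simp add: divide_neg_pos)
  qed
  have G0_eq: "G0 w = g (- \<i> * (8 / pi) * Ln w0 - \<i> * (8 / pi) * Ln (w / w0))"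
    if "w \<in> ball 0 1 - {0}" "w0 \<noteq> 0" for w w0
  proof -
    have w: "nome16 (- \<i> * (8 / pi) * Ln w - \<i> * (8 / pi) * Ln (w / w)) = w"
      "Im (- \<i> * (8 / pi) * Ln w - \<i> * (8 / pi) * Ln (w / w)) = - (8 / pi) * ln (norm w)"
      using nome16_surj[of w w "- \<i> * (8 / pi) * Ln w"] that by auto
    have w': "nome16 (- \<i> * (8 / pi) * Ln w0 - \<i> * (8 / pi) * Ln (w / w0)) = w"
      "Im (- \<i> * (8 / pi) * Ln w0 - \<i> * (8 / pi) * Ln (w / w0)) = - (8 / pi) * ln (norm w)"
      using nome16_surj[of w w0 "- \<i> * (8 / pi) * Ln w0"] that by auto
    have "- \<i> * (8 / pi) * Ln w = - \<i> * (8 / pi) * Ln w - \<i> * (8 / pi) * Ln (w / w)"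
      using that by simp
    then show ?thesis unfolding G0_def
      using eq[of "- \<i> * (8 / pi) * Ln w0 - \<i> * (8 / pi) * Ln (w / w0)" "- \<i> * (8 / pi) * Ln w"]
        w w' dom[OF that(1)] by (simp add: upper_half_plane_def)
  qed
  have G0_hol: "G0 holomorphic_on ball 0 1 - {0}"
  proof -
    \<comment> \<open>Near \<open>w0\<close>, which may lie on the cut of \<open>Ln\<close>, the branch through \<open>w0\<close> is used instead.\<close>
    have "\<exists>D. (G0 has_field_derivative D) (at w0)" if w0: "w0 \<in> ball 0 1 - {0}" for w0
    proof -
      define U where "U = (ball 0 1 - {0}) \<inter> {w. 0 < Re (w / w0)}"
      have "open U" unfolding U_def using w0
        by (intro open_Int open_Diff open_ball finite_imp_closed open_Collect_less continuous_intros) auto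
      have "w0 \<in> U" using w0 by (simp add: U_def)
      have "(\<lambda>w. g (- \<i> * (8 / pi) * Ln w0 - \<i> * (8 / pi) * Ln (w / w0))) holomorphic_on U"
      proof (rule holomorphic_on_compose_gen[OF _ hol, unfolded o_def])
        show "(\<lambda>w. - \<i> * (8 / pi) * Ln w0 - \<i> * (8 / pi) * Ln (w / w0)) holomorphic_on U"
        proof (intro holomorphic_intros)
          show "w / w0 \<notin> \<real>\<^sub>\<le>\<^sub>0" if "w \<in> U" for w
            using that by (auto simp: U_def complex_nonpos_Reals_iff)
        qed (use w0 in auto)
        show "(\<lambda>w. - \<i> * (8 / pi) * Ln w0 - \<i> * (8 / pi) * Ln (w / w0)) ` U \<subseteq> upper_half_plane"
        proof clarify
          fix w assume "w \<in> U"
          then have w: "w \<in> ball 0 1 - {0}" by (simp add: U_def)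
          then show "- \<i> * (8 / pi) * Ln w0 - \<i> * (8 / pi) * Ln (w / w0) \<in> upper_half_plane"
            using nome16_surj(2)[of w w0 "- \<i> * (8 / pi) * Ln w0"] dom[OF w] w0 unfolding upper_half_plane_def by simp
        qed
      qed
      then have "G0 holomorphic_on U"
        by (rule holomorphic_transform) (use G0_eq w0 in \<open>auto simp: U_def\<close>)
      then show ?thesis using \<open>open U\<close> \<open>w0 \<in> U\<close> by (auto simp: holomorphic_on_open)
    qed
    then show ?thesis by (subst holomorphic_on_open) (auto intro: open_Diff)
  qed
  obtain B where "\<forall>\<^sub>F \<tau> in filtercomap Im at_top. norm (g \<tau>) \<le> B" using bdd by (blast elim: BfunE)
  then obtain Y where Y: "\<And>\<tau>. Im \<tau> \<ge> Y \<Longrightarrow> norm (g \<tau>) \<le> B"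
    unfolding eventually_filtercomap eventually_at_top_linorder by blast
  have "\<forall>\<^sub>F w in at 0. norm (G0 w) \<le> B"
  proof -
    have "\<forall>\<^sub>F w in at (0::complex). w \<in> ball 0 (exp (- (pi / 8) * Y)) - {0}"
      by (intro eventually_at_in_open) auto
    then show ?thesis
    proof eventually_elim
      case (elim w)
      then have "ln (norm w) < ln (exp (- (pi / 8) * Y))" by (subst ln_less_cancel_iff) auto
      then have "ln (norm w) < - (pi / 8) * Y" by simp
      then have "Y \<le> - (8 / pi) * ln (norm w)" by (simp add: field_simps)
      then have "Y \<le> Im (- \<i> * (8 / pi) * Ln w)"
        using nome16_surj(2)[of w w "- \<i> * (8 / pi) * Ln w"] elim by simp
      then show ?case unfolding G0_def by (rule Y)
    qed
  qed
  then have "\<exists>G. G holomorphic_on ball 0 1 \<and> (\<forall>w\<in>ball 0 1 - {0}. G w = G0 w)"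
    by (subst holomorphic_on_extend_bounded[OF G0_hol]) auto
  then obtain G where G: "G holomorphic_on ball 0 1" "\<And>w. w \<in> ball 0 1 - {0} \<Longrightarrow> G w = G0 w" by blast
  show ?thesis
  proof (rule that[OF G(1)])
    fix \<tau> assume \<tau>: "\<tau> \<in> upper_half_plane"
    define w where "w = nome16 \<tau>"
    have w: "w \<in> ball 0 1 - {0}" using norm_nome16_less_1[OF \<tau>] by (simp add: w_def)
    have "nome16 (- \<i> * (8 / pi) * Ln w) = w"
      using nome16_surj(1)[of w w "- \<i> * (8 / pi) * Ln w"] w by simp
    then have "g (- \<i> * (8 / pi) * Ln w) = g \<tau>" by (intro eq[OF \<tau>]) (simp add: w_def)
    then show "g \<tau> = G (nome16 \<tau>)" using G(2)[OF w] by (simp add: G0_def w_def)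
  qed
qed

section \<open>Cusp forms are the multiples of \<open>\<eta>\<^bsup>3/2\<^esup>\<close>\<close>

lemma cusp_forms_D:
  assumes "f \<in> cusp_forms Gamma16 k (\<lambda>_. 1)"
  shows "f \<in> modular_forms Gamma16 k (\<lambda>_. 1)"
    "\<gamma> \<in> SL2Z \<Longrightarrow> (cusp_abs k f \<gamma> \<longlongrightarrow> 0) (filtercomap Im at_top)"
  using assms by (simp_all add: cusp_forms_def)

lemma nome16_tendsto_0: "(nome16 \<longlongrightarrow> 0) (filtercomap Im at_top)"
proof -
  have "((\<lambda>t. exp (- (pi * t / 8))) \<longlongrightarrow> 0) at_top" by real_asymp
  then have "((\<lambda>\<tau>. norm (nome16 \<tau>)) \<longlongrightarrow> 0) (filtercomap Im at_top)"
    unfolding norm_nome16 by (rule filterlim_compose[OF _ filterlim_filtercomap])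
  then show ?thesis by (rule tendsto_norm_zero_cancel)
qed

lemma eta32_tendsto_0: "(eta32 \<longlongrightarrow> 0) (filtercomap Im at_top)"
proof -
  have "euler_product32 holomorphic_on ball 0 1"
    by (rule holomorphic_euler_product32[of "\<lambda>z. z" "ball 0 1", simplified])
  then have "isCont euler_product32 0"
    by (intro continuous_on_interior[OF holomorphic_on_imp_continuous_on]) auto
  moreover have "((\<lambda>\<tau>. nome16 \<tau> ^ 16) \<longlongrightarrow> 0 ^ 16) (filtercomap Im at_top)"
    by (intro tendsto_power nome16_tendsto_0)
  ultimately have "((\<lambda>\<tau>. euler_product32 (nome16 \<tau> ^ 16)) \<longlongrightarrow> euler_product32 0) (filtercomap Im at_top)"
    using isCont_tendsto_compose[of "0::complex" euler_product32] by simp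
  from tendsto_mult[OF nome16_tendsto_0 this]
  have "((\<lambda>\<tau>. nome16 \<tau> * euler_product32 (nome16 \<tau> ^ 16)) \<longlongrightarrow> 0) (filtercomap Im at_top)" by simp
  then show ?thesis
    by (rule Lim_transform_eventually)
       (use eventually_upper_half_plane in eventually_elim, simp add: eta32_eq)
qed

text \<open>
  A cusp form vanishes at \<open>w = q\<^bsup>1/16\<^esup> = 0\<close>, and \<open>\<eta>\<^bsup>3/2\<^esup>\<close> is \<open>w\<close> times a function without zeros on the disc, so
  the quotient is holomorphic on the whole disc.
\<close>

lemma cusp_form_quotient_holomorphic:
  assumes f: "f \<in> cusp_forms Gamma16 k (\<lambda>_. 1)" and \<gamma>: "\<gamma> \<in> SL2Z"
  obtains Q where "Q holomorphic_on ball 0 1"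
    "\<And>\<tau>. \<tau> \<in> upper_half_plane \<Longrightarrow> slash_at_cusp k f \<gamma> \<tau> = Q (nome16 \<tau>) * eta32 \<tau>"
proof -
  note fm = cusp_forms_D(1)[OF f]
  let ?g = "slash_at_cusp k f \<gamma>"
  have lim: "(?g \<longlongrightarrow> 0) (filtercomap Im at_top)"
  proof (rule Lim_null_comparison)
    show "\<forall>\<^sub>F \<tau> in filtercomap Im at_top. norm (?g \<tau>) \<le> cusp_abs k f \<gamma> \<tau>"
      using eventually_upper_half_plane by eventually_elim (simp add: norm_slash_at_cusp[OF \<gamma>])
  qed (rule cusp_forms_D(2)[OF f \<gamma>])
  have "\<forall>\<^sub>F \<tau> in filtercomap Im at_top. norm (?g \<tau>) < 1"
    using order_tendstoD(2)[OF tendsto_norm[OF lim], of 1] by simp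
  then have "\<forall>\<^sub>F \<tau> in filtercomap Im at_top. norm (?g \<tau>) \<le> 1"
    by eventually_elim simp
  then have bdd: "Bfun ?g (filtercomap Im at_top)" by (rule BfunI)
  obtain G where G: "G holomorphic_on ball 0 1" "\<And>\<tau>. \<tau> \<in> upper_half_plane \<Longrightarrow> ?g \<tau> = G (nome16 \<tau>)"
    using periodic_factors_through_nome16[OF holomorphic_slash_at_cusp[OF modular_forms_Gamma16_D(1)[OF fm] \<gamma>]
        slash_at_cusp_periodic[OF fm \<gamma>] bdd] by blast
  have "G 0 = 0"
  proof -
    have fl: "filterlim (\<lambda>n::nat. \<i> * of_nat n) (filtercomap Im at_top) sequentially"
      by (simp add: filterlim_filtercomap_iff o_def filterlim_real_sequentially)
    have "isCont G 0" using holomorphic_on_imp_continuous_on[OF G(1)] by (intro continuous_on_interior) auto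
    then have "(\<lambda>n::nat. G (nome16 (\<i> * of_nat n))) \<longlonglongrightarrow> G 0"
      by (rule isCont_tendsto_compose) (rule filterlim_compose[OF nome16_tendsto_0 fl])
    moreover have "(\<lambda>n::nat. G (nome16 (\<i> * of_nat n))) \<longlonglongrightarrow> 0"
    proof (rule Lim_transform_eventually)
      show "(\<lambda>n::nat. ?g (\<i> * of_nat n)) \<longlonglongrightarrow> 0" by (rule filterlim_compose[OF lim fl])
      show "\<forall>\<^sub>F n::nat in sequentially. ?g (\<i> * of_nat n) = G (nome16 (\<i> * of_nat n))"
        using eventually_gt_at_top[of 0] by eventually_elim (intro G(2), simp add: upper_half_plane_def)
    qed
    ultimately show ?thesis by (rule LIMSEQ_unique)
  qed
  define K where "K = (\<lambda>w. if w = 0 then deriv G 0 else (G w - G 0) / (w - 0))"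
  have K: "K holomorphic_on ball 0 1"
    unfolding K_def using G(1) by (rule pole_lemma_open) simp
  show ?thesis
  proof (rule that)
    show "(\<lambda>w. K w / euler_product32 (w ^ 16)) holomorphic_on ball 0 1"
      by (intro holomorphic_intros K) (auto simp: norm_power power_less_one_iff)
    show "?g \<tau> = (K (nome16 \<tau>) / euler_product32 (nome16 \<tau> ^ 16)) * eta32 \<tau>" if "\<tau> \<in> upper_half_plane" for \<tau>
      using that by (simp add: G(2) K_def \<open>G 0 = 0\<close> eta32_eq)
  qed
qed

lemma finite_slash_at_cusp:
  assumes f: "f \<in> modular_forms Gamma16 k (\<lambda>_. 1)"
  shows "finite ((\<lambda>\<gamma>. restrict (slash_at_cusp k f \<gamma>) upper_half_plane) ` SL2Z)"
proof -
  define h where "h = (\<lambda>\<gamma>. restrict (slash_at_cusp k f \<gamma>) upper_half_plane)"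
  define cls :: "int^2^2 \<Rightarrow> int \<times> int \<times> int \<times> int" where
    "cls = (\<lambda>\<gamma>. (\<gamma>$1$1 mod 16, \<gamma>$1$2 mod 16, \<gamma>$2$1 mod 16, \<gamma>$2$2 mod 16))"
  have h_cls: "h \<gamma>' = h \<gamma>" if "\<gamma> \<in> SL2Z" "\<gamma>' \<in> SL2Z" "cls \<gamma>' = cls \<gamma>" for \<gamma> \<gamma>'
  proof -
    have "\<forall>i j. [\<gamma>'$i$j = \<gamma>$i$j] (mod 16)"
      using that(3) unfolding forall_2 cls_def cong_def by simp
    then show ?thesis
      using slash_at_cusp_cong_16[OF f that(1,2)] by (auto simp: h_def restrict_def fun_eq_iff)
  qed
  have "cls ` SL2Z \<subseteq> {0..<16} \<times> {0..<16} \<times> {0..<16} \<times> {0..<16}" by (auto simp: cls_def)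
  then have "finite (cls ` SL2Z)" by (rule finite_subset) auto
  moreover have "h ` SL2Z \<subseteq> (\<lambda>c. h (SOME \<gamma>. \<gamma> \<in> SL2Z \<and> cls \<gamma> = c)) ` (cls ` SL2Z)"
  proof clarify
    fix \<gamma> assume \<gamma>: "\<gamma> \<in> SL2Z"
    define \<gamma>' where "\<gamma>' = (SOME \<gamma>'. \<gamma>' \<in> SL2Z \<and> cls \<gamma>' = cls \<gamma>)"
    have "\<gamma>' \<in> SL2Z \<and> cls \<gamma>' = cls \<gamma>" unfolding \<gamma>'_def by (rule someI[of _ \<gamma>]) (use \<gamma> in simp)
    then have "h \<gamma> = h \<gamma>'" using h_cls \<gamma> by metis
    then show "h \<gamma> \<in> (\<lambda>c. h (SOME \<gamma>. \<gamma> \<in> SL2Z \<and> cls \<gamma> = c)) ` (cls ` SL2Z)"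
      using \<gamma> unfolding \<gamma>'_def by blast
  qed
  ultimately show ?thesis unfolding h_def by (meson finite_imageI finite_subset)
qed

text \<open>
  For one \<open>\<gamma>\<close> the quotient by \<open>\<eta>\<^bsup>3/2\<^esup>\<close> is a continuous function of \<open>w\<close> on a closed disc inside the unit
  disc; the constant can be chosen independently of \<open>\<gamma>\<close> since there are finitely many translates. The bound
  \<open>1/5\<close> is the height to which every point can be moved.
\<close>

lemma cusp_form_bound:
  assumes f: "f \<in> cusp_forms Gamma16 k (\<lambda>_. 1)"
  obtains C where "C > 0" "\<And>\<gamma> \<tau>. \<gamma> \<in> SL2Z \<Longrightarrow> Im \<tau> \<ge> 1 / 5 \<Longrightarrow> cusp_abs k f \<gamma> \<tau> \<le> C * norm (eta32 \<tau>)"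
proof -
  define h where "h = (\<lambda>\<gamma>. restrict (slash_at_cusp k f \<gamma>) upper_half_plane)"
  have "\<forall>u\<in>h ` SL2Z. \<exists>C. \<forall>\<tau>. Im \<tau> \<ge> 1 / 5 \<longrightarrow> norm (u \<tau>) \<le> C * norm (eta32 \<tau>)"
  proof clarify
    fix \<gamma> assume \<gamma>: "\<gamma> \<in> SL2Z"
    obtain Q where Q: "Q holomorphic_on ball 0 1"
      "\<And>\<tau>. \<tau> \<in> upper_half_plane \<Longrightarrow> slash_at_cusp k f \<gamma> \<tau> = Q (nome16 \<tau>) * eta32 \<tau>"
      using cusp_form_quotient_holomorphic[OF f \<gamma>] by blast
    define r where "r = exp (- (pi / 40))"
    have "compact (Q ` cball 0 r)"
    proof (intro compact_continuous_image compact_cball)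
      have "r < 1" by (simp add: r_def)
      then have "cball (0::complex) r \<subseteq> ball 0 1" by auto
      then show "continuous_on (cball 0 r) Q"
        by (rule continuous_on_subset[OF holomorphic_on_imp_continuous_on[OF Q(1)]])
    qed
    then obtain C where C: "\<And>w. w \<in> cball 0 r \<Longrightarrow> norm (Q w) \<le> C"
      using compact_imp_bounded bounded_iff by (metis imageI)
    have "norm (h \<gamma> \<tau>) \<le> C * norm (eta32 \<tau>)" if \<tau>: "Im \<tau> \<ge> 1 / 5" for \<tau>
    proof -
      have H: "\<tau> \<in> upper_half_plane" using \<tau> by (simp add: upper_half_plane_def)
      have "norm (nome16 \<tau>) \<le> r" using \<tau> by (simp add: norm_nome16 r_def)
      then show ?thesis using C[of "nome16 \<tau>"] H
        by (simp add: h_def Q(2)[OF H] norm_mult mult_right_mono)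
    qed
    then show "\<exists>C. \<forall>\<tau>. 1 / 5 \<le> Im \<tau> \<longrightarrow> norm (h \<gamma> \<tau>) \<le> C * norm (eta32 \<tau>)" by blast
  qed
  then obtain c where c: "\<And>u \<tau>. u \<in> h ` SL2Z \<Longrightarrow> Im \<tau> \<ge> 1 / 5 \<Longrightarrow> norm (u \<tau>) \<le> c u * norm (eta32 \<tau>)"
    by metis
  have fin: "finite (h ` SL2Z)" unfolding h_def by (rule finite_slash_at_cusp[OF cusp_forms_D(1)[OF f]])
  define C where "C = 1 + (\<Sum>u\<in>h ` SL2Z. \<bar>c u\<bar>)"
  show ?thesis
  proof (rule that)
    show "C > 0" unfolding C_def by (intro add_pos_nonneg sum_nonneg) auto
    fix \<gamma> \<tau> assume \<gamma>: "\<gamma> \<in> SL2Z" and \<tau>: "1 / 5 \<le> Im \<tau>"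
    then have H: "\<tau> \<in> upper_half_plane" by (simp add: upper_half_plane_def)
    have "\<bar>c (h \<gamma>)\<bar> \<le> (\<Sum>u\<in>h ` SL2Z. \<bar>c u\<bar>)" using \<gamma> by (intro member_le_sum fin) auto
    then have "c (h \<gamma>) \<le> C" by (simp add: C_def)
    have "cusp_abs k f \<gamma> \<tau> = norm (h \<gamma> \<tau>)" using H by (simp add: h_def norm_slash_at_cusp[OF \<gamma>])
    also have "\<dots> \<le> c (h \<gamma>) * norm (eta32 \<tau>)" using \<gamma> \<tau> by (intro c) auto
    also have "\<dots> \<le> C * norm (eta32 \<tau>)" using \<open>c (h \<gamma>) \<le> C\<close> by (intro mult_right_mono) auto
    finally show "cusp_abs k f \<gamma> \<tau> \<le> C * norm (eta32 \<tau>)" .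
  qed
qed

text \<open>
  A weak form of the fundamental domain that is enough for estimates. A lower row \<open>(c, d)\<close> with
  \<open>|c\<tau> + d|\<^sup>2 \<le> 5 Im \<tau>\<close> comes from Dirichlet's approximation of \<open>Re \<tau>\<close> with denominators up to
  \<open>N \<approx> 1 / \<surd>(Im \<tau>)\<close>.
\<close>

lemma SL2Z_reduction:
  assumes \<tau>: "\<tau> \<in> upper_half_plane"
  obtains \<gamma> \<tau>' where "\<gamma> \<in> SL2Z" "Im \<tau>' \<ge> 1 / 5" "mobius \<gamma> \<tau>' = \<tau>"
proof (cases "Im \<tau> \<ge> 1 / 5")
  case True
  show ?thesis by (rule that[of "mat 1" \<tau>]) (use True in \<open>simp_all add: SL2Z_def\<close>)
next
  case False
  define y where "y = Im \<tau>"
  have y: "0 < y" "y < 1 / 5" using \<tau> False by (simp_all add: y_def upper_half_plane_def)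
  define s where "s = 1 / sqrt y"
  have s2: "s ^ 2 = 1 / y" "s > 0" using y by (simp_all add: s_def power_divide)
  have "2 < s"
  proof (rule power2_less_imp_less)
    show "2\<^sup>2 < s\<^sup>2" using y by (simp add: s2 field_simps)
  qed (use s2 in simp)
  define N where "N = nat \<lfloor>s\<rfloor>"
  \<comment> \<open>For \<open>y < 1/4\<close> rounding \<open>s > 2\<close> down loses less than a factor 2.\<close>
  have N: "real N \<le> s" "s < 2 * real N" "N > 0"
    using \<open>2 < s\<close> unfolding N_def by linarith+
  obtain h c where hc: "coprime h c" "0 < c" "c \<le> int N" "\<bar>of_int c * Re \<tau> - of_int h\<bar> < 1 / N"
    using Dirichlet_approx_coprime[OF N(3), of "Re \<tau>"] by blast
  obtain u v where uv: "u * h + v * c = 1" using bezout_int[of h c] hc(1) by auto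
  define \<delta> where "\<delta> = mat2 (- u) (- v) c (- h)"
  have \<delta>: "\<delta> \<in> SL2Z" using uv by (simp add: \<delta>_def SL2Z_det)
  have "(norm (denom \<delta> \<tau>))\<^sup>2 = (of_int c * Re \<tau> - of_int h)\<^sup>2 + (of_int c * y)\<^sup>2"
    by (simp add: cmod_power2 denom_def \<delta>_def y_def)
  also have "\<dots> \<le> (1 / N)\<^sup>2 + (real N * y)\<^sup>2"
  proof (intro add_mono)
    show "(of_int c * Re \<tau> - of_int h)\<^sup>2 \<le> (1 / N)\<^sup>2"
      using hc(4) N by (intro power2_le_iff_abs_le[THEN iffD2]) auto
    show "(of_int c * y)\<^sup>2 \<le> (real N * y)\<^sup>2"
      using hc y by (intro power_mono mult_right_mono) auto
  qed
  also have "(1 / N)\<^sup>2 \<le> 4 * y"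
  proof -
    have "s\<^sup>2 \<le> (2 * real N)\<^sup>2" using N s2 by (intro power_mono) auto
    then have "1 / y \<le> (2 * real N)\<^sup>2" by (simp only: s2)
    then show ?thesis using y N by (simp add: field_simps power2_eq_square)
  qed
  also have "(real N * y)\<^sup>2 \<le> y"
  proof -
    have "(real N)\<^sup>2 \<le> s\<^sup>2" using N by (intro power_mono) auto
    then have "(real N)\<^sup>2 * y * y \<le> 1 * y" using y by (intro mult_right_mono) (simp_all add: s2 field_simps)
    then show ?thesis by (simp add: power2_eq_square mult_ac)
  qed
  finally have "(norm (denom \<delta> \<tau>))\<^sup>2 \<le> 5 * y" by simp
  moreover have "norm (denom \<delta> \<tau>) > 0" using denom_nonzero[OF \<delta> \<tau>] by simp
  ultimately have "Im (mobius \<delta> \<tau>) \<ge> 1 / 5"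
    by (simp add: Im_mobius[OF \<delta>] y_def[symmetric] field_simps)
  moreover have "mobius (adj2 \<delta>) (mobius \<delta> \<tau>) = \<tau>"
    using mobius_mult[OF SL2Z_adj2[OF \<delta>] \<delta> \<tau>] by (simp add: adj2_mult[OF \<delta>])
  ultimately show ?thesis using that SL2Z_adj2[OF \<delta>] by blast
qed

text \<open>
  The bound tends to 0 for \<open>|w| \<rightarrow> 1\<close>; the maximum modulus principle on discs of radius
  \<open>e\<^bsup>-1/(n+1)\<^esup>\<close> carries this to the interior.
\<close>

lemma holomorphic_eq_0_if_boundary_bound:
  assumes Q: "Q holomorphic_on ball 0 1" and e: "e > 0"
    and bound: "\<And>w. w \<in> ball 0 1 - {0} \<Longrightarrow> norm (Q w) \<le> C * (- ln (norm w)) powr e"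
    and w0: "w0 \<in> ball 0 1"
  shows "Q w0 = 0"
proof -
  have "(\<lambda>n. exp (- 1 / real (Suc n))) \<longlonglongrightarrow> 1" by real_asymp
  then have ev: "\<forall>\<^sub>F n in sequentially. norm w0 < exp (- 1 / real (Suc n))"
    using w0 by (intro order_tendstoD) auto
  have "(\<lambda>n. C * (1 / real (Suc n)) powr e) \<longlonglongrightarrow> C * 0"
    by (intro tendsto_mult tendsto_const) (use e in real_asymp)
  moreover have "\<forall>\<^sub>F n in sequentially. norm (Q w0) \<le> C * (1 / real (Suc n)) powr e"
    using ev
  proof eventually_elim
    case (elim n)
    define r where "r = exp (- 1 / real (Suc n))"
    have r: "0 < r" "r < 1" by (simp_all add: r_def)
    show ?case
    proof (rule maximum_modulus_frontier[of Q "cball 0 r"])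
      show "Q holomorphic_on interior (cball 0 r)"
        using Q r by (auto intro: holomorphic_on_subset)
      show "continuous_on (closure (cball 0 r)) Q"
        using holomorphic_on_imp_continuous_on[OF Q] r by (auto intro: continuous_on_subset)
      show "w0 \<in> cball 0 r" using elim by (simp add: r_def)
      fix z :: complex assume "z \<in> frontier (cball 0 r)"
      then have z: "norm z = r" using r by (simp add: frontier_cball)
      then have "norm (Q z) \<le> C * (- ln (norm z)) powr e" using r by (intro bound) auto
      then show "norm (Q z) \<le> C * (1 / real (Suc n)) powr e" by (simp add: z) (simp add: r_def)
    qed auto
  qed
  ultimately have "norm (Q w0) \<le> C * 0"
    by (intro tendsto_lowerbound) auto
  then show ?thesis by simp
qed

text \<open>
  The quotient \<open>Q = f / \<eta>\<^bsup>3/2\<^esup>\<close> has weight \<open>(k - 3)/4 < 0\<close>. For \<open>\<tau> = \<gamma>\<tau>'\<close> with \<open>Im \<tau>' \<ge> 1/5\<close> the uniform bound gives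
  \<open>|Q(\<tau>)| \<le> C |c\<tau>' + d|\<^bsup>(k-3)/4\<^esup>\<close>, and \<open>|c\<tau>' + d|\<^sup>2 = Im \<tau>' / Im \<tau>\<close>. Hence \<open>Q\<close> is bounded by a positive
  power of \<open>Im \<tau>\<close>, that is of \<open>-ln |w|\<close>.
\<close>

lemma no_cusp_forms_small_weight:
  assumes f: "f \<in> cusp_forms Gamma16 k (\<lambda>_. 1)" and k: "k < 3"
  shows "f = (\<lambda>_. 0)"
proof -
  obtain C where C: "C > 0" "\<And>\<gamma> \<tau>. \<gamma> \<in> SL2Z \<Longrightarrow> Im \<tau> \<ge> 1 / 5 \<Longrightarrow> cusp_abs k f \<gamma> \<tau> \<le> C * norm (eta32 \<tau>)"
    using cusp_form_bound[OF f] by blast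
  have one: "mat 1 \<in> SL2Z" by (simp add: SL2Z_def)
  obtain Q where Q: "Q holomorphic_on ball 0 1"
    "\<And>\<tau>. \<tau> \<in> upper_half_plane \<Longrightarrow> slash_at_cusp k f (mat 1) \<tau> = Q (nome16 \<tau>) * eta32 \<tau>"
    using cusp_form_quotient_holomorphic[OF f one] by blast
  have f_eq: "f \<tau> = Q (nome16 \<tau>) * eta32 \<tau>" if "\<tau> \<in> upper_half_plane" for \<tau>
    using Q(2)[OF that] eta32_nonzero[OF that] by (simp add: slash_at_cusp_def eta_factor_def)
  define e where "e = (3 - real k) / 8"
  have e: "e > 0" using k by (simp add: e_def)
  have boundH: "norm (Q (nome16 \<tau>)) \<le> C * (5 * Im \<tau>) powr e" if \<tau>: "\<tau> \<in> upper_half_plane" for \<tau>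
  proof -
    obtain \<gamma> \<tau>' where \<gamma>: "\<gamma> \<in> SL2Z" "Im \<tau>' \<ge> 1 / 5" "mobius \<gamma> \<tau>' = \<tau>" using SL2Z_reduction[OF \<tau>] by blast
    have \<tau>': "\<tau>' \<in> upper_half_plane" using \<gamma>(2) by (simp add: upper_half_plane_def)
    define D where "D = norm (denom \<gamma> \<tau>')"
    have D: "D > 0" using denom_nonzero[OF \<gamma>(1) \<tau>'] by (simp add: D_def)
    have "norm (f \<tau>) = D powr (real k / 4) * cusp_abs k f \<gamma> \<tau>'"
      using D by (simp add: cusp_abs_def \<gamma>(3) D_def[symmetric] powr_minus)
    also have "\<dots> \<le> D powr (real k / 4) * (C * norm (eta32 \<tau>'))"
      by (intro mult_left_mono C \<gamma>) auto
    finally have "norm (Q (nome16 \<tau>)) * norm (eta32 \<tau>) \<le> D powr (real k / 4) * (C * norm (eta32 \<tau>'))"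
      by (simp add: f_eq[OF \<tau>] norm_mult)
    moreover have "norm (eta32 \<tau>) = D powr (3 / 4) * norm (eta32 \<tau>')"
      using norm_eta32_mobius[OF \<gamma>(1) \<tau>'] by (simp add: \<gamma>(3) D_def)
    ultimately have "(norm (Q (nome16 \<tau>)) * D powr (3 / 4)) * norm (eta32 \<tau>') \<le> (D powr (real k / 4) * C) * norm (eta32 \<tau>')"
      by (simp add: mult_ac)
    then have "norm (Q (nome16 \<tau>)) * D powr (3 / 4) \<le> D powr (real k / 4) * C"
      using eta32_nonzero[OF \<tau>'] by (simp add: mult_le_cancel_right)
    then have "norm (Q (nome16 \<tau>)) \<le> C * (D powr (real k / 4) / D powr (3 / 4))"
      using D by (simp add: field_simps)
    also have "D powr (real k / 4) / D powr (3 / 4) = (1 / D\<^sup>2) powr e"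
    proof -
      have "1 / D\<^sup>2 = D powr (- 2)" using D by (simp add: powr_minus_divide)
      then have "(1 / D\<^sup>2) powr e = D powr (- 2 * e)" by (simp add: powr_powr)
      also have "- 2 * e = real k / 4 - 3 / 4" by (simp add: e_def field_simps)
      finally show ?thesis by (simp add: powr_diff)
    qed
    also have "(1 / D\<^sup>2) powr e \<le> (5 * Im \<tau>) powr e"
    proof (rule powr_mono2)
      have "Im \<tau> = Im \<tau>' / D\<^sup>2" using Im_mobius[OF \<gamma>(1), of \<tau>'] by (simp add: \<gamma>(3) D_def)
      then show "1 / D\<^sup>2 \<le> 5 * Im \<tau>" using \<gamma>(2) D by (simp add: divide_right_mono)
    qed (use e in auto)
    finally show ?thesis using C(1) by simp
  qed
  have "Q w = 0" if "w \<in> ball 0 1" for w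
  proof (rule holomorphic_eq_0_if_boundary_bound[OF Q(1) e _ that])
    fix w :: complex assume w: "w \<in> ball 0 1 - {0}"
    define \<tau> where "\<tau> = - \<i> * (8 / pi) * Ln w"
    have \<tau>: "nome16 \<tau> = w" "Im \<tau> = - (8 / pi) * ln (norm w)"
      using nome16_surj[of w w \<tau>] w by (simp_all add: \<tau>_def)
    have ln: "ln (norm w) < 0" using w by simp
    then have "\<tau> \<in> upper_half_plane" unfolding upper_half_plane_def using \<tau>(2) by (simp add: divide_neg_pos)
    from boundH[OF this] have "norm (Q w) \<le> C * (40 / pi * (- ln (norm w))) powr e"
      by (simp add: \<tau>)
    also have "\<dots> = C * (40 / pi) powr e * (- ln (norm w)) powr e"
      using ln by (subst powr_mult) auto
    finally show "norm (Q w) \<le> C * (40 / pi) powr e * (- ln (norm w)) powr e" .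
  qed
  then have "f \<tau> = 0" for \<tau>
    using f_eq[of \<tau>] norm_nome16_less_1[of \<tau>] modular_forms_Gamma16_D(2)[OF cusp_forms_D(1)[OF f], of \<tau>]
    by (cases "\<tau> \<in> upper_half_plane") auto
  then show ?thesis by auto
qed

lemma cusp_abs_times_eta32:
  assumes \<gamma>: "\<gamma> \<in> SL2Z" and \<tau>: "\<tau> \<in> upper_half_plane"
  shows "cusp_abs (k + 3) (\<lambda>\<tau>. h \<tau> * eta32 \<tau>) \<gamma> \<tau> = cusp_abs k h \<gamma> \<tau> * norm (eta32 \<tau>)"
proof -
  define D where "D = norm (denom \<gamma> \<tau>)"
  have D: "D > 0" using denom_nonzero[OF \<gamma> \<tau>] by (simp add: D_def)
  have "D powr (- (real (k + 3) / 4)) * D powr (3 / 4) = D powr (- (real k / 4))"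
    by (simp add: powr_add[symmetric] add_divide_distrib)
  then show ?thesis
    by (simp add: cusp_abs_def norm_mult norm_eta32_mobius[OF \<gamma> \<tau>] D_def[symmetric] mult_ac)
qed

lemma cusp_forms_iff_eta32_multiple:
  "f \<in> cusp_forms Gamma16 (k + 3) (\<lambda>_. 1) \<longleftrightarrow>
     (\<exists>h\<in>modular_forms Gamma16 k (\<lambda>_. 1). f = (\<lambda>\<tau>. h \<tau> * eta32 \<tau>))"
proof
  assume f: "f \<in> cusp_forms Gamma16 (k + 3) (\<lambda>_. 1)"
  note fm = cusp_forms_D(1)[OF f]
  define h where "h = (\<lambda>\<tau>. f \<tau> / eta32 \<tau>)"
  have f_eq: "f = (\<lambda>\<tau>. h \<tau> * eta32 \<tau>)"
  proof
    fix \<tau> show "f \<tau> = h \<tau> * eta32 \<tau>"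
      using eta32_nonzero[of \<tau>] modular_forms_Gamma16_D(2)[OF fm, of \<tau>]
      by (cases "\<tau> \<in> upper_half_plane") (simp_all add: h_def)
  qed
  have "h \<in> automorphic Gamma16 k (\<lambda>_. 1)"
    unfolding automorphic_def
  proof (intro CollectI conjI allI impI ballI)
    show "h holomorphic_on upper_half_plane"
      unfolding h_def by (intro holomorphic_intros modular_forms_Gamma16_D(1)[OF fm] holomorphic_eta32 eta32_nonzero)
    show "h \<tau> = 0" if "\<tau> \<notin> upper_half_plane" for \<tau>
      using modular_forms_Gamma16_D(2)[OF fm that] by (simp add: h_def)
    fix \<gamma> \<tau> assume \<gamma>: "\<gamma> \<in> Gamma16" and \<tau>: "\<tau> \<in> upper_half_plane"
    have "J 3 \<gamma> \<tau> \<noteq> 0" using \<gamma> \<tau> by (intro J_nonzero) (simp_all add: Gamma_principal_def)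
    then show "h (mobius \<gamma> \<tau>) = 1 * J k \<gamma> \<tau> * h \<tau>"
      using modular_forms_Gamma16_D(3)[OF fm \<gamma> \<tau>]
      by (simp add: h_def eta32_Gamma16[OF \<gamma> \<tau>] J_def power_add)
  qed
  moreover have "Bfun (cusp_abs k h \<gamma>) (filtercomap Im at_top)" if \<gamma>: "\<gamma> \<in> SL2Z" for \<gamma>
  proof -
    obtain C where C: "\<And>\<gamma> \<tau>. \<gamma> \<in> SL2Z \<Longrightarrow> Im \<tau> \<ge> 1 / 5 \<Longrightarrow> cusp_abs (k + 3) f \<gamma> \<tau> \<le> C * norm (eta32 \<tau>)"
      using cusp_form_bound[OF f] by blast
    have "\<forall>\<^sub>F \<tau> in filtercomap Im at_top. 1 / 5 \<le> Im \<tau>"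
      by (intro eventually_filtercomapI eventually_ge_at_top)
    then have "\<forall>\<^sub>F \<tau> in filtercomap Im at_top. norm (cusp_abs k h \<gamma> \<tau>) \<le> C"
    proof eventually_elim
      case (elim \<tau>)
      then have \<tau>: "\<tau> \<in> upper_half_plane" by (simp add: upper_half_plane_def)
      have "cusp_abs k h \<gamma> \<tau> * norm (eta32 \<tau>) \<le> C * norm (eta32 \<tau>)"
        using C[OF \<gamma> elim] cusp_abs_times_eta32[OF \<gamma> \<tau>, of k h] by (simp add: f_eq[symmetric])
      moreover have "norm (eta32 \<tau>) > 0" using eta32_nonzero[OF \<tau>] by simp
      ultimately have "cusp_abs k h \<gamma> \<tau> \<le> C" by (simp add: mult_le_cancel_right)
      moreover have "cusp_abs k h \<gamma> \<tau> \<ge> 0" by (simp add: cusp_abs_def)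
      ultimately show ?case by simp
    qed
    then show ?thesis by (rule BfunI)
  qed
  ultimately have "h \<in> modular_forms Gamma16 k (\<lambda>_. 1)" by (simp add: modular_forms_def)
  with f_eq show "\<exists>h\<in>modular_forms Gamma16 k (\<lambda>_. 1). f = (\<lambda>\<tau>. h \<tau> * eta32 \<tau>)" by blast
next
  assume "\<exists>h\<in>modular_forms Gamma16 k (\<lambda>_. 1). f = (\<lambda>\<tau>. h \<tau> * eta32 \<tau>)"
  then obtain h where h: "h \<in> modular_forms Gamma16 k (\<lambda>_. 1)" and f: "f = (\<lambda>\<tau>. h \<tau> * eta32 \<tau>)" by blast
  have "f \<in> automorphic Gamma16 (k + 3) (\<lambda>_. 1)"
    unfolding automorphic_def
  proof (intro CollectI conjI allI impI ballI)
    show "f holomorphic_on upper_half_plane"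
      unfolding f by (intro holomorphic_intros modular_forms_Gamma16_D(1)[OF h] holomorphic_eta32)
    show "f \<tau> = 0" if "\<tau> \<notin> upper_half_plane" for \<tau>
      using that by (simp add: f eta32_def)
    fix \<gamma> \<tau> assume \<gamma>: "\<gamma> \<in> Gamma16" and \<tau>: "\<tau> \<in> upper_half_plane"
    show "f (mobius \<gamma> \<tau>) = 1 * J (k + 3) \<gamma> \<tau> * f \<tau>"
      using modular_forms_Gamma16_D(3)[OF h \<gamma> \<tau>]
      by (simp add: f eta32_Gamma16[OF \<gamma> \<tau>] J_def power_add)
  qed
  moreover have lim: "(cusp_abs (k + 3) f \<gamma> \<longlongrightarrow> 0) (filtercomap Im at_top)" if \<gamma>: "\<gamma> \<in> SL2Z" for \<gamma>
  proof -
    have "((\<lambda>\<tau>. norm (eta32 \<tau>)) \<longlongrightarrow> 0) (filtercomap Im at_top)"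
      using tendsto_norm[OF eta32_tendsto_0] by simp
    then have "Zfun (\<lambda>\<tau>. norm (eta32 \<tau>)) (filtercomap Im at_top)" by (simp add: tendsto_Zfun_iff)
    from bounded_bilinear.Bfun_prod_Zfun[OF bounded_bilinear_mult modular_forms_Gamma16_D(4)[OF h \<gamma>] this]
    have "((\<lambda>\<tau>. cusp_abs k h \<gamma> \<tau> * norm (eta32 \<tau>)) \<longlongrightarrow> 0) (filtercomap Im at_top)"
      by (simp add: tendsto_Zfun_iff)
    then show ?thesis
    proof (rule Lim_transform_eventually)
      show "\<forall>\<^sub>F \<tau> in filtercomap Im at_top. cusp_abs k h \<gamma> \<tau> * norm (eta32 \<tau>) = cusp_abs (k + 3) f \<gamma> \<tau>"
        using eventually_upper_half_plane by eventually_elim (simp add: f cusp_abs_times_eta32[OF \<gamma>])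
    qed
  qed
  moreover have "Bfun (cusp_abs (k + 3) f \<gamma>) (filtercomap Im at_top)" if \<gamma>: "\<gamma> \<in> SL2Z" for \<gamma>
  proof (rule BfunI)
    have "((\<lambda>\<tau>. norm (cusp_abs (k + 3) f \<gamma> \<tau>)) \<longlongrightarrow> 0) (filtercomap Im at_top)"
      using tendsto_norm[OF lim[OF \<gamma>]] by simp
    from order_tendstoD(2)[OF this zero_less_one]
    show "\<forall>\<^sub>F \<tau> in filtercomap Im at_top. norm (cusp_abs (k + 3) f \<gamma> \<tau>) \<le> 1"
      by eventually_elim simp
  qed
  ultimately show "f \<in> cusp_forms Gamma16 (k + 3) (\<lambda>_. 1)"
    by (simp add: cusp_forms_def modular_forms_def)
qed

lemma graded_mult_eta32:
  "graded_mult F (homogeneous 3 eta32) k = (if k < 3 then (\<lambda>_. 0) else (\<lambda>\<tau>. F (k - 3) \<tau> * eta32 \<tau>))"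
proof (cases "k < 3")
  case True
  then have "graded_mult F (homogeneous 3 eta32) k \<tau> = 0" for \<tau>
    unfolding graded_mult_def homogeneous_def by (intro sum.neutral) auto
  then show ?thesis using True by auto
next
  case False
  have "graded_mult F (homogeneous 3 eta32) k \<tau> = F (k - 3) \<tau> * eta32 \<tau>" for \<tau>
  proof -
    have "(\<Sum>i\<le>k. F i \<tau> * homogeneous 3 eta32 (k - i) \<tau>)
        = (\<Sum>i\<le>k. if i = k - 3 then F i \<tau> * eta32 \<tau> else 0)"
      using False by (intro sum.cong refl) (auto simp: homogeneous_def)
    then show ?thesis by (simp add: graded_mult_def)
  qed
  then show ?thesis using False by auto
qed

text \<open>
  In weights \<open>k/4\<close> with \<open>k < 3\<close> the right-hand side is 0 by degree reasons and the left-hand side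
  by \<open>no_cusp_forms_small_weight\<close>.
\<close>

theorem cusp_forms_graded:
  "graded_sum (\<lambda>k. cusp_forms Gamma16 k (\<lambda>_. 1)) =
     (\<lambda>F. graded_mult F (homogeneous 3 eta32)) ` graded_sum (\<lambda>k. modular_forms Gamma16 k (\<lambda>_. 1))"
proof (intro equalityI subsetI)
  fix F assume "F \<in> graded_sum (\<lambda>k. cusp_forms Gamma16 k (\<lambda>_. 1))"
  then have F: "\<And>k. F k \<in> cusp_forms Gamma16 k (\<lambda>_. 1)" and fin: "finite {k. F k \<noteq> (\<lambda>_. 0)}"
    by (simp_all add: graded_sum_def)
  have "\<forall>k. \<exists>h\<in>modular_forms Gamma16 k (\<lambda>_. 1). F (k + 3) = (\<lambda>\<tau>. h \<tau> * eta32 \<tau>)"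
    using F cusp_forms_iff_eta32_multiple by blast
  then obtain H where H: "\<And>k. H k \<in> modular_forms Gamma16 k (\<lambda>_. 1)" "\<And>k. F (k + 3) = (\<lambda>\<tau>. H k \<tau> * eta32 \<tau>)"
    by metis
  have "H k = (\<lambda>_. 0)" if "F (k + 3) = (\<lambda>_. 0)" for k
  proof
    fix \<tau> show "H k \<tau> = 0"
      using fun_cong[OF H(2)[of k], of \<tau>] that eta32_nonzero[of \<tau>] modular_forms_Gamma16_D(2)[OF H(1), of \<tau>]
      by (cases "\<tau> \<in> upper_half_plane") auto
  qed
  then have "{k. H k \<noteq> (\<lambda>_. 0)} \<subseteq> (\<lambda>k. k + 3) -` {k. F k \<noteq> (\<lambda>_. 0)}" by auto
  moreover have "finite ((\<lambda>k. k + 3) -` {k. F k \<noteq> (\<lambda>_. 0)})"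
    by (intro finite_vimageI fin) (auto simp: inj_on_def)
  ultimately have "finite {k. H k \<noteq> (\<lambda>_. 0)}" by (rule finite_subset)
  then have "H \<in> graded_sum (\<lambda>k. modular_forms Gamma16 k (\<lambda>_. 1))"
    using H(1) by (simp add: graded_sum_def)
  moreover have "F = graded_mult H (homogeneous 3 eta32)"
  proof
    fix k show "F k = graded_mult H (homogeneous 3 eta32) k"
      using no_cusp_forms_small_weight[OF F, of k] H(2)[of "k - 3"]
      by (cases "k < 3") (simp_all add: graded_mult_eta32 not_less)
  qed
  ultimately show "F \<in> (\<lambda>F. graded_mult F (homogeneous 3 eta32)) ` graded_sum (\<lambda>k. modular_forms Gamma16 k (\<lambda>_. 1))"
    by blast
next
  fix F assume "F \<in> (\<lambda>F. graded_mult F (homogeneous 3 eta32)) ` graded_sum (\<lambda>k. modular_forms Gamma16 k (\<lambda>_. 1))"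
  then obtain H where H: "\<And>k. H k \<in> modular_forms Gamma16 k (\<lambda>_. 1)" "finite {k. H k \<noteq> (\<lambda>_. 0)}"
    and F: "F = graded_mult H (homogeneous 3 eta32)"
    by (auto simp: graded_sum_def)
  have "F k \<in> cusp_forms Gamma16 k (\<lambda>_. 1)" for k
  proof (cases "k < 3")
    case True
    have "(\<lambda>_. 0) \<in> cusp_forms Gamma16 k (\<lambda>_. 1)"
      by (simp add: cusp_forms_def modular_forms_def automorphic_def cusp_abs_def[abs_def])
    then show ?thesis using True by (simp add: F graded_mult_eta32)
  next
    case False
    then have "(\<lambda>\<tau>. H (k - 3) \<tau> * eta32 \<tau>) \<in> cusp_forms Gamma16 (k - 3 + 3) (\<lambda>_. 1)"
      using cusp_forms_iff_eta32_multiple H(1) by blast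
    then show ?thesis using False by (simp add: F graded_mult_eta32)
  qed
  moreover have "finite {k. F k \<noteq> (\<lambda>_. 0)}"
  proof (rule finite_subset)
    show "{k. F k \<noteq> (\<lambda>_. 0)} \<subseteq> (\<lambda>k. k + 3) ` {k. H k \<noteq> (\<lambda>_. 0)}"
    proof
      fix k assume "k \<in> {k. F k \<noteq> (\<lambda>_. 0)}"
      then have "\<not> k < 3" "H (k - 3) \<noteq> (\<lambda>_. 0)" by (auto simp: F graded_mult_eta32 split: if_splits)
      then show "k \<in> (\<lambda>k. k + 3) ` {k. H k \<noteq> (\<lambda>_. 0)}" by (intro image_eqI[of _ _ "k - 3"]) auto
    qed
  qed (use H(2) in simp)
  ultimately show "F \<in> graded_sum (\<lambda>k. cusp_forms Gamma16 k (\<lambda>_. 1))" by (simp add: graded_sum_def)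
qed

theorem theorem44:
  shows "(\<forall>k. internal_direct_sum {0..3::nat}
                (\<lambda>j. modular_forms_level 16 k (\<lambda>\<gamma>. chi16 (\<gamma>$2$2) ^ j))
                (modular_forms (Gamma_principal 16) k (\<lambda>_. 1))) \<and>
         (\<forall>k. internal_direct_sum ({0..3::nat} \<times> {0..3::nat} \<times> {0..3::nat})
                (\<lambda>(j, l, m). modular_forms_level 4 k (\<lambda>\<gamma>. chi16 (\<gamma>$2$2) ^ j * c16 \<gamma> ^ l * b16 \<gamma> ^ m))
                (modular_forms (Gamma_principal 16) k (\<lambda>_. 1))) \<and>
         graded_sum (\<lambda>k. cusp_forms (Gamma_principal 16) k (\<lambda>_. 1)) =
           (\<lambda>F. graded_mult F (homogeneous 3 eta32)) `
             graded_sum (\<lambda>k. modular_forms (Gamma_principal 16) k (\<lambda>_. 1))"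
  using decomposition_level_16 decomposition_level_4 cusp_forms_graded by blast

end
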